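(* Let $r\in (0,1]$, $p\in [1,\infty )$, $q\in [r,\infty )$ and let $\omega ,v\in \mathscr P_E(\mathbf R^d)$ be such that $\omega$ is $v$-moderate. Then $$W\!L^{1,r}_{(v)}(\mathbf R^d) * W\!L^{p,q}_{(\omega)}(\mathbf R^d) = W\!L^{p,q}_{(\omega)}(\mathbf R^d) * W\!L^{1,r}_{(v)}(\mathbf R^d) = W\!L^{p,q}_{(\omega)}(\mathbf R^d).$$
   Context: A weight on $\mathbf R^d$ is a positive function $\omega$ with $\omega,1/\omega\in L^\infty_{loc}(\mathbf R^d)$. For weights $\omega,v$, $\omega$ is called $v$-moderate if there is a constant $C>0$ with $\omega(x+y)\le C\omega(x)v(y)$ for all $x,y\in\mathbf R^d$; $\mathscr P_E(\mathbf R^d)$ is the set of all weights which are $v$-moderate for some weight $v$. For $p\in[1,\infty]$, $q\in(0,\infty]$ and $\omega\in\mathscr P_E(\mathbf R^d)$, $W\!L^{p,q}_{(\omega)}(\mathbf R^d)$ consists of all measurable functions $f$ on $\mathbf R^d$ such that $$\|f\|_{W\!L^{p,q}_{(\omega)}}\equiv\|\{a_f(k)\,\omega(k)\}_{k\in\mathbf Z^d}\|_{\ell^q(\mathbf Z^d)}<\infty,\qquad a_f(k)=\|f\|_{L^p(k+Q)},\ Q=[0,1]^d.$$ The symbol $*$ is convolution, $(f*g)(x)=\int f(x-y)g(y)\,dy$, and $E*F=\{f*g: f\in E,\ g\in F\}$ for sets $E,F$ (single products). *)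

theory Defs
  imports "HOL-Analysis.Analysis" "HOL-Probability.Essential_Supremum"
begin

definition weight :: "(real ^ 'n \<Rightarrow> real) \<Rightarrow> bool" where
  "weight \<omega> \<longleftrightarrow> (\<forall>x. 0 < \<omega> x) \<and> \<omega> \<in> borel_measurable lebesgue \<and>
     (\<forall>K. compact K \<longrightarrow> (\<exists>B. AE x in lebesgue_on K. \<bar>\<omega> x\<bar> \<le> B) \<and>
                        (\<exists>B. AE x in lebesgue_on K. \<bar>1 / \<omega> x\<bar> \<le> B))"

definition moderate :: "(real ^ 'n \<Rightarrow> real) \<Rightarrow> (real ^ 'n \<Rightarrow> real) \<Rightarrow> bool" where
  "moderate v \<omega> \<longleftrightarrow> (\<exists>C>0. \<forall>x y. \<omega> (x + y) \<le> C * \<omega> x * v y)"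

definition P_E :: "(real ^ 'n \<Rightarrow> real) set" where
  "P_E = {\<omega>. weight \<omega> \<and> (\<exists>v. weight v \<and> moderate v \<omega>)}"

(* Power of an extended nonnegative number, meant for exponents s > 0 only. *)
definition ennpow :: "ennreal \<Rightarrow> real \<Rightarrow> ennreal" where
  "ennpow x s = (if x = \<infinity> then \<infinity> else ennreal (enn2real x powr s))"

(* L^p (quasi-)norm of a measurable function with values in [0,\<infinity>], meant for 0 < p.  For the
   counting measure on a set it is the l^p (quasi-)norm of a family indexed by that set. *)
definition Lp_norm :: "'a measure \<Rightarrow> ennreal \<Rightarrow> ('a \<Rightarrow> ennreal) \<Rightarrow> ennreal" where
  "Lp_norm M p u =
     (if p = \<infinity> then esssup M u
      else ennpow (\<integral>\<^sup>+ x. ennpow (u x) (enn2real p) \<partial>M) (1 / enn2real p))"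

definition int_lattice :: "(real ^ 'n) set" where
  "int_lattice = {k. \<forall>i. k $ i \<in> \<int>}"

definition local_norm :: "ennreal \<Rightarrow> (real ^ 'n \<Rightarrow> complex) \<Rightarrow> real ^ 'n \<Rightarrow> ennreal" where
  "local_norm p f k = Lp_norm (lebesgue_on ((+) k ` cbox 0 1)) p (\<lambda>x. ennreal (norm (f x)))"

definition WL_norm :: "ennreal \<Rightarrow> ennreal \<Rightarrow> (real ^ 'n \<Rightarrow> real) \<Rightarrow> (real ^ 'n \<Rightarrow> complex) \<Rightarrow> ennreal"
  where
  "WL_norm p q \<omega> f = Lp_norm (count_space int_lattice) q (\<lambda>k. local_norm p f k * ennreal (\<omega> k))"

(* The elements are functions, not classes modulo null sets; the set is closed under almost
   everywhere equality. *)
definition WL :: "ennreal \<Rightarrow> ennreal \<Rightarrow> (real ^ 'n \<Rightarrow> real) \<Rightarrow> (real ^ 'n \<Rightarrow> complex) set" where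
  "WL p q \<omega> = {f \<in> borel_measurable lebesgue. WL_norm p q \<omega> f < \<infinity>}"

definition convolution_defined :: "(real ^ 'n \<Rightarrow> complex) \<Rightarrow> (real ^ 'n \<Rightarrow> complex) \<Rightarrow> bool" where
  "convolution_defined f g \<longleftrightarrow> (AE x in lebesgue. integrable lebesgue (\<lambda>y. f (x - y) * g y))"

(* Takes the value 0 wherever the integral does not converge absolutely. *)
definition convolve ::
    "(real ^ 'n \<Rightarrow> complex) \<Rightarrow> (real ^ 'n \<Rightarrow> complex) \<Rightarrow> real ^ 'n \<Rightarrow> complex" where
  "convolve f g x = (LINT y|lebesgue. f (x - y) * g y)"

(* E * F = {f * g : f in E, g in F}, where f * g is determined only up to almost everywhere
   equality, so all representatives are collected. *)
definition conv_set ::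
    "(real ^ 'n \<Rightarrow> complex) set \<Rightarrow> (real ^ 'n \<Rightarrow> complex) set \<Rightarrow> (real ^ 'n \<Rightarrow> complex) set" where
  "conv_set E F = {h. \<exists>f\<in>E. \<exists>g\<in>F. AE x in lebesgue. h x = convolve f g x}"

end

theory Submission
  imports Defs
begin

text \<open>
  The inclusion of the convolution product is a Young inequality: cutting the first factor into
  unit cubes, Jensen's inequality bounds each piece by translates of the local norms of the second
  factor, and the pieces are summed with the \<open>min 1 q\<close>-triangle inequality of the quasi-norm.

  For the factorization, given \<open>h\<close>, choose box bumps \<open>\<phi>\<^sub>0, \<phi>\<^sub>1, \<dots>\<close> of rapidly shrinking support and
  \<open>c < 1\<close> close to 1, and put \<open>\<mu>\<^sub>n = c \<delta> + (1 - c) \<phi>\<^sub>n\<close>. Each \<open>\<mu>\<^sub>n\<close> is invertible by a Neumann series, so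
  \<open>h = (\<mu>\<^sub>0 * \<dots> * \<mu>\<^sub>n) * g\<^sub>n\<close> with \<open>g\<^sub>n\<close> in the amalgam space. In the partial products the Dirac part
  has mass \<open>c ^ (n + 1)\<close>, which tends to 0; since the bumps approximate the identity they can be
  chosen one after the other so that both the absolutely continuous parts and the \<open>g\<^sub>n\<close> converge.
  The limit of the former is an integrable function supported in the unit cube, so the weight
  plays no role for it.
\<close>

subsection \<open>Powers and Lp quasi-norms with values in the extended reals\<close>

text \<open>The construction is Cohen's factorization argument, shaped by three obstacles. For
  \<open>q < 1\<close> there is no norm, so everything is measured by a power of the quasi-norm that
  is countably subadditive; homogeneity of degree \<open>min 1 q\<close> is all that the Neumann
  series needs. Young's inequality costs a constant \<open>K\<close> that depends on the weight and
  may exceed 1, so a bump of mass 1 is not a contraction; the condition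
  \<open>\<theta> powr s * K \<le> 1 / 2\<close> with \<open>c = 1 / (1 + \<theta>)\<close> absorbs
  \<open>K\<close>, and this is what forces \<open>c\<close> close to 1. Finally \<open>r\<close>
  may be less than 1 and \<open>v\<close> may grow, so an integrable limit need not lie in the first
  space; the bumps therefore sit in cubes with corner 0 and sides at most 1/2, 1/4, ..., which keeps
  all partial products in the unit cube, where only finitely many cells matter. That bumps act as an
  approximate identity on the second space rests on dominated convergence, hence on \<open>p\<close>
  and \<open>q\<close> being finite.\<close>

lemma ennpow_top [simp]: "ennpow \<infinity> s = \<infinity>" "ennpow top s = top"
  by (simp_all add: ennpow_def)

lemma ennpow_zero [simp]: "ennpow 0 s = 0"
  by (simp add: ennpow_def)

lemma ennpow_ennreal: "0 \<le> x \<Longrightarrow> ennpow (ennreal x) s = ennreal (x powr s)"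
  by (simp add: ennpow_def)

lemma ennpow_one [simp]: "ennpow x 1 = x"
  by (cases x) (auto simp: ennpow_ennreal)

lemma ennpow_one_base [simp]: "ennpow 1 s = 1"
  using ennpow_ennreal[of 1 s] by simp

lemma ennpow_ennpow: "ennpow (ennpow x a) b = ennpow x (a * b)"
  by (cases x) (auto simp: ennpow_ennreal powr_powr)

lemma ennpow_mono: "x \<le> y \<Longrightarrow> 0 \<le> s \<Longrightarrow> ennpow x s \<le> ennpow y s"
  by (cases x; cases y) (auto simp: ennpow_ennreal intro!: powr_mono2 ennreal_leI simp: top_unique)

lemma ennpow_mult:
  assumes "0 < s"
  shows "ennpow (x * y) s = ennpow x s * ennpow y s"
proof (cases "x = 0 \<or> y = 0")
  case False
  then show ?thesis using assms
    by (cases x; cases y)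
      (auto simp: ennpow_ennreal powr_mult ennreal_mult_top ennreal_top_mult simp flip: ennreal_mult)
qed auto

lemma ennpow_less_top_iff: "ennpow x s < top \<longleftrightarrow> x < top"
  by (cases x) (auto simp: ennpow_ennreal)

lemma ennpow_eq_0_iff: "ennpow x s = 0 \<longleftrightarrow> x = 0"
  by (cases x) (auto simp: ennpow_ennreal)

lemma ennpow_add: "0 < a \<Longrightarrow> 0 \<le> b \<Longrightarrow> ennpow x (a + b) = ennpow x a * ennpow x b"
  by (cases x; cases "x = 0") (auto simp: ennpow_ennreal powr_add simp flip: ennreal_mult)

lemma ennpow_measurable [measurable (raw)]:
  assumes [measurable]: "f \<in> borel_measurable M"
  shows "(\<lambda>x. ennpow (f x) s) \<in> borel_measurable M"
  unfolding ennpow_def by (intro measurable_If) measurable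

lemma ennpow_tendsto_0:
  assumes "(f \<longlongrightarrow> 0) F" "0 < s"
  shows "((\<lambda>x. ennpow (f x) s) \<longlongrightarrow> 0) F"
proof -
  have fin: "\<forall>\<^sub>F x in F. f x < top"
    using order_tendstoD(2)[OF assms(1)] by simp
  have "((\<lambda>x. enn2real (f x)) \<longlongrightarrow> enn2real 0) F"
    by (rule tendsto_enn2real) (use assms in auto)
  then have "((\<lambda>x. enn2real (f x) powr s) \<longlongrightarrow> 0) F"
    using tendsto_powr'[of "\<lambda>x. enn2real (f x)" 0 F "\<lambda>_. s" s] assms(2) by simp
  then have "((\<lambda>x. ennreal (enn2real (f x) powr s)) \<longlongrightarrow> ennreal 0) F"
    by (rule tendsto_ennrealI)
  moreover have "\<forall>\<^sub>F x in F. ennreal (enn2real (f x) powr s) = ennpow (f x) s"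
    using fin by eventually_elim (simp add: ennpow_def)
  ultimately show ?thesis
    by (simp add: tendsto_cong)
qed

text \<open>With \<open>T\<close> the right-hand side, every \<open>ennpow (u i) s\<close> is at
  most \<open>T\<close>, so \<open>u i\<close> is at most \<open>ennpow (u i) s\<close> times the
  power \<open>1 / s - 1\<close> of \<open>T\<close>; summation yields the power
  \<open>1 / s\<close> of \<open>T\<close>.\<close>

lemma ennpow_sum_le:
  assumes s: "0 < s" "s \<le> 1"
  shows "ennpow (\<integral>\<^sup>+ i. u i \<partial>count_space I) s \<le> (\<integral>\<^sup>+ i. ennpow (u i) s \<partial>count_space I)"
proof (cases "(\<integral>\<^sup>+ i. ennpow (u i) s \<partial>count_space I) = top")
  case False
  define T where "T = (\<integral>\<^sup>+ i. ennpow (u i) s \<partial>count_space I)"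
  have T: "ennpow (u i) s \<le> T" if "i \<in> I" for i
    unfolding T_def by (rule nn_integral_ge_point) fact
  have u: "u i \<le> ennpow (u i) s * ennpow T (1 / s - 1)" if "i \<in> I" for i
  proof -
    have "u i = ennpow (ennpow (u i) s) (1 + (1 / s - 1))"
      using s by (simp add: ennpow_ennpow)
    also have "\<dots> = ennpow (u i) s * ennpow (ennpow (u i) s) (1 / s - 1)"
      using s by (subst ennpow_add) auto
    also have "\<dots> \<le> ennpow (u i) s * ennpow T (1 / s - 1)"
      using s by (intro mult_left_mono ennpow_mono T that) auto
    finally show ?thesis .
  qed
  have "(\<integral>\<^sup>+ i. u i \<partial>count_space I) \<le> (\<integral>\<^sup>+ i. ennpow (u i) s * ennpow T (1 / s - 1) \<partial>count_space I)"
    by (intro nn_integral_mono) (use u in auto)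
  also have "\<dots> = T * ennpow T (1 / s - 1)"
    by (simp add: nn_integral_multc T_def)
  also have "\<dots> = ennpow T (1 / s)"
    using s ennpow_add[of 1 "1/s - 1" T] by simp
  finally have "ennpow (\<integral>\<^sup>+ i. u i \<partial>count_space I) s \<le> ennpow (ennpow T (1 / s)) s"
    using s by (intro ennpow_mono) auto
  then show ?thesis
    using s by (simp add: ennpow_ennpow T_def)
qed (simp add: top_unique)

lemma ennpow_sum_ge:
  assumes t: "1 \<le> t"
  shows "(\<integral>\<^sup>+ i. ennpow (u i) t \<partial>count_space I) \<le> ennpow (\<integral>\<^sup>+ i. u i \<partial>count_space I) t"
proof -
  have "ennpow (\<integral>\<^sup>+ i. ennpow (u i) t \<partial>count_space I) (1 / t)
      \<le> (\<integral>\<^sup>+ i. ennpow (ennpow (u i) t) (1 / t) \<partial>count_space I)"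
    using t by (intro ennpow_sum_le) auto
  also have "\<dots> = (\<integral>\<^sup>+ i. u i \<partial>count_space I)"
    using t by (simp add: ennpow_ennpow)
  finally have "ennpow (ennpow (\<integral>\<^sup>+ i. ennpow (u i) t \<partial>count_space I) (1 / t)) t
      \<le> ennpow (\<integral>\<^sup>+ i. u i \<partial>count_space I) t"
    using t by (intro ennpow_mono) auto
  then show ?thesis using t by (simp add: ennpow_ennpow)
qed

text \<open>As a function of \<open>t powr p\<close>, the right-hand side is the tangent of the
  concave p-th root at \<open>c powr p\<close>. The point \<open>c\<close> is left free, to be
  optimized in Jensen's inequality.\<close>

lemma young_powr:
  fixes t c p :: real
  assumes "0 \<le> t" "0 < c" "1 \<le> p"
  shows "t \<le> (c powr (1 - p) / p) * t powr p + (1 - 1 / p) * c"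
proof (cases "t = 0")
  case False
  then have t: "0 < t" using assms by simp
  have "(t powr p * c powr (1 - p)) powr (1 / p) * c powr (1 - 1 / p)
     \<le> (1 / p) * (t powr p * c powr (1 - p)) + (1 - 1 / p) * c"
    using assms t by (intro Youngs_inequality_0) auto
  also have "(t powr p * c powr (1 - p)) powr (1 / p) * c powr (1 - 1 / p)
      = t * (c powr ((1 - p) / p + (1 - 1 / p)))"
    using assms t by (simp add: powr_mult powr_powr powr_add)
  also have "(1 - p) / p + (1 - 1 / p) = 0"
    using assms by (simp add: field_simps)
  finally show ?thesis using assms by (simp add: field_simps)
qed (use assms in auto)

lemma jensen_ennpow:
  assumes [measurable]: "h \<in> borel_measurable M" "G \<in> borel_measurable M"
    and p: "1 \<le> p" and fin: "(\<integral>\<^sup>+ x. h x \<partial>M) < top"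
  shows "ennpow (\<integral>\<^sup>+ x. h x * G x \<partial>M) p
    \<le> ennpow (\<integral>\<^sup>+ x. h x \<partial>M) (p - 1) * (\<integral>\<^sup>+ x. h x * ennpow (G x) p \<partial>M)"
proof -
  define J where "J = (\<integral>\<^sup>+ x. h x * ennpow (G x) p \<partial>M)"
  obtain m where m: "(\<integral>\<^sup>+ x. h x \<partial>M) = ennreal m" "0 \<le> m"
    using fin by (cases "\<integral>\<^sup>+ x. h x \<partial>M") auto
  consider "m = 0 \<or> J = 0" | "m > 0" "J = top" | j where "m > 0" "J = ennreal j" "j > 0"
    using m(2) by (cases J) (auto simp: less_le)
  then show ?thesis
  proof cases
    case 1
    have "AE x in M. h x = 0 \<or> G x = 0"
      using 1
    proof
      assume "m = 0"
      then have "AE x in M. h x = 0"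
        using m by (simp add: nn_integral_0_iff_AE)
      then show ?thesis by auto
    next
      assume "J = 0"
      then have "AE x in M. h x * ennpow (G x) p = 0"
        unfolding J_def by (subst (asm) nn_integral_0_iff_AE) auto
      then show ?thesis by (auto simp: ennpow_eq_0_iff)
    qed
    then have "(\<integral>\<^sup>+ x. h x * G x \<partial>M) = 0"
      by (subst nn_integral_0_iff_AE) auto
    then show ?thesis by simp
  next
    case 2
    then show ?thesis using m
      by (simp add: J_def[symmetric] ennpow_ennreal ennreal_mult_top)
  next
    case 3
    \<comment> \<open>Minimizes the integrated bound \<open>\<alpha> * j + \<beta> * m\<close>;
      there it equals \<open>m * c\<close>, whose p-th power is
      \<open>m powr (p - 1) * j\<close>.\<close>
    define c where "c = (j / m) powr (1 / p)"
    have c: "0 < c" using 3 by (simp add: c_def)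
    have cp: "c powr p = j / m" using 3 p by (simp add: c_def powr_powr)
    define \<alpha> where "\<alpha> = c powr (1 - p) / p"
    define \<beta> where "\<beta> = (1 - 1 / p) * c"
    have \<alpha>\<beta>: "0 \<le> \<alpha>" "0 \<le> \<beta>" "0 < \<alpha>" using p c by (auto simp: \<alpha>_def \<beta>_def)
    have G: "g \<le> ennreal \<alpha> * ennpow g p + ennreal \<beta>" for g
    proof (cases g)
      case (real t)
      then have "t \<le> \<alpha> * t powr p + \<beta>"
        using young_powr[of t c p] c p by (simp add: \<alpha>_def \<beta>_def)
      with real show ?thesis using \<alpha>\<beta>
        by (simp add: ennpow_ennreal flip: ennreal_mult ennreal_plus)
    qed (use \<alpha>\<beta> in \<open>auto simp: ennreal_mult_top\<close>)
    have "(\<integral>\<^sup>+ x. h x * G x \<partial>M)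
        \<le> (\<integral>\<^sup>+ x. ennreal \<alpha> * (h x * ennpow (G x) p) + ennreal \<beta> * h x \<partial>M)"
    proof (intro nn_integral_mono)
      fix x
      have "h x * G x \<le> h x * (ennreal \<alpha> * ennpow (G x) p + ennreal \<beta>)"
        by (intro mult_left_mono G) auto
      then show "h x * G x \<le> ennreal \<alpha> * (h x * ennpow (G x) p) + ennreal \<beta> * h x"
        by (simp add: algebra_simps)
    qed
    also have "\<dots> = ennreal \<alpha> * J + ennreal \<beta> * ennreal m"
      by (simp add: nn_integral_add nn_integral_cmult J_def m)
    also have "\<dots> = ennreal (\<alpha> * j + \<beta> * m)"
      using 3 \<alpha>\<beta> m by (simp flip: ennreal_mult ennreal_plus)
    also have "\<alpha> * j + \<beta> * m = m * c"
    proof -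
      have "c powr (1 - p) * j = c * m"
        using 3 c cp by (simp add: powr_diff field_simps)
      then show ?thesis using p by (simp add: \<alpha>_def \<beta>_def field_simps)
    qed
    finally have "ennpow (\<integral>\<^sup>+ x. h x * G x \<partial>M) p \<le> ennpow (ennreal (m * c)) p"
      using p by (intro ennpow_mono) auto
    also have "\<dots> = ennreal (m powr p * (j / m))"
      using c m by (simp add: ennpow_ennreal powr_mult cp)
    also have "m powr p * (j / m) = m powr (p - 1) * j"
      using 3 by (simp add: powr_diff)
    finally show ?thesis
      using m 3 by (simp add: J_def[symmetric] ennpow_ennreal ennreal_mult)
  qed
qed

lemma borel_measurable_countable_sum:
  fixes f :: "'i \<Rightarrow> 'a \<Rightarrow> ennreal"
  assumes "countable I" and [measurable]: "\<And>i. i \<in> I \<Longrightarrow> f i \<in> borel_measurable M"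
  shows "(\<lambda>x. \<integral>\<^sup>+ i. f i x \<partial>count_space I) \<in> borel_measurable M"
proof cases
  assume "finite I" then show ?thesis
    by (simp add: nn_integral_count_space_finite)
next
  assume "infinite I"
  then have [simp]: "I \<noteq> {}" by auto
  note * = bij_betw_from_nat_into[OF \<open>countable I\<close> \<open>infinite I\<close>]
  have [measurable]: "f (from_nat_into I n) \<in> borel_measurable M" for n
    by (simp add: from_nat_into)
  show ?thesis
    by (simp add: nn_integral_bij_count_space[symmetric, OF *] nn_integral_count_space_nat)
qed

section \<open>Minkowski's inequality and dominated convergence for Lp quasi-norms\<close>

lemma Lp_norm_ennreal:
  "0 < p \<Longrightarrow> Lp_norm M (ennreal p) u = ennpow (\<integral>\<^sup>+ x. ennpow (u x) p \<partial>M) (1 / p)"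
  by (simp add: Lp_norm_def)

lemma Lp_norm_mono_AE:
  assumes "0 < p" "AE x in M. u x \<le> w x"
  shows "Lp_norm M (ennreal p) u \<le> Lp_norm M (ennreal p) w"
proof -
  have "AE x in M. ennpow (u x) p \<le> ennpow (w x) p"
    using assms(2) by eventually_elim (use assms(1) in \<open>auto intro: ennpow_mono\<close>)
  then show ?thesis
    using assms(1) unfolding Lp_norm_ennreal[OF assms(1)]
    by (intro ennpow_mono nn_integral_mono_AE) auto
qed

lemma Lp_norm_cong_AE:
  assumes "0 < p" "AE x in M. u x = w x"
  shows "Lp_norm M (ennreal p) u = Lp_norm M (ennreal p) w"
  using assms by (intro antisym Lp_norm_mono_AE) auto

lemma Lp_norm_cmult:
  assumes p: "0 < p" and [measurable]: "u \<in> borel_measurable M"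
  shows "Lp_norm M (ennreal p) (\<lambda>x. c * u x) = c * Lp_norm M (ennreal p) u"
  using p by (simp add: Lp_norm_ennreal ennpow_mult nn_integral_cmult ennpow_ennpow)

lemma Lp_norm_finite_AE:
  assumes p: "0 < p" and [measurable]: "u \<in> borel_measurable M"
    and "Lp_norm M (ennreal p) u < top"
  shows "AE x in M. u x < top"
proof -
  have "(\<integral>\<^sup>+ x. ennpow (u x) p \<partial>M) < top"
    using assms by (simp add: Lp_norm_ennreal ennpow_less_top_iff)
  then have "AE x in M. ennpow (u x) p \<noteq> \<infinity>"
    by (intro nn_integral_noteq_infinite) auto
  then show ?thesis
    by (rule eventually_mono) (metis ennpow_less_top_iff infinity_ennreal_def less_top)
qed

text \<open>Convexity: divide each \<open>u i\<close> by its norm \<open>a i\<close> and apply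
  Jensen's inequality on \<open>count_space I\<close> with density \<open>a\<close>. The normalized
  terms have p-th powers of integral at most 1, which leaves
  \<open>ennpow A (p - 1) * A\<close>.\<close>

lemma Lp_norm_sum_le:
  assumes p: "1 \<le> p" and I: "countable I"
    and [measurable]: "\<And>i. i \<in> I \<Longrightarrow> u i \<in> borel_measurable M"
  shows "Lp_norm M (ennreal p) (\<lambda>x. \<integral>\<^sup>+ i. u i x \<partial>count_space I)
    \<le> (\<integral>\<^sup>+ i. Lp_norm M (ennreal p) (u i) \<partial>count_space I)"
proof -
  define a where "a i = Lp_norm M (ennreal p) (u i)" for i
  define A where "A = (\<integral>\<^sup>+ i. a i \<partial>count_space I)"
  show ?thesis
  proof (cases "A = top")
    case True
    then show ?thesis by (simp add: A_def a_def)
  next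
    case False
    then have A: "A < top" by (simp add: less_top)
    have a_fin: "a i < top" if "i \<in> I" for i
      using nn_integral_ge_point[OF that, of a] A by (simp add: A_def)
    have a_int: "(\<integral>\<^sup>+ x. ennpow (u i x) p \<partial>M) = ennpow (a i) p" for i
      using p by (simp add: a_def Lp_norm_ennreal ennpow_ennpow)
    \<comment> \<open>Terms of norm 0 must be caught before dividing by \<open>a i\<close>: they
      vanish almost everywhere, and \<open>0 / 0 = 0\<close> in \<open>ennreal\<close>.\<close>
    have null: "AE x in M. a i = 0 \<longrightarrow> u i x = 0" if [measurable]: "i \<in> I" for i
    proof (cases "a i = 0")
      case True
      then have "(\<integral>\<^sup>+ x. ennpow (u i x) p \<partial>M) = 0" using a_int[of i] by simp
      then show ?thesis
        by (subst (asm) nn_integral_0_iff_AE) (auto simp: ennpow_eq_0_iff that)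
    qed auto
    have "AE x in M. \<forall>i\<in>I. a i = 0 \<longrightarrow> u i x = 0"
      using I null by (auto simp: AE_ball_countable)
    then have eq: "AE x in M. (\<integral>\<^sup>+ i. u i x \<partial>count_space I) = (\<integral>\<^sup>+ i. a i * (u i x / a i) \<partial>count_space I)"
    proof eventually_elim
      case (elim x)
      have "u i x = a i * (u i x / a i)" if i: "i \<in> I" for i
      proof (cases "a i = 0")
        case False
        then have "a i * inverse (a i) = 1"
          using a_fin[OF i] by (metis divide_ennreal_def ennreal_divide_self less_top)
        then show ?thesis
          by (simp add: divide_ennreal_def mult.left_commute[of "a i"])
      qed (use elim i in auto)
      then show ?case
        by (intro nn_integral_cong) auto
    qed
    have one: "(\<integral>\<^sup>+ x. ennpow (u i x / a i) p \<partial>M) \<le> 1" if i[measurable]: "i \<in> I" for i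
    proof (cases "a i = 0")
      case True
      then have "(\<integral>\<^sup>+ x. ennpow (u i x / a i) p \<partial>M) = (\<integral>\<^sup>+ x. 0 \<partial>M)"
        using null[OF i] by (intro nn_integral_cong_AE) auto
      then show ?thesis by simp
    next
      case False
      have "(\<integral>\<^sup>+ x. ennpow (u i x / a i) p \<partial>M) = (\<integral>\<^sup>+ x. ennpow (u i x) p * ennpow (inverse (a i)) p \<partial>M)"
        using p by (simp add: divide_ennreal_def ennpow_mult)
      also have "\<dots> = ennpow (a i) p * ennpow (inverse (a i)) p"
        by (subst nn_integral_multc) (auto simp: a_int i)
      also have "\<dots> = ennpow (a i * inverse (a i)) p"
        using p by (simp add: ennpow_mult)
      also have "a i * inverse (a i) = 1"
        using a_fin[OF i] False by (metis divide_ennreal_def ennreal_divide_self less_top)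
      finally show ?thesis by simp
    qed
    have "Lp_norm M (ennreal p) (\<lambda>x. \<integral>\<^sup>+ i. u i x \<partial>count_space I)
        = Lp_norm M (ennreal p) (\<lambda>x. \<integral>\<^sup>+ i. a i * (u i x / a i) \<partial>count_space I)"
      using p by (intro Lp_norm_cong_AE eq) auto
    also have "\<dots> = ennpow (\<integral>\<^sup>+ x. ennpow (\<integral>\<^sup>+ i. a i * (u i x / a i) \<partial>count_space I) p \<partial>M) (1 / p)"
      using p by (simp add: Lp_norm_ennreal)
    also have "\<dots> \<le> ennpow (\<integral>\<^sup>+ x. ennpow A (p - 1) * (\<integral>\<^sup>+ i. a i * ennpow (u i x / a i) p \<partial>count_space I) \<partial>M) (1 / p)"
      using p A unfolding A_def
      by (intro ennpow_mono nn_integral_mono jensen_ennpow) auto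
    also have "(\<integral>\<^sup>+ x. ennpow A (p - 1) * (\<integral>\<^sup>+ i. a i * ennpow (u i x / a i) p \<partial>count_space I) \<partial>M)
        = ennpow A (p - 1) * (\<integral>\<^sup>+ i. \<integral>\<^sup>+ x. a i * ennpow (u i x / a i) p \<partial>M \<partial>count_space I)"
      using I by (subst nn_integral_cmult)
        (auto simp: nn_integral_count_space_nn_integral divide_ennreal_def
           intro!: borel_measurable_countable_sum)
    also have "ennpow \<dots> (1 / p) \<le> ennpow (ennpow A (p - 1) * A) (1 / p)"
    proof (intro ennpow_mono mult_left_mono)
      have "(\<integral>\<^sup>+ x. a i * ennpow (u i x / a i) p \<partial>M) \<le> a i" if i[measurable]: "i \<in> I" for i
      proof -
        have "(\<integral>\<^sup>+ x. a i * ennpow (u i x / a i) p \<partial>M) = a i * (\<integral>\<^sup>+ x. ennpow (u i x / a i) p \<partial>M)"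
          by (intro nn_integral_cmult) (simp add: divide_ennreal_def i)
        also have "\<dots> \<le> a i * 1"
          by (intro mult_left_mono one i) auto
        finally show ?thesis by simp
      qed
      then show "(\<integral>\<^sup>+ i. \<integral>\<^sup>+ x. a i * ennpow (u i x / a i) p \<partial>M \<partial>count_space I) \<le> A"
        unfolding A_def by (intro nn_integral_mono) auto
    qed (use p in auto)
    also have "\<dots> = A"
    proof -
      have "ennpow A (p - 1) * A = ennpow A p"
        using p ennpow_add[of 1 "p - 1" A] by (simp add: mult.commute)
      then show ?thesis using p by (simp add: ennpow_ennpow)
    qed
    finally show ?thesis by (simp add: A_def a_def)
  qed
qed

text \<open>For \<open>q < 1\<close> the triangle inequality fails, but subadditivity of the q-th
  power under the integral restores it for the q-th power of the quasi-norm; \<open>min 1 q\<close>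
  covers both ranges with one exponent.\<close>

lemma Lp_norm_min_sum_le:
  assumes q: "0 < q" and I: "countable I"
    and u: "\<And>i. i \<in> I \<Longrightarrow> u i \<in> borel_measurable M"
  shows "ennpow (Lp_norm M (ennreal q) (\<lambda>x. \<integral>\<^sup>+ i. u i x \<partial>count_space I)) (min 1 q)
    \<le> (\<integral>\<^sup>+ i. ennpow (Lp_norm M (ennreal q) (u i)) (min 1 q) \<partial>count_space I)"
proof (cases "1 \<le> q")
  case True
  then show ?thesis
    using I u by (simp add: Lp_norm_sum_le)
next
  case False
  then have m: "min 1 q = q" by simp
  have "ennpow (Lp_norm M (ennreal q) (\<lambda>x. \<integral>\<^sup>+ i. u i x \<partial>count_space I)) q
      = (\<integral>\<^sup>+ x. ennpow (\<integral>\<^sup>+ i. u i x \<partial>count_space I) q \<partial>M)"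
    using q by (simp add: Lp_norm_ennreal ennpow_ennpow)
  also have "\<dots> \<le> (\<integral>\<^sup>+ x. \<integral>\<^sup>+ i. ennpow (u i x) q \<partial>count_space I \<partial>M)"
    using q False by (intro nn_integral_mono ennpow_sum_le) auto
  also have "\<dots> = (\<integral>\<^sup>+ i. \<integral>\<^sup>+ x. ennpow (u i x) q \<partial>M \<partial>count_space I)"
    using I u by (intro nn_integral_count_space_nn_integral) auto
  also have "\<dots> = (\<integral>\<^sup>+ i. ennpow (Lp_norm M (ennreal q) (u i)) q \<partial>count_space I)"
    using q by (simp add: Lp_norm_ennreal ennpow_ennpow)
  finally show ?thesis by (simp add: m)
qed

lemma Lp_norm_dominated:
  assumes p: "0 < p" and [measurable]: "\<And>n. u n \<in> borel_measurable M" "w \<in> borel_measurable M"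
    and le: "\<And>n. AE x in M. u n x \<le> w x" and w: "Lp_norm M (ennreal p) w < top"
    and lim: "AE x in M. (\<lambda>n. u n x) \<longlonglongrightarrow> 0"
  shows "(\<lambda>n. Lp_norm M (ennreal p) (u n)) \<longlonglongrightarrow> 0"
proof -
  have "(\<lambda>n. \<integral>\<^sup>+ x. ennpow (u n x) p \<partial>M) \<longlonglongrightarrow> (\<integral>\<^sup>+ x. 0 \<partial>M)"
  proof (rule nn_integral_dominated_convergence)
    show "AE x in M. ennpow (u n x) p \<le> ennpow (w x) p" for n
      using le[of n] by eventually_elim (use p in \<open>auto intro: ennpow_mono\<close>)
    show "(\<integral>\<^sup>+ x. ennpow (w x) p \<partial>M) < \<infinity>"
      using w p by (simp add: Lp_norm_ennreal ennpow_less_top_iff)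
    show "AE x in M. (\<lambda>n. ennpow (u n x) p) \<longlonglongrightarrow> 0"
      using lim p by (auto intro: ennpow_tendsto_0)
  qed auto
  then show ?thesis
    using p by (simp add: Lp_norm_ennreal ennpow_tendsto_0)
qed

subsection \<open>Amalgam quasi-norms\<close>

lemma countable_int_lattice: "countable (int_lattice :: (real ^ 'n) set)"
proof (rule countable_subset)
  show "int_lattice \<subseteq> range (\<lambda>g::'n \<Rightarrow> int. (\<chi> i. of_int (g i)) :: real ^ 'n)"
  proof
    fix k :: "real ^ 'n" assume "k \<in> int_lattice"
    then have "k = (\<chi> i. of_int \<lfloor>k $ i\<rfloor>)"
      by (auto simp: int_lattice_def vec_eq_iff)
    then show "k \<in> range (\<lambda>g::'n \<Rightarrow> int. (\<chi> i. of_int (g i)) :: real ^ 'n)"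
      by (rule range_eqI[where x = "\<lambda>i. \<lfloor>k $ i\<rfloor>"])
  qed
qed auto

lemma int_lattice_add: "k \<in> int_lattice \<Longrightarrow> l \<in> int_lattice \<Longrightarrow> k + l \<in> int_lattice"
  and int_lattice_diff: "k \<in> int_lattice \<Longrightarrow> l \<in> int_lattice \<Longrightarrow> k - l \<in> int_lattice"
  by (auto simp: int_lattice_def)

lemma mem_cell: "x \<in> (+) k ` cbox 0 1 \<longleftrightarrow> (\<forall>i. k $ i \<le> x $ i \<and> x $ i \<le> k $ i + 1)"
  for k x :: "real ^ 'n"
proof -
  have "(+) k ` cbox 0 1 = cbox k (k + 1)"
    using cbox_translation[of k 0 1] by simp
  then show ?thesis by (auto simp: mem_box_cart)
qed

lemma sets_cell [measurable, simp]: "(+) k ` cbox 0 1 \<in> sets borel" for k :: "real ^ 'n"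
proof -
  have "(+) k ` cbox 0 1 = cbox k (k + 1)"
    using cbox_translation[of k 0 1] by simp
  then show ?thesis by simp
qed

lemma sets_cell_lebesgue [measurable, simp]: "(+) k ` cbox 0 1 \<in> sets lebesgue" for k :: "real ^ 'n"
  using sets_cell[of k] by (intro sets_completionI_sets) simp

lemma cells_cover:
  fixes x :: "real ^ 'n"
  obtains k where "k \<in> int_lattice" "x \<in> (+) k ` cbox 0 1"
proof -
  have "(\<chi> i. of_int \<lfloor>x $ i\<rfloor>) \<in> (int_lattice :: (real ^ 'n) set)"
    by (auto simp: int_lattice_def)
  moreover have "x \<in> (+) (\<chi> i. of_int \<lfloor>x $ i\<rfloor>) ` cbox 0 1"
    unfolding mem_cell by (simp add: real_of_int_floor_add_one_ge)
  ultimately show thesis by (rule that)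
qed

lemma finite_cells_meeting:
  assumes "bounded (S :: (real ^ 'n) set)"
  shows "finite {k \<in> int_lattice. (+) k ` cbox 0 1 \<inter> S \<noteq> {}}"
proof -
  obtain B where B: "\<And>x. x \<in> S \<Longrightarrow> norm x \<le> B"
    using assms by (auto simp: bounded_iff)
  define m where "m = \<lceil>B\<rceil> + 1"
  show ?thesis
  proof (rule finite_subset)
    show "finite ((\<lambda>g::'n \<Rightarrow> int. (\<chi> i. of_int (g i)) :: real ^ 'n) ` (PiE UNIV (\<lambda>_. {-m..m})))"
      by (intro finite_imageI finite_PiE) auto
    show "{k \<in> int_lattice. (+) k ` cbox 0 1 \<inter> S \<noteq> {}}
      \<subseteq> (\<lambda>g::'n \<Rightarrow> int. (\<chi> i. of_int (g i)) :: real ^ 'n) ` (PiE UNIV (\<lambda>_. {-m..m}))"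
    proof
      fix k assume "k \<in> {k \<in> int_lattice. (+) k ` cbox 0 1 \<inter> S \<noteq> {}}"
      then obtain x where k: "k \<in> int_lattice" and x: "x \<in> (+) k ` cbox 0 1" "x \<in> S"
        by blast
      have eq: "k = (\<chi> i. of_int \<lfloor>k $ i\<rfloor>)"
        using k by (auto simp: int_lattice_def vec_eq_iff)
      have "\<lfloor>k $ i\<rfloor> \<in> {-m..m}" for i
      proof -
        have "\<bar>x $ i\<bar> \<le> B" using B[OF x(2)] component_le_norm_cart[of x i] by linarith
        moreover have "k $ i \<le> x $ i" "x $ i \<le> k $ i + 1"
          using x(1) by (auto simp: mem_cell)
        ultimately show ?thesis unfolding m_def by (auto; linarith)
      qed
      then show "k \<in> (\<lambda>g::'n \<Rightarrow> int. (\<chi> i. of_int (g i)) :: real ^ 'n) ` (PiE UNIV (\<lambda>_. {-m..m}))"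
        by (subst eq) (auto intro!: image_eqI[where x = "\<lambda>i. \<lfloor>k $ i\<rfloor>"])
    qed
  qed
qed

text \<open>The power \<open>min 1 q\<close> is built in because it is countably subadditive for
  every \<open>q\<close>; the price is homogeneity of degree \<open>min 1 q\<close>. Arguments take
  values in the extended nonnegative numbers, so that infinite sums and convolutions always
  exist.\<close>

definition amalgam_norm ::
    "real \<Rightarrow> real \<Rightarrow> (real ^ 'n \<Rightarrow> real) \<Rightarrow> (real ^ 'n \<Rightarrow> ennreal) \<Rightarrow> ennreal" where
  "amalgam_norm p q \<omega> F = ennpow (Lp_norm (count_space int_lattice) (ennreal q)
     (\<lambda>k. Lp_norm (lebesgue_on ((+) k ` cbox 0 1)) (ennreal p) F * ennreal (\<omega> k))) (min 1 q)"

lemma WL_iff: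
  assumes "0 < q"
  shows "f \<in> WL (ennreal p) (ennreal q) \<omega> \<longleftrightarrow>
    f \<in> borel_measurable lebesgue \<and> amalgam_norm p q \<omega> (\<lambda>x. ennreal (norm (f x))) < top"
  using assms by (simp add: WL_def WL_norm_def local_norm_def amalgam_norm_def ennpow_less_top_iff)

lemma AE_lebesgue_on_cell:
  "AE x in lebesgue. P x \<Longrightarrow> AE x in lebesgue_on ((+) k ` cbox 0 1). P x" for k :: "real ^ 'n"
  by (auto simp: AE_restrict_space_iff)

lemma measurable_cell:
  "F \<in> borel_measurable lebesgue \<Longrightarrow> F \<in> borel_measurable (lebesgue_on ((+) k ` cbox 0 1))"
  for k :: "real ^ 'n"
  by (rule measurable_restrict_space1)

lemma AE_all_cells:
  assumes "\<And>k. k \<in> int_lattice \<Longrightarrow> AE x in lebesgue_on ((+) k ` cbox 0 1). P x"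
  shows "AE x in lebesgue. P (x :: real ^ 'n)"
proof -
  have "AE x in lebesgue. \<forall>k\<in>int_lattice. x \<in> (+) k ` cbox 0 1 \<longrightarrow> P x"
    using assms countable_int_lattice
    by (intro AE_ball_countable') (auto simp: AE_restrict_space_iff)
  then show ?thesis
    by (rule eventually_mono) (metis cells_cover)
qed

locale amalgam =
  fixes p q :: real and \<omega> :: "real ^ 'n \<Rightarrow> real"
  assumes p: "1 \<le> p" and q: "0 < q" and pos: "\<And>x. 0 < \<omega> x"
begin

abbreviation "s \<equiv> min 1 q"
abbreviation "\<nu> \<equiv> amalgam_norm p q \<omega>"
abbreviation "loc F k \<equiv> Lp_norm (lebesgue_on ((+) k ` cbox 0 1)) (ennreal p) F"

lemma s_pos: "0 < s" using q by simp

lemma mono_AE: "AE x in lebesgue. F x \<le> G x \<Longrightarrow> \<nu> F \<le> \<nu> G"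
  unfolding amalgam_norm_def using p q
  by (intro ennpow_mono Lp_norm_mono_AE[of q, OF _ AE_I2] Lp_norm_mono_AE[of p] mult_right_mono
      AE_lebesgue_on_cell) simp_all

lemma cong_AE: "AE x in lebesgue. F x = G x \<Longrightarrow> \<nu> F = \<nu> G"
  by (intro antisym mono_AE) auto

lemma mono: "(\<And>x. F x \<le> G x) \<Longrightarrow> \<nu> F \<le> \<nu> G"
  by (intro mono_AE) auto

lemma cmult:
  assumes "F \<in> borel_measurable lebesgue"
  shows "\<nu> (\<lambda>x. c * F x) = ennpow c s * \<nu> F"
  unfolding amalgam_norm_def using p q
  by (simp add: Lp_norm_cmult measurable_cell assms mult.assoc ennpow_mult)

lemma countable_sum:
  assumes I: "countable I" and F: "\<And>i. i \<in> I \<Longrightarrow> F i \<in> borel_measurable lebesgue"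
  shows "\<nu> (\<lambda>x. \<integral>\<^sup>+ i. F i x \<partial>count_space I) \<le> (\<integral>\<^sup>+ i. \<nu> (F i) \<partial>count_space I)"
proof -
  have loc: "loc (\<lambda>x. \<integral>\<^sup>+ i. F i x \<partial>count_space I) k * ennreal (\<omega> k)
      \<le> (\<integral>\<^sup>+ i. loc (F i) k * ennreal (\<omega> k) \<partial>count_space I)" for k
  proof -
    have "loc (\<lambda>x. \<integral>\<^sup>+ i. F i x \<partial>count_space I) k \<le> (\<integral>\<^sup>+ i. loc (F i) k \<partial>count_space I)"
      using p I F by (intro Lp_norm_sum_le measurable_cell) auto
    then show ?thesis by (simp add: nn_integral_multc mult_right_mono)
  qed
  define L where "L = (count_space (int_lattice :: (real ^ 'n) set))"
  define a where "a i k = loc (F i) k * ennreal (\<omega> k)" for i k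
  have am: "a i \<in> borel_measurable L" for i by (simp add: L_def)
  have le: "\<nu> (\<lambda>x. \<integral>\<^sup>+ i. F i x \<partial>count_space I)
      \<le> ennpow (Lp_norm L (ennreal q) (\<lambda>k. \<integral>\<^sup>+ i. a i k \<partial>count_space I)) s"
    unfolding amalgam_norm_def L_def a_def using p q
    by (intro ennpow_mono Lp_norm_mono_AE AE_I2 loc) auto
  also have "\<dots> \<le> (\<integral>\<^sup>+ i. ennpow (Lp_norm L (ennreal q) (a i)) s \<partial>count_space I)"
    using I q am by (intro Lp_norm_min_sum_le) auto
  finally show ?thesis
    unfolding amalgam_norm_def L_def a_def[abs_def] .
qed

lemma suminf:
  assumes "\<And>i. F i \<in> borel_measurable lebesgue"
  shows "\<nu> (\<lambda>x. \<Sum>i. F i x) \<le> (\<Sum>i. \<nu> (F i))"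
  using countable_sum[of UNIV F] assms by (simp add: nn_integral_count_space_nat)

lemma finite_AE:
  assumes F: "F \<in> borel_measurable lebesgue" and fin: "\<nu> F < top"
  shows "AE x in lebesgue. F x < top"
proof (rule AE_all_cells)
  fix k :: "real ^ 'n" assume k: "k \<in> int_lattice"
  have "(AE k in count_space int_lattice. loc F k * ennreal (\<omega> k) < top)"
    using fin q by (intro Lp_norm_finite_AE[of q]) (auto simp: amalgam_norm_def ennpow_less_top_iff)
  then have "loc F k * ennreal (\<omega> k) < top"
    using k by (auto simp: AE_count_space)
  then have "loc F k < top"
    using pos[of k] by (auto simp: ennreal_mult_less_top)
  then show "AE x in lebesgue_on ((+) k ` cbox 0 1). F x < top"
    using p F by (intro Lp_norm_finite_AE[of p] measurable_cell) auto
qed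

text \<open>Dominated convergence is used twice: inside each cell, then over the lattice, where the
  weighted local norms of \<open>G\<close> form the majorant. Both uses rely on finite
  exponents.\<close>

lemma dominated:
  assumes F: "\<And>n. F n \<in> borel_measurable lebesgue" "G \<in> borel_measurable lebesgue"
    and le: "\<And>n. AE x in lebesgue. F n x \<le> G x" and G: "\<nu> G < top"
    and lim: "AE x in lebesgue. (\<lambda>n. F n x) \<longlonglongrightarrow> 0"
  shows "(\<lambda>n. \<nu> (F n)) \<longlonglongrightarrow> 0"
proof -
  have Gfin: "Lp_norm (count_space int_lattice) (ennreal q) (\<lambda>k. loc G k * ennreal (\<omega> k)) < top"
    using G by (simp add: amalgam_norm_def ennpow_less_top_iff)
  then have "(AE k in count_space int_lattice. loc G k * ennreal (\<omega> k) < top)"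
    using q by (intro Lp_norm_finite_AE[of q]) auto
  then have G': "loc G k < top" if "k \<in> int_lattice" for k
    using that pos[of k] by (auto simp: AE_count_space ennreal_mult_less_top)
  have loc: "(\<lambda>n. loc (F n) k) \<longlonglongrightarrow> 0" if "k \<in> int_lattice" for k
  proof (rule Lp_norm_dominated)
    show "loc G k < top" using G' that by simp
  qed (use p F le lim in \<open>auto intro: measurable_cell AE_lebesgue_on_cell\<close>)
  have "(\<lambda>n. Lp_norm (count_space int_lattice) (ennreal q) (\<lambda>k. loc (F n) k * ennreal (\<omega> k))) \<longlonglongrightarrow> 0"
  proof (rule Lp_norm_dominated)
    show "AE k in count_space int_lattice. loc (F n) k * ennreal (\<omega> k) \<le> loc G k * ennreal (\<omega> k)" for n
      using p by (intro AE_I2 mult_right_mono Lp_norm_mono_AE AE_lebesgue_on_cell le) auto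
    have "(\<lambda>n. loc (F n) k * ennreal (\<omega> k)) \<longlonglongrightarrow> 0" if "k \<in> int_lattice" for k
      using ennreal_tendsto_cmult[OF _ loc[OF that], of "ennreal (\<omega> k)"] by (simp add: mult.commute)
    then show "AE k in count_space int_lattice. (\<lambda>n. loc (F n) k * ennreal (\<omega> k)) \<longlonglongrightarrow> 0"
      by (auto simp: AE_count_space)
  qed (use q Gfin in auto)
  then show ?thesis
    unfolding amalgam_norm_def by (intro ennpow_tendsto_0 s_pos)
qed

text \<open>Only finitely many cells meet \<open>S\<close>, so the weight enters through finitely
  many values.\<close>

lemma finite_bounded_support:
  assumes F: "F \<in> borel_measurable lebesgue"
    and S: "bounded S" "\<And>x. x \<notin> S \<Longrightarrow> F x = 0"
    and fin: "(\<integral>\<^sup>+ x. ennpow (F x) p \<partial>lebesgue) < top"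
  shows "\<nu> F < top"
proof -
  define K where "K = {k \<in> int_lattice. (+) k ` cbox 0 1 \<inter> S \<noteq> {}}"
  have K: "finite K" "K \<subseteq> int_lattice"
    using finite_cells_meeting[OF S(1)] by (auto simp: K_def)
  have loc0: "loc F k = 0" if "k \<in> int_lattice" "k \<notin> K" for k
  proof -
    have "loc F k = loc (\<lambda>_. 0) k"
      using p S that by (intro Lp_norm_cong_AE) (auto simp: K_def AE_restrict_space_iff)
    then show ?thesis using p by (simp add: Lp_norm_ennreal)
  qed
  have locfin: "loc F k < top" for k
  proof -
    have "(\<integral>\<^sup>+ x. ennpow (F x) p \<partial>lebesgue_on ((+) k ` cbox 0 1)) \<le> (\<integral>\<^sup>+ x. ennpow (F x) p \<partial>lebesgue)"
      by (subst nn_integral_restrict_space) (auto intro!: nn_integral_mono simp: indicator_def)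
    with fin have "(\<integral>\<^sup>+ x. ennpow (F x) p \<partial>lebesgue_on ((+) k ` cbox 0 1)) < top"
      by (rule order.strict_trans1[rotated])
    then show ?thesis using p by (simp add: Lp_norm_ennreal ennpow_less_top_iff)
  qed
  have "(\<integral>\<^sup>+ k. ennpow (loc F k * ennreal (\<omega> k)) q \<partial>count_space int_lattice)
      = (\<Sum>k\<in>K. ennpow (loc F k * ennreal (\<omega> k)) q)"
    using K loc0 by (intro nn_integral_count_space') auto
  also have "\<dots> < top"
    using K locfin by (auto simp: ennpow_less_top_iff ennreal_mult_less_top)
  finally show ?thesis
    using q by (simp add: amalgam_norm_def Lp_norm_ennreal ennpow_less_top_iff)
qed

end

subsection \<open>Convolution of nonnegative functions\<close>

lemma lborel_distr_reflect: "distr lborel borel (\<lambda>y. x - y) = (lborel :: 'a::euclidean_space measure)"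
proof -
  have "(lborel :: 'a measure) = density (distr lborel borel (\<lambda>y. x - y)) (\<lambda>_. 1)"
    using lborel_affine[of "-1" x] by simp
  then show ?thesis by (simp add: density_1)
qed

lemma nn_integral_lborel_reflect:
  fixes f :: "'a::euclidean_space \<Rightarrow> ennreal"
  assumes [measurable]: "f \<in> borel_measurable borel"
  shows "(\<integral>\<^sup>+ y. f (x - y) \<partial>lborel) = (\<integral>\<^sup>+ y. f y \<partial>lborel)"
  by (subst lborel_distr_reflect[of x, symmetric], subst nn_integral_distr) simp_all

lemma nn_integral_lborel_translate:
  fixes f :: "'a::euclidean_space \<Rightarrow> ennreal"
  assumes [measurable]: "f \<in> borel_measurable borel"
  shows "(\<integral>\<^sup>+ x. f (x - y) \<partial>lborel) = (\<integral>\<^sup>+ x. f x \<partial>lborel)"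
proof -
  have "(\<integral>\<^sup>+ x. f x \<partial>lborel) = (\<integral>\<^sup>+ x. f x \<partial>distr lborel borel ((+) (- y)))"
    by (simp add: lborel_distr_plus)
  also have "\<dots> = (\<integral>\<^sup>+ x. f (x - y) \<partial>lborel)"
    by (subst nn_integral_distr) simp_all
  finally show ?thesis ..
qed

lemma integral_lborel_reflect:
  fixes f :: "'a::euclidean_space \<Rightarrow> 'b::{banach, second_countable_topology}"
  assumes [measurable]: "f \<in> borel_measurable borel"
  shows "(LINT y|lborel. f (x - y)) = (LINT y|lborel. f y)"
  by (subst (2) lborel_distr_reflect[of x, symmetric], subst integral_distr) simp_all

lemma AE_lborel_reflect:
  fixes P :: "'a::euclidean_space \<Rightarrow> bool"
  assumes "AE y in lborel. P y"
  shows "AE y in lborel. P (x - y)"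
proof -
  have "AE y in distr lborel borel (\<lambda>y. x - y). P y"
    using assms by (subst lborel_distr_reflect)
  then show ?thesis
    by (rule AE_distrD[rotated]) simp
qed

definition nnconv ::
    "('a::euclidean_space \<Rightarrow> ennreal) \<Rightarrow> ('a \<Rightarrow> ennreal) \<Rightarrow> 'a \<Rightarrow> ennreal" where
  "nnconv f g x = (\<integral>\<^sup>+ y. f (x - y) * g y \<partial>lborel)"

lemma nnconv_measurable [measurable]:
  fixes f g :: "'a::euclidean_space \<Rightarrow> ennreal"
  assumes [measurable]: "f \<in> borel_measurable borel" "g \<in> borel_measurable borel"
  shows "nnconv f g \<in> borel_measurable borel"
  unfolding nnconv_def[abs_def] by measurable

lemma nnconv_commute:
  fixes f g :: "'a::euclidean_space \<Rightarrow> ennreal"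
  assumes [measurable]: "f \<in> borel_measurable borel" "g \<in> borel_measurable borel"
  shows "nnconv f g x = nnconv g f x"
  unfolding nnconv_def
  by (subst nn_integral_lborel_reflect[of _ x, symmetric]) (simp_all add: mult.commute)

lemma borel_imp_lebesgue: "f \<in> borel_measurable borel \<Longrightarrow> f \<in> borel_measurable lebesgue"
  by (intro measurable_completion) simp

section \<open>Young's inequality, cell by cell\<close>

lemma nn_integral_cell:
  fixes k :: "real ^ 'n"
  shows "(\<integral>\<^sup>+ x. F x \<partial>lebesgue_on ((+) k ` cbox 0 1))
    = (\<integral>\<^sup>+ x. F x * indicator ((+) k ` cbox 0 1) x \<partial>lborel)"
  by (subst nn_integral_restrict_space) (simp_all add: nn_integral_completion)

text \<open>The lattice points with all coordinates in {-1, 0}: the offsets of the cells that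
  together fill the cube from -1 to 1.\<close>

definition nbhd :: "(real ^ 'n) set" where
  "nbhd = {e \<in> int_lattice. 0 \<in> (+) e ` cbox 0 1}"

lemma finite_nbhd [simp]: "finite (nbhd :: (real ^ 'n) set)"
proof -
  have "nbhd = {k \<in> int_lattice :: (real ^ 'n) set. (+) k ` cbox 0 1 \<inter> {0} \<noteq> {}}"
    by (auto simp: nbhd_def)
  then show ?thesis using finite_cells_meeting[of "{0 :: real ^ 'n}"] by simp
qed

text \<open>The difference of the cells at \<open>k\<close> and \<open>j\<close> is
  \<open>k - j\<close> plus the cube from -1 to 1; the sign of each coordinate of
  \<open>y - (k - j)\<close> selects the offset.\<close>

lemma diff_cells_subset:
  fixes x y j k :: "real ^ 'n"
  assumes "x \<in> (+) k ` cbox 0 1" "x - y \<in> (+) j ` cbox 0 1"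
  obtains e where "e \<in> nbhd" "y \<in> (+) (k - j + e) ` cbox 0 1"
proof -
  define e :: "real ^ 'n" where "e = (\<chi> i. if y $ i < (k - j) $ i then -1 else 0)"
  have "e \<in> nbhd"
    unfolding nbhd_def mem_Collect_eq mem_cell by (auto simp: e_def int_lattice_def)
  moreover have "y \<in> (+) (k - j + e) ` cbox 0 1"
    using assms unfolding mem_cell by (auto simp: e_def; smt (verit))
  ultimately show thesis by (rule that)
qed

lemma Lp_norm_nnconv_cell:
  fixes f G :: "real ^ 'n \<Rightarrow> ennreal" and k j :: "real ^ 'n"
  assumes p: "1 \<le> p"
    and [measurable]: "f \<in> borel_measurable borel" "G \<in> borel_measurable borel"
    and supp: "\<And>z. f z \<noteq> 0 \<Longrightarrow> z \<in> (+) j ` cbox 0 1"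
    and fin: "(\<integral>\<^sup>+ z. f z \<partial>lborel) < top"
  shows "Lp_norm (lebesgue_on ((+) k ` cbox 0 1)) (ennreal p) (nnconv f G)
    \<le> (\<integral>\<^sup>+ z. f z \<partial>lborel) *
      (\<Sum>e\<in>nbhd. Lp_norm (lebesgue_on ((+) (k - j + e) ` cbox 0 1)) (ennreal p) G)"
proof -
  define m where "m = (\<integral>\<^sup>+ z. f z \<partial>lborel)"
  \<comment> \<open>Restricts the p-th power of \<open>G\<close> to the cells that can contribute
    when \<open>x\<close> lies in cell \<open>k\<close>. It does not depend on \<open>x\<close>, so
    Fubini's theorem separates it from \<open>f\<close>; overlaps of cells only enlarge it.\<close>
  define H where "H y = (\<Sum>e\<in>nbhd. ennpow (G y) p * indicator ((+) (k - j + e) ` cbox 0 1) y)" for y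
  have [measurable]: "H \<in> borel_measurable borel"
    unfolding H_def[abs_def] by measurable
  have pt: "ennpow (nnconv f G x) p * indicator ((+) k ` cbox 0 1) x
      \<le> ennpow m (p - 1) * (\<integral>\<^sup>+ y. f (x - y) * H y \<partial>lborel)" for x
  proof (cases "x \<in> (+) k ` cbox 0 1")
    case True
    have "ennpow (nnconv f G x) p
        \<le> ennpow (\<integral>\<^sup>+ y. f (x - y) \<partial>lborel) (p - 1) * (\<integral>\<^sup>+ y. f (x - y) * ennpow (G y) p \<partial>lborel)"
      unfolding nnconv_def using p fin
      by (intro jensen_ennpow) (simp_all add: nn_integral_lborel_reflect)
    also have "(\<integral>\<^sup>+ y. f (x - y) \<partial>lborel) = m"
      by (simp add: nn_integral_lborel_reflect m_def)
    also have "ennpow m (p - 1) * (\<integral>\<^sup>+ y. f (x - y) * ennpow (G y) p \<partial>lborel)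
        \<le> ennpow m (p - 1) * (\<integral>\<^sup>+ y. f (x - y) * H y \<partial>lborel)"
    proof (rule mult_left_mono, rule nn_integral_mono)
      fix y
      show "f (x - y) * ennpow (G y) p \<le> f (x - y) * H y"
      proof (cases "f (x - y) = 0")
        case False
        then obtain e where e: "e \<in> nbhd" "y \<in> (+) (k - j + e) ` cbox 0 1"
          using diff_cells_subset[OF True supp] by metis
        then have "ennpow (G y) p = ennpow (G y) p * indicator ((+) (k - j + e) ` cbox 0 1) y"
          by simp
        also have "\<dots> \<le> H y"
          unfolding H_def by (rule member_le_sum) (use e in auto)
        finally show ?thesis by (intro mult_left_mono) auto
      qed auto
    qed auto
    finally show ?thesis using True by simp
  qed auto
  have "(\<integral>\<^sup>+ x. ennpow (nnconv f G x) p \<partial>lebesgue_on ((+) k ` cbox 0 1))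
      \<le> (\<integral>\<^sup>+ x. ennpow m (p - 1) * (\<integral>\<^sup>+ y. f (x - y) * H y \<partial>lborel) \<partial>lborel)"
    unfolding nn_integral_cell by (intro nn_integral_mono pt)
  also have "\<dots> = ennpow m (p - 1) * (\<integral>\<^sup>+ x. \<integral>\<^sup>+ y. f (x - y) * H y \<partial>lborel \<partial>lborel)"
    by (rule nn_integral_cmult) measurable
  also have "(\<integral>\<^sup>+ x. \<integral>\<^sup>+ y. f (x - y) * H y \<partial>lborel \<partial>lborel)
      = (\<integral>\<^sup>+ y. \<integral>\<^sup>+ x. f (x - y) * H y \<partial>lborel \<partial>lborel)"
    by (rule lborel_pair.Fubini'[symmetric]) measurable
  also have "\<dots> = m * (\<integral>\<^sup>+ y. H y \<partial>lborel)"
    by (simp add: nn_integral_multc nn_integral_cmult nn_integral_lborel_translate m_def)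
  also have "ennpow m (p - 1) * (m * (\<integral>\<^sup>+ y. H y \<partial>lborel)) = ennpow m p * (\<integral>\<^sup>+ y. H y \<partial>lborel)"
    using p ennpow_add[of 1 "p - 1" m] by (simp add: mult_ac)
  finally have "Lp_norm (lebesgue_on ((+) k ` cbox 0 1)) (ennreal p) (nnconv f G)
      \<le> ennpow (ennpow m p * (\<integral>\<^sup>+ y. H y \<partial>lborel)) (1 / p)"
    using p by (simp add: Lp_norm_ennreal ennpow_mono)
  also have "\<dots> = m * ennpow (\<integral>\<^sup>+ y. H y \<partial>lborel) (1 / p)"
    using p by (simp add: ennpow_mult ennpow_ennpow)
  also have "(\<integral>\<^sup>+ y. H y \<partial>lborel)
      = (\<integral>\<^sup>+ e. (\<integral>\<^sup>+ y. ennpow (G y) p \<partial>lebesgue_on ((+) (k - j + e) ` cbox 0 1)) \<partial>count_space nbhd)"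
    unfolding H_def nn_integral_cell nn_integral_count_space_finite[OF finite_nbhd]
    by (rule nn_integral_sum) measurable
  also have "ennpow \<dots> (1 / p)
      \<le> (\<integral>\<^sup>+ e. Lp_norm (lebesgue_on ((+) (k - j + e) ` cbox 0 1)) (ennreal p) G \<partial>count_space nbhd)"
    using p by (simp add: Lp_norm_ennreal) (intro ennpow_sum_le; simp)
  finally show ?thesis
    unfolding m_def by (simp add: nn_integral_count_space_finite mult_left_mono)
qed

locale amalgam_conv = amalgam p q \<omega> for p q :: real and \<omega> :: "real ^ 'n \<Rightarrow> real" +
  fixes v :: "real ^ 'n \<Rightarrow> real" and C :: real
  assumes v_pos: "\<And>x. 0 < v x" and C_pos: "0 < C"
    and mod: "\<And>x y. \<omega> (x + y) \<le> C * \<omega> x * v y"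
begin

text \<open>By moderateness \<open>\<omega> k\<close> is at most \<open>C * v (j - e)\<close> times
  \<open>\<omega> (k - j + e)\<close>; summing over \<open>e\<close> makes one factor serve all
  offsets.\<close>

definition V :: "real ^ 'n \<Rightarrow> real" where
  "V j = C * (\<Sum>e\<in>nbhd. v (j - e))"

lemma V_nonneg: "0 \<le> V j"
  unfolding V_def using C_pos v_pos by (intro mult_nonneg_nonneg sum_nonneg) (auto simp: less_imp_le)

lemma weight_le:
  assumes "e \<in> nbhd"
  shows "\<omega> k \<le> V j * \<omega> (k - j + e)"
proof -
  have "v (j - e) \<le> (\<Sum>e\<in>nbhd. v (j - e))"
    by (rule member_le_sum) (use assms v_pos in \<open>auto simp: less_imp_le\<close>)
  then have le: "C * \<omega> (k - j + e) * v (j - e) \<le> C * \<omega> (k - j + e) * (\<Sum>e\<in>nbhd. v (j - e))"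
    using C_pos pos[of "k - j + e"] by (intro mult_left_mono) auto
  have "\<omega> k = \<omega> ((k - j + e) + (j - e))" by simp
  also have "\<dots> \<le> C * \<omega> (k - j + e) * v (j - e)" by (rule mod)
  finally show ?thesis using le by (simp add: V_def mult_ac)
qed

text \<open>A first factor living in cell \<open>j\<close> shifts local norms by \<open>j\<close> up
  to an offset in \<open>nbhd\<close>, at the cost \<open>V j\<close> in the weight. Lattice
  translations preserve the lattice quasi-norm, so every offset contributes the same amount, whence
  the factor \<open>card nbhd\<close>.\<close>

lemma nnconv_cell:
  assumes [measurable]: "f \<in> borel_measurable borel" "G \<in> borel_measurable borel"
    and supp: "\<And>z. f z \<noteq> 0 \<Longrightarrow> z \<in> (+) j ` cbox 0 1"
    and fin: "(\<integral>\<^sup>+ z. f z \<partial>lborel) < top" and j: "j \<in> int_lattice"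
  shows "\<nu> (nnconv f G)
    \<le> ennpow ((\<integral>\<^sup>+ z. f z \<partial>lborel) * ennreal (V j)) s * (of_nat (card (nbhd :: (real ^ 'n) set)) * \<nu> G)"
proof -
  define m where "m = (\<integral>\<^sup>+ z. f z \<partial>lborel)"
  define b where "b k = loc G k * ennreal (\<omega> k)" for k
  have le: "loc (nnconv f G) k * ennreal (\<omega> k)
      \<le> (m * ennreal (V j)) * (\<integral>\<^sup>+ e. b (k - j + e) \<partial>count_space nbhd)" for k
  proof -
    have "loc (nnconv f G) k * ennreal (\<omega> k) \<le> m * (\<Sum>e\<in>nbhd. loc G (k - j + e)) * ennreal (\<omega> k)"
      unfolding m_def using p fin supp by (intro mult_right_mono Lp_norm_nnconv_cell) auto
    also have "\<dots> = m * (\<Sum>e\<in>nbhd. loc G (k - j + e) * ennreal (\<omega> k))"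
      by (simp add: sum_distrib_right mult.assoc)
    also have "\<dots> \<le> m * (\<Sum>e\<in>nbhd. loc G (k - j + e) * ennreal (V j * \<omega> (k - j + e)))"
      by (intro mult_left_mono sum_mono ennreal_leI weight_le) auto
    also have "\<dots> = (m * ennreal (V j)) * (\<Sum>e\<in>nbhd. b (k - j + e))"
      using V_nonneg pos
      by (simp add: b_def ennreal_mult less_imp_le sum_distrib_left mult_ac)
    finally show ?thesis by (simp add: nn_integral_count_space_finite)
  qed
  let ?L = "count_space (int_lattice :: (real ^ 'n) set)"
  have shift: "Lp_norm ?L (ennreal q) (\<lambda>k. b (k - j + e)) = Lp_norm ?L (ennreal q) b"
    if "e \<in> nbhd" for e
  proof -
    have e: "e \<in> int_lattice" using that by (simp add: nbhd_def)
    have "bij_betw (\<lambda>k. k - j + e) int_lattice int_lattice"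
    proof (rule bij_betwI[where g = "\<lambda>k. k + j - e"])
      show "(\<lambda>k. k - j + e) \<in> int_lattice \<rightarrow> int_lattice"
        using j e by (auto intro: int_lattice_add int_lattice_diff)
      show "(\<lambda>k. k + j - e) \<in> int_lattice \<rightarrow> int_lattice"
        using j e by (auto intro: int_lattice_add int_lattice_diff)
    qed auto
    from nn_integral_bij_count_space[OF this, of "\<lambda>k. ennpow (b k) q"] show ?thesis
      using q by (simp add: Lp_norm_ennreal)
  qed
  have "\<nu> (nnconv f G)
      \<le> ennpow (Lp_norm ?L (ennreal q)
          (\<lambda>k. (m * ennreal (V j)) * (\<integral>\<^sup>+ e. b (k - j + e) \<partial>count_space nbhd))) s"
    unfolding amalgam_norm_def using q by (intro ennpow_mono Lp_norm_mono_AE AE_I2 le) auto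
  also have "\<dots> = ennpow (m * ennreal (V j)) s *
      ennpow (Lp_norm ?L (ennreal q) (\<lambda>k. \<integral>\<^sup>+ e. b (k - j + e) \<partial>count_space nbhd)) s"
    using q s_pos by (simp add: Lp_norm_cmult ennpow_mult del: min_less_iff_conj)
  also have "\<dots> \<le> ennpow (m * ennreal (V j)) s *
      (\<integral>\<^sup>+ e. ennpow (Lp_norm ?L (ennreal q) (\<lambda>k. b (k - j + e))) s \<partial>count_space nbhd)"
    using q by (intro mult_left_mono Lp_norm_min_sum_le) (auto intro: countable_finite)
  also have "(\<integral>\<^sup>+ e. ennpow (Lp_norm ?L (ennreal q) (\<lambda>k. b (k - j + e))) s \<partial>count_space nbhd)
      = of_nat (card (nbhd :: (real ^ 'n) set)) * \<nu> G"
    unfolding amalgam_norm_def b_def[symmetric]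
    by (simp add: nn_integral_count_space_finite shift)
  finally show ?thesis by (simp add: m_def)
qed

lemma nnconv_bound:
  assumes [measurable]: "f \<in> borel_measurable borel" "G \<in> borel_measurable borel"
    and fin: "\<And>j. j \<in> int_lattice \<Longrightarrow> (\<integral>\<^sup>+ z. f z * indicator ((+) j ` cbox 0 1) z \<partial>lborel) < top"
  shows "\<nu> (nnconv f G) \<le>
    (\<integral>\<^sup>+ j. ennpow ((\<integral>\<^sup>+ z. f z * indicator ((+) j ` cbox 0 1) z \<partial>lborel) * ennreal (V j)) s
      \<partial>count_space int_lattice) * (of_nat (card (nbhd :: (real ^ 'n) set)) * \<nu> G)"
proof -
  define fj where "fj j z = f z * indicator ((+) j ` cbox 0 1) z" for j z
  have [measurable]: "fj j \<in> borel_measurable borel" for j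
    unfolding fj_def[abs_def] by measurable
  \<comment> \<open>Only an inequality, since closed cells overlap on their faces.\<close>
  have split: "f z \<le> (\<integral>\<^sup>+ j. fj j z \<partial>count_space int_lattice)" for z
  proof -
    obtain k where k: "k \<in> int_lattice" "z \<in> (+) k ` cbox 0 1" by (rule cells_cover)
    then have "f z = fj k z" by (simp add: fj_def)
    also have "\<dots> \<le> (\<integral>\<^sup>+ j. fj j z \<partial>count_space int_lattice)"
      by (rule nn_integral_ge_point) fact
    finally show ?thesis .
  qed
  have "nnconv f G x \<le> (\<integral>\<^sup>+ j. nnconv (fj j) G x \<partial>count_space int_lattice)" for x
  proof -
    have "nnconv f G x \<le> (\<integral>\<^sup>+ y. (\<integral>\<^sup>+ j. fj j (x - y) * G y \<partial>count_space int_lattice) \<partial>lborel)"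
      unfolding nnconv_def
      by (intro nn_integral_mono) (simp add: nn_integral_multc mult_right_mono split)
    also have "\<dots> = (\<integral>\<^sup>+ j. nnconv (fj j) G x \<partial>count_space int_lattice)"
      unfolding nnconv_def
      by (intro nn_integral_count_space_nn_integral countable_int_lattice) measurable
    finally show ?thesis .
  qed
  then have "\<nu> (nnconv f G) \<le> \<nu> (\<lambda>x. \<integral>\<^sup>+ j. nnconv (fj j) G x \<partial>count_space int_lattice)"
    by (rule mono)
  also have "\<dots> \<le> (\<integral>\<^sup>+ j. \<nu> (nnconv (fj j) G) \<partial>count_space int_lattice)"
    by (intro countable_sum countable_int_lattice borel_imp_lebesgue nnconv_measurable) auto
  also have "\<dots> \<le> (\<integral>\<^sup>+ j. ennpow ((\<integral>\<^sup>+ z. fj j z \<partial>lborel) * ennreal (V j)) s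
      * (of_nat (card (nbhd :: (real ^ 'n) set)) * \<nu> G) \<partial>count_space int_lattice)"
    by (intro nn_integral_mono nnconv_cell)
      (use fin in \<open>auto simp: fj_def indicator_def split: if_splits\<close>)
  finally show ?thesis
    by (simp add: nn_integral_multc fj_def)
qed

text \<open>The constant of \<open>nnconv_cell\<close> for \<open>j = 0\<close>, with the power
  \<open>s\<close> already taken.\<close>

definition K :: real where
  "K = V 0 powr s * real (card (nbhd :: (real ^ 'n) set))"

lemma nnconv_unit_cell:
  assumes "f \<in> borel_measurable borel" "G \<in> borel_measurable borel"
    and supp: "\<And>z. f z \<noteq> 0 \<Longrightarrow> z \<in> cbox 0 1"
    and fin: "(\<integral>\<^sup>+ z. f z \<partial>lborel) < top"
  shows "\<nu> (nnconv f G) \<le> ennreal K * ennpow (\<integral>\<^sup>+ z. f z \<partial>lborel) s * \<nu> G"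
proof -
  have z: "(+) 0 ` cbox 0 1 = (cbox 0 1 :: (real ^ 'n) set)" by auto
  have "\<nu> (nnconv f G)
    \<le> ennpow ((\<integral>\<^sup>+ z. f z \<partial>lborel) * ennreal (V 0)) s * (of_nat (card (nbhd :: (real ^ 'n) set)) * \<nu> G)"
    using assms by (intro nnconv_cell) (auto simp: z int_lattice_def)
  then show ?thesis
    using s_pos V_nonneg[of 0]
    by (simp add: ennpow_mult K_def ennpow_ennreal ennreal_mult mult_ac ennreal_of_nat_eq_real_of_nat
        del: min_less_iff_conj)
qed

end

subsection \<open>Convolution of complex functions\<close>

abbreviation (input) nnorm :: "('a \<Rightarrow> complex) \<Rightarrow> 'a \<Rightarrow> ennreal" where
  "nnorm f \<equiv> \<lambda>x. ennreal (norm (f x))"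

lemma nnorm_measurable:
  "f \<in> borel_measurable M \<Longrightarrow> nnorm f \<in> borel_measurable M"
  by measurable

context
  fixes f g :: "real ^ 'n \<Rightarrow> complex"
  assumes [measurable]: "f \<in> borel_measurable borel" "g \<in> borel_measurable borel"
begin

lemma convolve_lborel: "convolve f g x = (LINT y|lborel. f (x - y) * g y)"
  unfolding convolve_def by (rule integral_completion) measurable

lemma convolve_integrable_lborel:
  "integrable lborel (\<lambda>y. f (x - y) * g y) \<longleftrightarrow> nnconv (nnorm f) (nnorm g) x < top"
  by (simp add: integrable_iff_bounded nnconv_def norm_mult ennreal_mult)

lemma convolve_integrable:
  "integrable lebesgue (\<lambda>y. f (x - y) * g y) \<longleftrightarrow> nnconv (nnorm f) (nnorm g) x < top"
  by (subst integrable_completion) (simp_all add: convolve_integrable_lborel)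

text \<open>Valid at every point, because \<open>convolve\<close> is 0 wherever the integral does
  not converge absolutely.\<close>

lemma nnorm_convolve_le: "ennreal (norm (convolve f g x)) \<le> nnconv (nnorm f) (nnorm g) x"
proof (cases "integrable lborel (\<lambda>y. f (x - y) * g y)")
  case True
  then have "ennreal (norm (convolve f g x)) \<le> (\<integral>\<^sup>+ y. norm (f (x - y) * g y) \<partial>lborel)"
    unfolding convolve_lborel by (rule integral_norm_bound_ennreal)
  then show ?thesis by (simp add: nnconv_def norm_mult ennreal_mult)
qed (simp add: convolve_lborel not_integrable_integral_eq)

lemma convolve_measurable [measurable]: "convolve f g \<in> borel_measurable borel"
proof -
  have "(\<lambda>x. LINT y|lborel. f (x - y) * g y) \<in> borel_measurable borel"
    by measurable
  then show ?thesis by (simp add: convolve_lborel[abs_def])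
qed

end

lemma convolve_commute:
  fixes f g :: "real ^ 'n \<Rightarrow> complex"
  assumes [measurable]: "f \<in> borel_measurable borel" "g \<in> borel_measurable borel"
  shows "convolve f g x = convolve g f x"
  unfolding convolve_lborel[OF assms] convolve_lborel[OF assms(2,1)]
  by (subst integral_lborel_reflect[of _ x, symmetric]) (simp_all add: mult.commute)

lemma convolve_add_right:
  fixes f g h :: "real ^ 'n \<Rightarrow> complex"
  assumes [measurable]: "f \<in> borel_measurable borel" "g \<in> borel_measurable borel" "h \<in> borel_measurable borel"
    and "nnconv (nnorm f) (nnorm g) x < top" "nnconv (nnorm f) (nnorm h) x < top"
  shows "convolve f (\<lambda>x. g x + h x) x = convolve f g x + convolve f h x"
  using assms(4,5)
  by (simp add: convolve_lborel convolve_integrable_lborel[symmetric] distrib_left)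

lemma convolve_diff_right:
  fixes f g h :: "real ^ 'n \<Rightarrow> complex"
  assumes [measurable]: "f \<in> borel_measurable borel" "g \<in> borel_measurable borel" "h \<in> borel_measurable borel"
    and "nnconv (nnorm f) (nnorm g) x < top" "nnconv (nnorm f) (nnorm h) x < top"
  shows "convolve f (\<lambda>x. g x - h x) x = convolve f g x - convolve f h x"
  using assms(4,5)
  by (simp add: convolve_lborel convolve_integrable_lborel[symmetric] right_diff_distrib)

lemma convolve_cmult_right:
  fixes f g :: "real ^ 'n \<Rightarrow> complex"
  assumes [measurable]: "f \<in> borel_measurable borel" "g \<in> borel_measurable borel"
  shows "convolve f (\<lambda>x. c * g x) x = c * convolve f g x"
  by (simp add: convolve_lborel mult.left_commute)

lemma integral_lborel_translate:
  fixes f :: "'a::euclidean_space \<Rightarrow> 'b::{banach, second_countable_topology}"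
  assumes [measurable]: "f \<in> borel_measurable borel"
  shows "(LINT x|lborel. f (x + y)) = (LINT x|lborel. f x)"
proof -
  have "(LINT x|lborel. f x) = (LINT x|distr lborel borel ((+) y). f x)"
    by (simp add: lborel_distr_plus)
  also have "\<dots> = (LINT x|lborel. f (x + y))"
    by (subst integral_distr) (simp_all add: add.commute)
  finally show ?thesis ..
qed

text \<open>The assumption \<open>fin\<close> is absolute integrability of the double integrand,
  which permits Fubini's theorem; a translation by \<open>y\<close> then turns the inner integral
  into \<open>convolve a f (x - y)\<close>.\<close>

lemma convolve_assoc:
  fixes a f g :: "real ^ 'n \<Rightarrow> complex"
  assumes [measurable]: "a \<in> borel_measurable borel" "f \<in> borel_measurable borel" "g \<in> borel_measurable borel"
    and fin: "nnconv (nnorm a) (nnconv (nnorm f) (nnorm g)) x < top"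
  shows "convolve a (convolve f g) x = convolve (convolve a f) g x"
proof -
  have "convolve a (convolve f g) x
      = (LINT u|lborel. LINT y|lborel. a (x - u) * (f (u - y) * g y))"
    by (simp add: convolve_lborel)
  also have "\<dots> = (LINT y|lborel. LINT u|lborel. a (x - u) * (f (u - y) * g y))"
  proof (rule lborel_pair.Fubini_integral[symmetric])
    show "integrable (lborel \<Otimes>\<^sub>M lborel) (\<lambda>(u, y). a (x - u) * (f (u - y) * g y))"
    proof (rule integrableI_bounded)
      have "(\<integral>\<^sup>+ z. norm (case z of (u, y) \<Rightarrow> a (x - u) * (f (u - y) * g y)) \<partial>(lborel \<Otimes>\<^sub>M lborel))
          = (\<integral>\<^sup>+ u. \<integral>\<^sup>+ y. norm (a (x - u) * (f (u - y) * g y)) \<partial>lborel \<partial>lborel)"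
        by (subst lborel.nn_integral_fst[symmetric]) simp_all
      also have "\<dots> = nnconv (nnorm a) (nnconv (nnorm f) (nnorm g)) x"
        unfolding nnconv_def by (simp add: norm_mult ennreal_mult nn_integral_cmult)
      finally show "(\<integral>\<^sup>+ z. norm (case z of (u, y) \<Rightarrow> a (x - u) * (f (u - y) * g y)) \<partial>(lborel \<Otimes>\<^sub>M lborel)) < \<infinity>"
        using fin by simp
    qed measurable
  qed
  also have "\<dots> = (LINT y|lborel. convolve a f (x - y) * g y)"
  proof (intro Bochner_Integration.integral_cong refl)
    fix y
    have "(LINT u|lborel. a (x - u) * (f (u - y) * g y)) = (LINT u|lborel. a (x - u) * f (u - y)) * g y"
      by (simp flip: mult.assoc)
    also have "(LINT u|lborel. a (x - u) * f (u - y)) = (LINT w|lborel. a (x - (w + y)) * f (w + y - y))"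
      by (rule integral_lborel_translate[symmetric]) measurable
    also have "\<dots> = convolve a f (x - y)"
      by (simp add: convolve_lborel algebra_simps)
    finally show "(LINT u|lborel. a (x - u) * (f (u - y) * g y)) = convolve a f (x - y) * g y" .
  qed
  finally show ?thesis
    by (simp add: convolve_lborel[of "convolve a f"])
qed

lemma tendsto_0_le_ennreal:
  fixes f g :: "nat \<Rightarrow> ennreal"
  assumes "\<And>n. f n \<le> g n" "g \<longlonglongrightarrow> 0"
  shows "f \<longlonglongrightarrow> 0"
  by (rule tendsto_sandwich[OF _ _ tendsto_const assms(2)]) (simp_all add: assms)

text \<open>Instantiated both with the norm of \<open>L\<^sup>1\<close> and with the power \<open>min 1 q\<close> of the amalgam quasi-norm.\<close>

locale conv_norm =
  fixes N :: "(real ^ 'n \<Rightarrow> ennreal) \<Rightarrow> ennreal" and s K :: real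
  assumes s_pos: "0 < s" and K_nonneg: "0 \<le> K"
    and N_mono: "\<And>F G. AE x in lborel. F x \<le> G x \<Longrightarrow> N F \<le> N G"
    and N_suminf: "\<And>F. (\<And>i. F i \<in> borel_measurable borel) \<Longrightarrow> N (\<lambda>x. \<Sum>i. F i x) \<le> (\<Sum>i. N (F i))"
    and N_cmult: "\<And>F c. F \<in> borel_measurable borel \<Longrightarrow> N (\<lambda>x. c * F x) = ennpow c s * N F"
    and N_finite: "\<And>F. F \<in> borel_measurable borel \<Longrightarrow> N F < top \<Longrightarrow> AE x in lborel. F x < top"
    and N_conv: "\<And>f G. f \<in> borel_measurable borel \<Longrightarrow> G \<in> borel_measurable borel
      \<Longrightarrow> (\<And>z. f z \<noteq> 0 \<Longrightarrow> z \<in> cbox 0 1) \<Longrightarrow> (\<integral>\<^sup>+ z. f z \<partial>lborel) < top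
      \<Longrightarrow> N (nnconv f G) \<le> ennreal K * ennpow (\<integral>\<^sup>+ z. f z \<partial>lborel) s * N G"
begin

lemma N_cong: "AE x in lborel. F x = G x \<Longrightarrow> N F = N G"
  by (intro antisym N_mono) auto

lemma N_zero [simp]: "N (\<lambda>_. 0) = 0"
  using N_cmult[of "\<lambda>_. 0" 0] by simp

lemma N_add:
  assumes [measurable]: "F \<in> borel_measurable borel" "G \<in> borel_measurable borel"
  shows "N (\<lambda>x. F x + G x) \<le> N F + N G"
proof -
  define H where "H i = (if i = 0 then F else if i = Suc 0 then G else (\<lambda>_. 0))" for i :: nat
  have [measurable]: "H i \<in> borel_measurable borel" for i by (simp add: H_def)
  have "(\<Sum>i. H i x) = F x + G x" for x
    by (subst suminf_finite[of "{0, Suc 0}"]) (auto simp: H_def)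
  moreover have "(\<Sum>i. N (H i)) = N F + N G"
    by (subst suminf_finite[of "{0, Suc 0}"]) (auto simp: H_def)
  ultimately show ?thesis using N_suminf[of H] by simp
qed

text \<open>Multiplication by \<open>top\<close> keeps the value 0 of \<open>N\<close>, and
  \<open>top * F x\<close> can be finite only where \<open>F x\<close> is 0.\<close>

lemma N_zero_AE:
  assumes [measurable]: "F \<in> borel_measurable borel" and "N F = 0"
  shows "AE x in lborel. F x = 0"
proof -
  have "AE x in lborel. top * F x < top"
    using N_cmult[of F top] assms by (intro N_finite) auto
  then show ?thesis
    by eventually_elim (auto simp: ennreal_top_mult split: if_splits)
qed

text \<open>Borel rather than Lebesgue measurable, so that \<open>f (x - y) * g y\<close> is jointly
  measurable in \<open>x\<close> and \<open>y\<close>, as Fubini's theorem requires.\<close>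

definition X :: "(real ^ 'n \<Rightarrow> complex) set" where
  "X = {g \<in> borel_measurable borel. N (nnorm g) < top}"

lemma X_measurable [measurable_dest, dest]: "g \<in> X \<Longrightarrow> g \<in> borel_measurable borel"
  by (simp add: X_def)

lemma X_finite: "g \<in> X \<Longrightarrow> N (nnorm g) < top"
  by (simp add: X_def)

lemma N_nnorm_add:
  assumes "g \<in> borel_measurable borel" "h \<in> borel_measurable borel"
  shows "N (nnorm (\<lambda>x. g x + h x)) \<le> N (nnorm g) + N (nnorm h)"
proof -
  have "N (nnorm (\<lambda>x. g x + h x)) \<le> N (\<lambda>x. nnorm g x + nnorm h x)"
    by (intro N_mono AE_I2) (simp add: ennreal_plus[symmetric] norm_triangle_ineq del: ennreal_plus)
  also have "\<dots> \<le> N (nnorm g) + N (nnorm h)"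
    using assms by (intro N_add nnorm_measurable)
  finally show ?thesis .
qed

lemma N_nnorm_minus: "N (nnorm (\<lambda>x. h x - g x)) = N (nnorm (\<lambda>x. g x - h x))"
  by (simp add: norm_minus_commute)

lemma N_nnorm_triangle:
  assumes "g \<in> borel_measurable borel" "h \<in> borel_measurable borel" "k \<in> borel_measurable borel"
  shows "N (nnorm (\<lambda>x. g x - k x)) \<le> N (nnorm (\<lambda>x. g x - h x)) + N (nnorm (\<lambda>x. h x - k x))"
  using N_nnorm_add[of "\<lambda>x. g x - h x" "\<lambda>x. h x - k x"] assms by simp

lemma N_nnorm_cmult:
  assumes [measurable]: "g \<in> borel_measurable borel"
  shows "N (nnorm (\<lambda>x. c * g x)) = ennreal (norm c powr s) * N (nnorm g)"
  using N_cmult[of "nnorm g" "ennreal (norm c)"]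
  by (simp add: norm_mult ennreal_mult ennpow_ennreal)

lemma X_add: "g \<in> X \<Longrightarrow> h \<in> X \<Longrightarrow> (\<lambda>x. g x + h x) \<in> X"
  using N_nnorm_add[of g h] by (auto simp: X_def intro: order.strict_trans1)

lemma X_cmult: "g \<in> X \<Longrightarrow> (\<lambda>x. c * g x) \<in> X"
  by (auto simp: X_def N_nnorm_cmult ennreal_mult_less_top)

lemma X_diff: "g \<in> X \<Longrightarrow> h \<in> X \<Longrightarrow> (\<lambda>x. g x - h x) \<in> X"
  using X_add[of g "\<lambda>x. - 1 * h x"] X_cmult[of h "-1"] by simp

text \<open>Does not mention \<open>N\<close>, so all instances of the locale share this set: bumps
  and first factors pass between the L^1 instance and the amalgam instance without
  conversion.\<close>

definition A :: "(real ^ 'n \<Rightarrow> complex) set" where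
  "A = {f \<in> borel_measurable borel. (\<forall>z. f z \<noteq> 0 \<longrightarrow> z \<in> cbox 0 1) \<and> (\<integral>\<^sup>+ z. norm (f z) \<partial>lborel) < top}"

lemma A_measurable [measurable_dest, dest]: "f \<in> A \<Longrightarrow> f \<in> borel_measurable borel"
  by (simp add: A_def)

lemma A_diff:
  assumes "f \<in> A" "g \<in> A" shows "(\<lambda>x. f x - g x) \<in> A"
proof -
  note [measurable] = A_measurable[OF assms(1)] A_measurable[OF assms(2)]
  have "(\<integral>\<^sup>+ z. norm (f z - g z) \<partial>lborel) \<le> (\<integral>\<^sup>+ z. ennreal (norm (f z)) + ennreal (norm (g z)) \<partial>lborel)"
    by (intro nn_integral_mono)
      (simp add: ennreal_plus[symmetric] norm_triangle_ineq4 del: ennreal_plus)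
  also have "\<dots> < top"
    using assms by (subst nn_integral_add) (auto simp: A_def)
  finally have "(\<integral>\<^sup>+ z. norm (f z - g z) \<partial>lborel) < top" .
  moreover have "z \<in> cbox 0 1" if "f z - g z \<noteq> 0" for z
    using that assms by (cases "f z = 0") (auto simp: A_def)
  ultimately show ?thesis by (auto simp: A_def)
qed

lemma N_nnconv:
  assumes "f \<in> A" "G \<in> borel_measurable borel"
  shows "N (nnconv (nnorm f) G) \<le> ennreal K * ennpow (\<integral>\<^sup>+ z. norm (f z) \<partial>lborel) s * N G"
  using assms by (intro N_conv) (auto simp: A_def)

lemma nnconv_finite:
  assumes f: "f \<in> A" and G: "G \<in> borel_measurable borel" "N G < top"
  shows "N (nnconv (nnorm f) G) < top" "AE x in lborel. nnconv (nnorm f) G x < top"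
proof -
  have "ennreal K * ennpow (\<integral>\<^sup>+ z. norm (f z) \<partial>lborel) s * N G < top"
    using f G by (auto simp: A_def ennreal_mult_less_top ennpow_less_top_iff)
  with N_nnconv[OF f G(1)] show *: "N (nnconv (nnorm f) G) < top"
    by (rule order.strict_trans1)
  show "AE x in lborel. nnconv (nnorm f) G x < top"
    using f G by (intro N_finite nnconv_measurable nnorm_measurable *) auto
qed

lemma convolve_AE_finite:
  assumes "f \<in> A" "g \<in> X"
  shows "AE x in lborel. nnconv (nnorm f) (nnorm g) x < top"
  using assms by (intro nnconv_finite) (auto simp: X_def)

lemma N_convolve:
  assumes f: "f \<in> A" and g: "g \<in> borel_measurable borel"
  shows "N (nnorm (convolve f g))
    \<le> ennreal K * ennpow (\<integral>\<^sup>+ z. norm (f z) \<partial>lborel) s * N (nnorm g)"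
proof -
  have "N (nnorm (convolve f g)) \<le> N (nnconv (nnorm f) (nnorm g))"
    using f g by (intro N_mono AE_I2 nnorm_convolve_le) auto
  also have "\<dots> \<le> ennreal K * ennpow (\<integral>\<^sup>+ z. norm (f z) \<partial>lborel) s * N (nnorm g)"
    using f g by (intro N_nnconv) auto
  finally show ?thesis .
qed

lemma X_convolve:
  assumes f: "f \<in> A" and g: "g \<in> X"
  shows "convolve f g \<in> X"
proof -
  have "N (nnorm (convolve f g)) \<le> N (nnconv (nnorm f) (nnorm g))"
    using f g by (intro N_mono AE_I2 nnorm_convolve_le) auto
  also have "\<dots> < top"
    using f g by (intro nnconv_finite) (auto simp: X_def)
  finally show ?thesis using f g by (auto simp: X_def)
qed

lemma convolve_add_AE:
  assumes "f \<in> A" "g \<in> X" "h \<in> X"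
  shows "AE x in lborel. convolve f (\<lambda>x. g x + h x) x = convolve f g x + convolve f h x"
  using convolve_AE_finite[OF assms(1,2)] convolve_AE_finite[OF assms(1,3)]
  by eventually_elim (use assms in \<open>auto intro!: convolve_add_right\<close>)

lemma convolve_diff_AE:
  assumes "f \<in> A" "g \<in> X" "h \<in> X"
  shows "AE x in lborel. convolve f (\<lambda>x. g x - h x) x = convolve f g x - convolve f h x"
  using convolve_AE_finite[OF assms(1,2)] convolve_AE_finite[OF assms(1,3)]
  by eventually_elim (use assms in \<open>auto intro!: convolve_diff_right\<close>)

lemma convolve_diff_left_AE:
  assumes "f \<in> A" "f' \<in> A" "g \<in> X"
  shows "AE x in lborel. convolve (\<lambda>x. f x - f' x) g x = convolve f g x - convolve f' g x"
  using convolve_AE_finite[OF assms(1,3)] convolve_AE_finite[OF assms(2,3)]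
proof eventually_elim
  case (elim x)
  have [measurable]: "f \<in> borel_measurable borel" "f' \<in> borel_measurable borel" "g \<in> borel_measurable borel"
    using assms by auto
  have "convolve g (\<lambda>x. f x - f' x) x = convolve g f x - convolve g f' x"
    using elim by (intro convolve_diff_right) (auto simp: nnconv_commute)
  then show ?case by (simp add: convolve_commute)
qed

lemma convolve_assoc_AE:
  assumes "a \<in> A" "f \<in> A" "g \<in> X"
  shows "AE x in lborel. convolve a (convolve f g) x = convolve (convolve a f) g x"
proof -
  have "AE x in lborel. nnconv (nnorm a) (nnconv (nnorm f) (nnorm g)) x < top"
  proof (rule nnconv_finite(2))
    show "N (nnconv (nnorm f) (nnorm g)) < top"
      using assms by (intro nnconv_finite) (auto simp: X_def)
  qed (use assms in \<open>auto intro!: nnconv_measurable nnorm_measurable\<close>)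
  then show ?thesis
    by eventually_elim (use assms in \<open>auto intro!: convolve_assoc\<close>)
qed

section \<open>Completeness, limits of convolutions and Neumann series\<close>

lemma series_converges:
  assumes u: "\<And>n. u n \<in> X" and sum: "(\<Sum>n. N (nnorm (u n))) < top"
  shows "AE x in lborel. summable (\<lambda>n. norm (u n x))"
    and "(\<lambda>x. \<Sum>n. u n x) \<in> X"
    and "N (nnorm (\<lambda>x. \<Sum>n. u n x)) \<le> (\<Sum>n. N (nnorm (u n)))"
    and "(\<lambda>m. N (nnorm (\<lambda>x. (\<Sum>n. u n x) - (\<Sum>n<m. u n x)))) \<longlonglongrightarrow> 0"
proof -
  have [measurable]: "u n \<in> borel_measurable borel" for n using u by auto
  \<comment> \<open>The Riesz-Fischer argument: countable subadditivity makes the sum of the norms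
    finite almost everywhere, and its tails control the remainders of the series.\<close>
  have tail: "N (\<lambda>x. \<Sum>n. nnorm (u (n + m)) x) \<le> (\<Sum>n. N (nnorm (u (n + m))))" for m
    by (intro N_suminf) measurable
  have "AE x in lborel. (\<Sum>n. nnorm (u n) x) < top"
    using tail[of 0] sum by (intro N_finite) (auto intro: order.strict_trans1)
  then show summ: "AE x in lborel. summable (\<lambda>n. norm (u n x))"
    by eventually_elim (intro summable_suminf_not_top; auto simp: less_top)
  have tail_le: "N (nnorm (\<lambda>x. (\<Sum>n. u n x) - (\<Sum>n<m. u n x))) \<le> (\<Sum>n. N (nnorm (u (n + m))))" for m
  proof -
    have "AE x in lborel. nnorm (\<lambda>x. (\<Sum>n. u n x) - (\<Sum>n<m. u n x)) x \<le> (\<Sum>n. nnorm (u (n + m)) x)"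
      using summ
    proof eventually_elim
      case (elim x)
      have s: "summable (\<lambda>n. norm (u (n + m) x))"
        using elim by (simp add: summable_iff_shift[of "\<lambda>n. norm (u n x)"])
      have "(\<Sum>n. u n x) - (\<Sum>n<m. u n x) = (\<Sum>n. u (n + m) x)"
        using suminf_minus_initial_segment[OF summable_norm_cancel[OF elim], of m] by simp
      then have "norm ((\<Sum>n. u n x) - (\<Sum>n<m. u n x)) \<le> (\<Sum>n. norm (u (n + m) x))"
        using summable_norm[OF s] by simp
      then show ?case
        using s by (simp add: suminf_ennreal2 ennreal_leI)
    qed
    then show ?thesis by (rule order_trans[OF N_mono tail])
  qed
  then show le: "N (nnorm (\<lambda>x. \<Sum>n. u n x)) \<le> (\<Sum>n. N (nnorm (u n)))"
    using tail_le[of 0] by simp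
  then show "(\<lambda>x. \<Sum>n. u n x) \<in> X"
    using sum by (auto simp: X_def intro: order.strict_trans1)
  have "(\<lambda>m. \<Sum>n. N (nnorm (u (n + m)))) \<longlonglongrightarrow> 0"
  proof -
    have fin: "N (nnorm (u n)) < top" for n using u by (simp add: X_def)
    define a where "a n = enn2real (N (nnorm (u n)))" for n
    have a: "N (nnorm (u n)) = ennreal (a n)" "0 \<le> a n" for n
      using fin[of n] by (simp_all add: a_def)
    have sa: "summable a"
      using sum a by (intro summable_suminf_not_top) auto
    have "(\<lambda>m. \<Sum>n. a (n + m)) \<longlonglongrightarrow> 0"
      using suminf_exist_split2[OF sa] .
    then have "(\<lambda>m. ennreal (\<Sum>n. a (n + m))) \<longlonglongrightarrow> ennreal 0"
      by (rule tendsto_ennrealI)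
    moreover have "ennreal (\<Sum>n. a (n + m)) = (\<Sum>n. N (nnorm (u (n + m))))" for m
      using a sa by (simp add: suminf_ennreal2 summable_iff_shift)
    ultimately show ?thesis by simp
  qed
  then show "(\<lambda>m. N (nnorm (\<lambda>x. (\<Sum>n. u n x) - (\<Sum>n<m. u n x)))) \<longlonglongrightarrow> 0"
    by (rule tendsto_sandwich[OF always_eventually always_eventually tendsto_const, rotated 2])
      (use tail_le in auto)
qed

lemma limit_unique_AE:
  assumes [measurable]: "\<And>n. u n \<in> borel_measurable borel" "a \<in> borel_measurable borel" "b \<in> borel_measurable borel"
    and "(\<lambda>n. N (nnorm (\<lambda>x. u n x - a x))) \<longlonglongrightarrow> 0" "(\<lambda>n. N (nnorm (\<lambda>x. u n x - b x))) \<longlonglongrightarrow> 0"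
  shows "AE x in lborel. a x = b x"
proof -
  have "N (nnorm (\<lambda>x. a x - b x)) \<le> N (nnorm (\<lambda>x. u n x - a x)) + N (nnorm (\<lambda>x. u n x - b x))" for n
    using N_nnorm_triangle[of a "u n" b] by (simp add: N_nnorm_minus[of a])
  moreover have "(\<lambda>n. N (nnorm (\<lambda>x. u n x - a x)) + N (nnorm (\<lambda>x. u n x - b x))) \<longlonglongrightarrow> 0 + 0"
    by (intro tendsto_add assms)
  ultimately have "N (nnorm (\<lambda>x. a x - b x)) \<le> 0"
    by (intro tendsto_lowerbound[where F = sequentially]) auto
  then have "AE x in lborel. nnorm (\<lambda>x. a x - b x) x = 0"
    by (intro N_zero_AE) auto
  then show ?thesis by eventually_elim simp
qed

text \<open>The difference splits into \<open>w n - f\<close> convolved with \<open>u n\<close> and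
  \<open>f\<close> convolved with \<open>u n - g\<close>; the uniform bound \<open>B\<close> is what
  makes the first part small.\<close>

lemma convolve_tendsto:
  assumes w: "\<And>n. w n \<in> A" "f \<in> A" and g: "\<And>n. u n \<in> X" "g \<in> X"
    and wlim: "(\<lambda>n. \<integral>\<^sup>+ x. norm (w n x - f x) \<partial>lborel) \<longlonglongrightarrow> 0"
    and ulim: "(\<lambda>n. N (nnorm (\<lambda>x. u n x - g x))) \<longlonglongrightarrow> 0"
    and bd: "\<And>n. N (nnorm (u n)) \<le> B" "B < top"
  shows "(\<lambda>n. N (nnorm (\<lambda>x. convolve (w n) (u n) x - convolve f g x))) \<longlonglongrightarrow> 0"
proof -
  define m where "m = (\<integral>\<^sup>+ x. norm (f x) \<partial>lborel)"
  have m: "m < top" using w by (simp add: A_def m_def)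
  have le: "N (nnorm (\<lambda>x. convolve (w n) (u n) x - convolve f g x))
     \<le> ennreal K * ennpow (\<integral>\<^sup>+ x. norm (w n x - f x) \<partial>lborel) s * B
       + ennreal K * ennpow m s * N (nnorm (\<lambda>x. u n x - g x))" (is "_ \<le> ?b n") for n
  proof -
    have [measurable]: "w n \<in> borel_measurable borel" "f \<in> borel_measurable borel"
      "u n \<in> borel_measurable borel" "g \<in> borel_measurable borel" using w g by auto
    have "AE x in lborel. convolve (w n) (u n) x - convolve f g x
        = convolve (\<lambda>x. w n x - f x) (u n) x + convolve f (\<lambda>x. u n x - g x) x"
      using convolve_diff_left_AE[OF w(1) w(2) g(1), of n n] convolve_diff_AE[OF w(2) g(1) g(2), of n]
      by eventually_elim simp
    then have "N (nnorm (\<lambda>x. convolve (w n) (u n) x - convolve f g x))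
        = N (nnorm (\<lambda>x. convolve (\<lambda>x. w n x - f x) (u n) x + convolve f (\<lambda>x. u n x - g x) x))"
      by (intro N_cong) auto
    also have "\<dots> \<le> N (nnorm (convolve (\<lambda>x. w n x - f x) (u n))) + N (nnorm (convolve f (\<lambda>x. u n x - g x)))"
      by (intro N_nnorm_add) measurable
    also have "\<dots> \<le> ennreal K * ennpow (\<integral>\<^sup>+ x. norm (w n x - f x) \<partial>lborel) s * N (nnorm (u n))
       + ennreal K * ennpow m s * N (nnorm (\<lambda>x. u n x - g x))"
      unfolding m_def using w g by (intro add_mono N_convolve A_diff) auto
    also have "\<dots> \<le> ?b n"
      by (intro add_mono mult_left_mono bd) auto
    finally show ?thesis .
  qed
  have "(\<lambda>n. ennreal K * B * ennpow (\<integral>\<^sup>+ x. norm (w n x - f x) \<partial>lborel) s) \<longlonglongrightarrow> ennreal K * B * 0"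
    using bd s_pos wlim by (intro ennreal_tendsto_cmult ennpow_tendsto_0) (auto simp: ennreal_mult_less_top)
  moreover have "(\<lambda>n. ennreal K * ennpow m s * N (nnorm (\<lambda>x. u n x - g x))) \<longlonglongrightarrow> ennreal K * ennpow m s * 0"
    using m ulim by (intro ennreal_tendsto_cmult) (auto simp: ennreal_mult_less_top ennpow_less_top_iff)
  ultimately have "(\<lambda>n. ennreal K * B * ennpow (\<integral>\<^sup>+ x. norm (w n x - f x) \<partial>lborel) s
      + ennreal K * ennpow m s * N (nnorm (\<lambda>x. u n x - g x))) \<longlonglongrightarrow> ennreal K * B * 0 + ennreal K * ennpow m s * 0"
    by (rule tendsto_add)
  then have "?b \<longlonglongrightarrow> 0"
    by (simp add: mult.assoc mult.commute[of B])
  then show ?thesis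
    by (rule tendsto_sandwich[OF always_eventually always_eventually tendsto_const, rotated 2])
      (use le in auto)
qed

lemma N_convolve_diff:
  assumes f: "f \<in> A" and g: "g \<in> X" and h: "h \<in> X"
  shows "N (nnorm (\<lambda>x. convolve f g x - convolve f h x))
    \<le> ennreal K * ennpow (\<integral>\<^sup>+ z. norm (f z) \<partial>lborel) s * N (nnorm (\<lambda>x. g x - h x))"
proof -
  have "AE x in lborel. nnorm (\<lambda>x. convolve f g x - convolve f h x) x
      = nnorm (convolve f (\<lambda>x. g x - h x)) x"
    using convolve_diff_AE[OF assms] by eventually_elim simp
  then have "N (nnorm (\<lambda>x. convolve f g x - convolve f h x)) = N (nnorm (convolve f (\<lambda>x. g x - h x)))"
    by (rule N_cong)
  also have "\<dots> \<le> ennreal K * ennpow (\<integral>\<^sup>+ z. norm (f z) \<partial>lborel) s * N (nnorm (\<lambda>x. g x - h x))"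
    using f X_diff[OF g h] by (intro N_convolve) auto
  finally show ?thesis .
qed

text \<open>A Neumann series for Dirac plus \<open>\<theta>\<close> times \<open>\<phi>\<close>.
  Each step convolves with \<open>\<phi>\<close> anew; convolution powers of \<open>\<phi>\<close>
  would leave the unit cube and thus the reach of \<open>N_conv\<close>. Every step at least halves
  \<open>N\<close>, whence the factor 2.\<close>

lemma solve_perturbed_identity:
  assumes \<phi>: "\<phi> \<in> A" "(\<integral>\<^sup>+ z. norm (\<phi> z) \<partial>lborel) = 1"
    and \<theta>: "0 \<le> \<theta>" "\<theta> powr s * K \<le> 1 / 2" and e: "e \<in> X"
  shows "\<exists>d\<in>X. (AE x in lborel. d x + of_real \<theta> * convolve \<phi> d x = e x) \<and>
    N (nnorm d) \<le> 2 * N (nnorm e)"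
proof -
  define u where "u = rec_nat e (\<lambda>_ w x. of_real (- \<theta>) * convolve \<phi> w x)"
  have u0: "u 0 = e" and uS: "u (Suc n) = (\<lambda>x. of_real (- \<theta>) * convolve \<phi> (u n) x)" for n
    by (simp_all add: u_def)
  have uX: "u n \<in> X" for n
    by (induction n) (auto simp: u0 uS e simp del: of_real_minus intro!: X_cmult X_convolve \<phi>)
  note [measurable] = A_measurable[OF \<phi>(1)] X_measurable[OF uX] X_measurable[OF e]
  have bound: "N (nnorm (u n)) \<le> ennreal ((1 / 2) ^ n) * N (nnorm e)" for n
  proof (induction n)
    case (Suc n)
    have "N (nnorm (u (Suc n))) = ennreal (\<theta> powr s) * N (nnorm (convolve \<phi> (u n)))"
      unfolding uS using \<theta> by (subst N_nnorm_cmult) (auto intro: convolve_measurable)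
    also have "\<dots> \<le> ennreal (\<theta> powr s) * (ennreal K * N (nnorm (u n)))"
      using N_convolve[OF \<phi>(1), of "u n"] by (intro mult_left_mono) (auto simp: \<phi>)
    also have "\<dots> = ennreal (\<theta> powr s * K) * N (nnorm (u n))"
      by (simp add: ennreal_mult K_nonneg mult.assoc)
    also have "\<dots> \<le> ennreal (1 / 2) * (ennreal ((1 / 2) ^ n) * N (nnorm e))"
      by (intro mult_mono ennreal_leI \<theta> Suc) auto
    also have "\<dots> = ennreal ((1 / 2) ^ Suc n) * N (nnorm e)"
    proof -
      have "ennreal (1 / 2) * ennreal ((1 / 2) ^ n) = ennreal (1 / 2 * (1 / 2) ^ n)"
        by (rule ennreal_mult[symmetric]) auto
      then show ?thesis by (simp only: mult.assoc[symmetric] power_Suc)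
    qed
    finally show ?case .
  qed (simp add: u0)
  have geo: "(\<Sum>n. ennreal ((1 / 2) ^ n) * N (nnorm e)) = 2 * N (nnorm e)"
  proof -
    have "(\<Sum>n. ennreal ((1 / 2) ^ n)) = ennreal 2"
      using suminf_geometric[of "1 / 2 :: real"] by (subst suminf_ennreal2) auto
    then show ?thesis by simp
  qed
  have sum_le: "(\<Sum>n. N (nnorm (u n))) \<le> 2 * N (nnorm e)"
    unfolding geo[symmetric] by (intro suminf_le bound) auto
  then have sum: "(\<Sum>n. N (nnorm (u n))) < top"
    using X_finite[OF e] by (auto simp: ennreal_mult_less_top intro: order.strict_trans1)
  define d where "d = (\<lambda>x. \<Sum>n. u n x)"
  define S where "S m = (\<lambda>x. \<Sum>n<m. u n x)" for m
  have d: "d \<in> X" "N (nnorm d) \<le> 2 * N (nnorm e)" "(\<lambda>m. N (nnorm (\<lambda>x. d x - S m x))) \<longlonglongrightarrow> 0"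
    using series_converges[OF uX sum] sum_le unfolding d_def S_def by auto
  have SX: "S m \<in> X" for m
  proof (induction m)
    case 0
    then show ?case by (simp add: S_def X_def)
  next
    case (Suc m)
    then show ?case using X_add[OF Suc uX[of m]] by (simp add: S_def)
  qed
  note [measurable] = X_measurable[OF d(1)] X_measurable[OF SX]
  have cm [measurable]: "convolve \<phi> (S m) \<in> borel_measurable borel" "convolve \<phi> d \<in> borel_measurable borel"
    "convolve \<phi> (u m) \<in> borel_measurable borel" for m
    by (intro convolve_measurable; measurable)+
  \<comment> \<open>Telescoping: the iterate \<open>u m\<close> is the residual of the partial sum
    \<open>S m\<close>. The limit is then identified twice, through \<open>d\<close> and through the
    vanishing residual.\<close>
  have partial: "AE x in lborel. S m x + of_real \<theta> * convolve \<phi> (S m) x = e x - u m x" for m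
  proof (induction m)
    case 0
    have "convolve \<phi> (S 0) x = 0" for x by (simp add: S_def convolve_def)
    then show ?case by (simp add: S_def u0)
  next
    case (Suc m)
    have "AE x in lborel. convolve \<phi> (S (Suc m)) x = convolve \<phi> (S m) x + convolve \<phi> (u m) x"
      using convolve_add_AE[OF \<phi>(1) SX[of m] uX[of m]] by (simp add: S_def)
    with Suc show ?case
    proof eventually_elim
      case (elim x)
      have "S (Suc m) x + of_real \<theta> * convolve \<phi> (S (Suc m)) x
          = (S m x + of_real \<theta> * convolve \<phi> (S m) x) + u m x + of_real \<theta> * convolve \<phi> (u m) x"
        unfolding elim(2) by (simp add: S_def algebra_simps)
      then show ?case unfolding elim(1) by (simp add: uS)
    qed
  qed
  have "AE x in lborel. d x + of_real \<theta> * convolve \<phi> d x = e x"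
  proof (rule limit_unique_AE)
    let ?a = "\<lambda>m x. S m x + of_real \<theta> * convolve \<phi> (S m) x"
    have "N (nnorm (\<lambda>x. ?a m x - (d x + of_real \<theta> * convolve \<phi> d x)))
        \<le> ennreal (1 + \<theta> powr s * K) * N (nnorm (\<lambda>x. d x - S m x))" for m
    proof -
      have "N (nnorm (\<lambda>x. ?a m x - (d x + of_real \<theta> * convolve \<phi> d x)))
          = N (nnorm (\<lambda>x. (S m x - d x) + of_real \<theta> * (convolve \<phi> (S m) x - convolve \<phi> d x)))"
        by (simp add: algebra_simps)
      also have "\<dots> \<le> N (nnorm (\<lambda>x. S m x - d x))
          + N (nnorm (\<lambda>x. of_real \<theta> * (convolve \<phi> (S m) x - convolve \<phi> d x)))"
        by (intro N_nnorm_add) measurable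
      also have "\<dots> = N (nnorm (\<lambda>x. S m x - d x))
          + ennreal (\<theta> powr s) * N (nnorm (\<lambda>x. convolve \<phi> (S m) x - convolve \<phi> d x))"
      proof -
        have "N (nnorm (\<lambda>x. of_real \<theta> * (convolve \<phi> (S m) x - convolve \<phi> d x)))
            = ennreal (norm (of_real \<theta> :: complex) powr s) * N (nnorm (\<lambda>x. convolve \<phi> (S m) x - convolve \<phi> d x))"
          by (rule N_nnorm_cmult) measurable
        then show ?thesis using \<theta>(1) by (simp only: norm_of_real abs_of_nonneg)
      qed
      also have "\<dots> \<le> N (nnorm (\<lambda>x. S m x - d x))
          + ennreal (\<theta> powr s) * (ennreal K * N (nnorm (\<lambda>x. S m x - d x)))"
        using N_convolve_diff[OF \<phi>(1) SX[of m] d(1)] by (intro add_mono mult_left_mono) (auto simp: \<phi>)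
      also have "\<dots> = ennreal (1 + \<theta> powr s * K) * N (nnorm (\<lambda>x. S m x - d x))"
        using K_nonneg by (simp add: ennreal_mult distrib_right mult.assoc)
      finally show ?thesis by (simp add: N_nnorm_minus[of d])
    qed
    moreover have "(\<lambda>m. ennreal (1 + \<theta> powr s * K) * N (nnorm (\<lambda>x. d x - S m x))) \<longlonglongrightarrow> 0"
      using ennreal_tendsto_cmult[OF _ d(3), of "ennreal (1 + \<theta> powr s * K)"] by simp
    ultimately show "(\<lambda>m. N (nnorm (\<lambda>x. ?a m x - (d x + of_real \<theta> * convolve \<phi> d x)))) \<longlonglongrightarrow> 0"
      by (rule tendsto_0_le_ennreal)
    have "N (nnorm (\<lambda>x. ?a m x - e x)) = N (nnorm (u m))" for m
      using partial[of m] by (intro N_cong) (auto elim!: eventually_mono)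
    then have le: "N (nnorm (\<lambda>x. ?a m x - e x)) \<le> N (nnorm e) * ennreal ((1 / 2) ^ m)" for m
      using bound[of m] by (simp add: mult.commute)
    have "(\<lambda>m. N (nnorm e) * ennreal ((1 / 2) ^ m)) \<longlonglongrightarrow> 0"
    proof -
      have "(\<lambda>m. ennreal ((1 / 2) ^ m)) \<longlonglongrightarrow> ennreal 0"
        by (intro tendsto_ennrealI LIMSEQ_realpow_zero) auto
      from ennreal_tendsto_cmult[OF X_finite[OF e] this] show ?thesis by simp
    qed
    with le show "(\<lambda>m. N (nnorm (\<lambda>x. ?a m x - e x))) \<longlonglongrightarrow> 0"
      by (rule tendsto_0_le_ennreal)
  qed measurable
  with d show ?thesis by blast
qed

text \<open>Insert \<open>convolve f h\<close> and \<open>h\<close>: the constant is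
  \<open>K\<close> for the convolved difference plus 1 for the difference itself. As it is the same
  for all such \<open>f\<close>, mollification errors need to be estimated only on a dense
  class.\<close>

lemma N_convolve_sub_stable:
  assumes f: "f \<in> A" "(\<integral>\<^sup>+ z. norm (f z) \<partial>lborel) = 1" and g: "g \<in> X" and h: "h \<in> X"
  shows "N (nnorm (\<lambda>x. convolve f g x - g x))
    \<le> N (nnorm (\<lambda>x. convolve f h x - h x)) + ennreal (K + 1) * N (nnorm (\<lambda>x. g x - h x))"
proof -
  note [measurable] = A_measurable[OF f(1)] X_measurable[OF g] X_measurable[OF h]
    X_measurable[OF X_convolve[OF f(1) g]] X_measurable[OF X_convolve[OF f(1) h]]
  have "N (nnorm (\<lambda>x. convolve f g x - g x))
      \<le> N (nnorm (\<lambda>x. convolve f g x - convolve f h x)) + N (nnorm (\<lambda>x. convolve f h x - g x))"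
    by (intro N_nnorm_triangle) measurable
  also have "\<dots> \<le> ennreal K * N (nnorm (\<lambda>x. g x - h x))
      + (N (nnorm (\<lambda>x. convolve f h x - h x)) + N (nnorm (\<lambda>x. h x - g x)))"
    using N_convolve_diff[OF f(1) g h]
    by (intro add_mono N_nnorm_triangle) (auto simp: f intro: X_measurable[OF X_convolve[OF f(1) h]])
  also have "\<dots> = N (nnorm (\<lambda>x. convolve f h x - h x)) + ennreal (K + 1) * N (nnorm (\<lambda>x. g x - h x))"
    using K_nonneg by (simp add: N_nnorm_minus[of h] distrib_right add_ac)
  finally show ?thesis .
qed

end

subsection \<open>Mollification\<close>

lemma nn_integral_nnconv:
  fixes f G :: "'a::euclidean_space \<Rightarrow> ennreal"
  assumes [measurable]: "f \<in> borel_measurable borel" "G \<in> borel_measurable borel"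
  shows "(\<integral>\<^sup>+ x. nnconv f G x \<partial>lborel) = (\<integral>\<^sup>+ z. f z \<partial>lborel) * (\<integral>\<^sup>+ x. G x \<partial>lborel)"
proof -
  have "(\<integral>\<^sup>+ x. nnconv f G x \<partial>lborel) = (\<integral>\<^sup>+ y. \<integral>\<^sup>+ x. f (x - y) * G y \<partial>lborel \<partial>lborel)"
    unfolding nnconv_def by (rule lborel_pair.Fubini'[symmetric]) measurable
  also have "\<dots> = (\<integral>\<^sup>+ z. f z \<partial>lborel) * (\<integral>\<^sup>+ x. G x \<partial>lborel)"
    by (simp add: nn_integral_multc nn_integral_cmult nn_integral_lborel_translate)
  finally show ?thesis .
qed

interpretation L1: conv_norm "\<lambda>F :: real ^ 'n \<Rightarrow> ennreal. \<integral>\<^sup>+ x. F x \<partial>lborel" 1 1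
proof
  fix f G :: "real ^ 'n \<Rightarrow> ennreal"
  assume [measurable]: "f \<in> borel_measurable borel" "G \<in> borel_measurable borel"
  show "(\<integral>\<^sup>+ x. nnconv f G x \<partial>lborel)
      \<le> ennreal 1 * ennpow (\<integral>\<^sup>+ z. f z \<partial>lborel) 1 * (\<integral>\<^sup>+ x. G x \<partial>lborel)"
    by (simp add: nn_integral_nnconv)
next
  fix F :: "real ^ 'n \<Rightarrow> ennreal"
  assume "F \<in> borel_measurable borel" "(\<integral>\<^sup>+ x. F x \<partial>lborel) < top"
  then have "AE x in lborel. F x \<noteq> \<infinity>"
    by (intro nn_integral_noteq_infinite) auto
  then show "AE x in lborel. F x < top"
    by eventually_elim (simp add: less_top)
qed (auto intro: nn_integral_mono_AE simp: nn_integral_suminf nn_integral_cmult)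

text \<open>The cube has its corner, not its centre, at 0: sides of supports then add under
  convolution, and products of fine bumps stay inside \<open>cbox 0 1\<close>.\<close>

definition bump :: "nat \<Rightarrow> real ^ 'n \<Rightarrow> complex" where
  "bump n = (\<lambda>x. of_real (indicator (cbox 0 (inverse (real (Suc n)) *\<^sub>R 1)) x
      / measure lborel (cbox 0 (inverse (real (Suc n)) *\<^sub>R (1 :: real ^ 'n)))))"

lemma bump_measurable [measurable]: "bump n \<in> borel_measurable borel"
  unfolding bump_def by measurable

lemma bump_support: "bump n x \<noteq> 0 \<Longrightarrow> x \<in> cbox 0 (inverse (real (Suc n)) *\<^sub>R 1)"
  by (auto simp: bump_def indicator_def split: if_splits)

lemma bump_integral: "(\<integral>\<^sup>+ z. norm (bump n (z :: real ^ 'n)) \<partial>lborel) = 1"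
proof -
  let ?B = "cbox 0 (inverse (real (Suc n)) *\<^sub>R 1) :: (real ^ 'n) set"
  have pos: "0 < measure lborel ?B"
    by (simp add: content_pos_lt_eq Basis_vec_def) (auto simp: inner_axis)
  have "(\<integral>\<^sup>+ z. norm (bump n (z :: real ^ 'n)) \<partial>lborel)
      = (\<integral>\<^sup>+ z. ennreal (1 / measure lborel ?B) * indicator ?B z \<partial>lborel)"
    by (intro nn_integral_cong) (auto simp: bump_def indicator_def norm_divide)
  also have "\<dots> = ennreal (1 / measure lborel ?B) * emeasure lborel ?B"
    by (simp add: nn_integral_cmult_indicator)
  also have "\<dots> = ennreal (1 / measure lborel ?B) * ennreal (measure lborel ?B)"
    using emeasure_lborel_cbox_finite[of "0 :: real ^ 'n" "inverse (real (Suc n)) *\<^sub>R 1"]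
    by (subst emeasure_eq_ennreal_measure) (auto simp only: infinity_ennreal_def less_irrefl)
  also have "\<dots> = 1"
    using pos by (simp flip: ennreal_mult)
  finally show ?thesis .
qed

lemma bump_A: "bump n \<in> L1.A"
proof -
  have "inverse (real (Suc n)) \<le> 1" by (simp add: field_simps)
  then have "x \<in> cbox 0 1" if "bump n x \<noteq> 0" for x :: "real ^ 'n"
    using bump_support[OF that] by (auto simp: mem_box_cart intro: order_trans)
  then show ?thesis
    by (auto simp: L1.A_def bump_integral)
qed

lemma L1_X_iff: "w \<in> L1.X \<longleftrightarrow> w \<in> borel_measurable borel \<and> integrable lborel w"
  by (auto simp: L1.X_def integrable_iff_bounded)

section \<open>Bumps as an approximate identity in L^1\<close>

definition approx :: "(real ^ 'n \<Rightarrow> complex) \<Rightarrow> bool" where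
  "approx w \<longleftrightarrow> (\<lambda>n. \<integral>\<^sup>+ x. norm (convolve (bump n) w x - w x) \<partial>lborel) \<longlonglongrightarrow> 0"

lemma ennreal_less_scaled:
  assumes "0 < a"
  obtains \<delta> where "0 < \<delta>" "ennreal (3 * \<delta>) < a"
proof (cases a)
  case (real r)
  then show thesis using assms that[of "r / 6"] by (auto simp: ennreal_less_iff)
next
  case top
  then show thesis using that[of 1] by simp
qed

text \<open>\<open>N_convolve_sub_stable\<close> with \<open>K = 1\<close> gives an error of
  \<open>\<delta> + 2 * \<delta>\<close>, the origin of \<open>3 * \<delta>\<close>.\<close>

lemma approx_closed:
  assumes w: "w \<in> L1.X"
    and ex: "\<And>\<delta>. 0 < \<delta> \<Longrightarrow> \<exists>h\<in>L1.X. approx h \<and> (\<integral>\<^sup>+ x. norm (w x - h x) \<partial>lborel) \<le> ennreal \<delta>"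
  shows "approx w"
  unfolding approx_def
proof (rule order_tendstoI)
  fix a :: ennreal assume "0 < a"
  then obtain \<delta> where \<delta>: "0 < \<delta>" "ennreal (3 * \<delta>) < a"
    by (rule ennreal_less_scaled)
  obtain h where h: "h \<in> L1.X" "approx h" "(\<integral>\<^sup>+ x. norm (w x - h x) \<partial>lborel) \<le> ennreal \<delta>"
    using ex[OF \<delta>(1)] by blast
  have "\<forall>\<^sub>F n in sequentially. (\<integral>\<^sup>+ x. norm (convolve (bump n) h x - h x) \<partial>lborel) < ennreal \<delta>"
    using order_tendstoD(2)[OF h(2)[unfolded approx_def], of "ennreal \<delta>"] \<delta> by simp
  then show "\<forall>\<^sub>F n in sequentially. (\<integral>\<^sup>+ x. norm (convolve (bump n) w x - w x) \<partial>lborel) < a"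
  proof eventually_elim
    case (elim n)
    have "(\<integral>\<^sup>+ x. norm (convolve (bump n) w x - w x) \<partial>lborel)
        \<le> (\<integral>\<^sup>+ x. norm (convolve (bump n) h x - h x) \<partial>lborel)
          + ennreal (1 + 1) * (\<integral>\<^sup>+ x. norm (w x - h x) \<partial>lborel)"
      by (rule L1.N_convolve_sub_stable[OF bump_A bump_integral w h(1)])
    also have "\<dots> \<le> ennreal \<delta> + ennreal (1 + 1) * ennreal \<delta>"
      using elim h(3) by (intro add_mono mult_left_mono) auto
    also have "\<dots> = ennreal (3 * \<delta>)"
    proof -
      have "ennreal (1 + 1) * ennreal \<delta> = ennreal ((1 + 1) * \<delta>)"
        using \<delta> by (intro ennreal_mult[symmetric]) auto
      moreover have "ennreal \<delta> + ennreal ((1 + 1) * \<delta>) = ennreal (\<delta> + (1 + 1) * \<delta>)"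
        using \<delta> by (intro ennreal_plus[symmetric]) auto
      ultimately show ?thesis by (simp add: algebra_simps)
    qed
    finally show ?case using \<delta> by simp
  qed
qed auto

lemma approx_add:
  assumes "w \<in> L1.X" "u \<in> L1.X" "approx w" "approx u"
  shows "approx (\<lambda>x. w x + u x)"
proof -
  have le: "(\<integral>\<^sup>+ x. norm (convolve (bump n) (\<lambda>x. w x + u x) x - (w x + u x)) \<partial>lborel)
    \<le> (\<integral>\<^sup>+ x. norm (convolve (bump n) w x - w x) \<partial>lborel) + (\<integral>\<^sup>+ x. norm (convolve (bump n) u x - u x) \<partial>lborel)" for n
  proof -
    note [measurable] = L1.X_measurable[OF assms(1)] L1.X_measurable[OF assms(2)]
      L1.X_measurable[OF L1.X_convolve[OF bump_A[of n] assms(1)]]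
      L1.X_measurable[OF L1.X_convolve[OF bump_A[of n] assms(2)]]
    have "(\<integral>\<^sup>+ x. norm (convolve (bump n) (\<lambda>x. w x + u x) x - (w x + u x)) \<partial>lborel)
        = (\<integral>\<^sup>+ x. norm ((convolve (bump n) w x - w x) + (convolve (bump n) u x - u x)) \<partial>lborel)"
      using L1.convolve_add_AE[OF bump_A[of n] assms(1,2)]
      by (intro nn_integral_cong_AE) (auto elim!: eventually_mono simp: algebra_simps)
    also have "\<dots> \<le> (\<integral>\<^sup>+ x. norm (convolve (bump n) w x - w x) \<partial>lborel) + (\<integral>\<^sup>+ x. norm (convolve (bump n) u x - u x) \<partial>lborel)"
      by (rule L1.N_nnorm_add) measurable
    finally show ?thesis .
  qed
  have "(\<lambda>n. (\<integral>\<^sup>+ x. norm (convolve (bump n) w x - w x) \<partial>lborel)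
      + (\<integral>\<^sup>+ x. norm (convolve (bump n) u x - u x) \<partial>lborel)) \<longlonglongrightarrow> 0 + 0"
    using assms(3,4) unfolding approx_def by (intro tendsto_add)
  then show ?thesis
    unfolding approx_def by (intro tendsto_0_le_ennreal[OF le]) simp
qed

lemma approx_cmult:
  assumes w: "w \<in> L1.X" and "approx w"
  shows "approx (\<lambda>x. c * w x)"
proof -
  note [measurable] = L1.X_measurable[OF w]
  have "(\<integral>\<^sup>+ x. norm (convolve (bump n) (\<lambda>x. c * w x) x - c * w x) \<partial>lborel)
      = ennreal (norm c) * (\<integral>\<^sup>+ x. norm (convolve (bump n) w x - w x) \<partial>lborel)" for n
  proof -
    note [measurable] = L1.X_measurable[OF L1.X_convolve[OF bump_A[of n] w]]
    have "(\<integral>\<^sup>+ x. norm (convolve (bump n) (\<lambda>x. c * w x) x - c * w x) \<partial>lborel)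
        = (\<integral>\<^sup>+ x. norm (c * (convolve (bump n) w x - w x)) \<partial>lborel)"
      by (simp add: convolve_cmult_right right_diff_distrib)
    also have "\<dots> = ennreal (norm c) * (\<integral>\<^sup>+ x. norm (convolve (bump n) w x - w x) \<partial>lborel)"
      by (simp add: norm_mult ennreal_mult nn_integral_cmult)
    finally show ?thesis .
  qed
  moreover have "(\<lambda>n. ennreal (norm c) * (\<integral>\<^sup>+ x. norm (convolve (bump n) w x - w x) \<partial>lborel)) \<longlonglongrightarrow> ennreal (norm c) * 0"
    using assms(2) unfolding approx_def by (intro ennreal_tendsto_cmult) auto
  ultimately show ?thesis by (simp add: approx_def)
qed

lemma norm_le_of_mem_cbox:
  fixes z :: "real ^ 'n"
  assumes "z \<in> cbox 0 (\<epsilon> *\<^sub>R 1)"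
  shows "norm z \<le> real CARD('n) * \<epsilon>"
proof -
  have "norm z \<le> (\<Sum>i\<in>UNIV. \<bar>z $ i\<bar>)" by (rule norm_le_l1_cart)
  also have "\<dots> \<le> (\<Sum>i\<in>(UNIV :: 'n set). \<epsilon>)"
    using assms by (intro sum_mono) (auto simp: mem_box_cart)
  finally show ?thesis by simp
qed

lemma L1_X_indicator:
  assumes "U \<in> sets lborel" "emeasure lborel U < top"
  shows "(\<lambda>x. of_real (indicator U x)) \<in> L1.X"
proof -
  have [measurable]: "U \<in> sets borel" using assms by simp
  show ?thesis using assms by (auto simp: L1_X_iff integrable_indicator_iff less_top)
qed

text \<open>The mollified indicator of \<open>U\<close> has the same integral as that of \<open>U\<close> and tends to 1 on \<open>U\<close>,
  so no mass can stay outside \<open>U\<close>.\<close>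

lemma approx_open:
  fixes U :: "(real ^ 'n) set"
  assumes U: "open U" "emeasure lborel U < top"
  shows "approx (\<lambda>x. of_real (indicator U x))"
proof -
  have [measurable]: "U \<in> sets borel" using U by auto
  define F where "F n = nnconv (nnorm (bump n)) (indicator U)" for n
  have [measurable]: "F n \<in> borel_measurable borel" for n
    unfolding F_def by measurable
  have mass: "(\<integral>\<^sup>+ y. norm (bump n (x - y)) \<partial>lborel) = 1" for n and x :: "real ^ 'n"
    using nn_integral_lborel_reflect[of "nnorm (bump n)" x] by (simp add: bump_integral)
  have F1: "F n x \<le> 1" for n x
  proof -
    have "F n x \<le> (\<integral>\<^sup>+ y. norm (bump n (x - y)) \<partial>lborel)"
      unfolding F_def nnconv_def by (intro nn_integral_mono) (auto simp: indicator_def)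
    then show ?thesis by (simp add: mass)
  qed
  have FU: "\<forall>\<^sub>F n in sequentially. F n x = 1" if x: "x \<in> U" for x
  proof -
    obtain r where r: "0 < r" "ball x r \<subseteq> U" using U(1) x openE by blast
    \<comment> \<open>The support of \<open>bump n\<close> lies within
      \<open>CARD('n) / (n + 1)\<close> of 0; once this is below \<open>r\<close>, the average
      around \<open>x\<close> sees only \<open>U\<close>.\<close>
    have "(\<lambda>n. real CARD('n) * inverse (real (Suc n))) \<longlonglongrightarrow> real CARD('n) * 0"
      by (intro tendsto_mult tendsto_const LIMSEQ_inverse_real_of_nat)
    then have "\<forall>\<^sub>F n in sequentially. real CARD('n) * inverse (real (Suc n)) < r"
      using r by (intro order_tendstoD(2)[where y = "real CARD('n) * 0"]) auto
    then show ?thesis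
    proof eventually_elim
      case (elim n)
      have "F n x = (\<integral>\<^sup>+ y. norm (bump n (x - y)) \<partial>lborel)"
        unfolding F_def nnconv_def
      proof (rule nn_integral_cong)
        fix y
        show "ennreal (norm (bump n (x - y))) * indicator U y = ennreal (norm (bump n (x - y)))"
        proof (cases "bump n (x - y) = 0")
          case False
          then have "norm (x - y) < r"
            using norm_le_of_mem_cbox[OF bump_support[OF False]] elim by linarith
          then have "y \<in> U" using r by (auto simp: dist_norm)
          then show ?thesis by simp
        qed simp
      qed
      then show ?case by (simp add: mass)
    qed
  qed
  \<comment> \<open>The mollified indicator is a real number in [0, 1], so the distance to the
    indicator can be read off separately on \<open>U\<close> and on its complement.\<close>
  have conv: "convolve (bump n) (\<lambda>x. of_real (indicator U x)) x = of_real (enn2real (F n x))" for n x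
  proof -
    define m where "m = measure lborel (cbox 0 (inverse (real (Suc n)) *\<^sub>R (1 :: real ^ 'n)))"
    define h where "h y = indicator (cbox 0 (inverse (real (Suc n)) *\<^sub>R 1)) (x - y) / m * indicator U y"
      for y :: "real ^ 'n"
    have [measurable]: "h \<in> borel_measurable borel" unfolding h_def[abs_def] by measurable
    have h0: "0 \<le> h y" for y by (simp add: h_def m_def)
    have "convolve (bump n) (\<lambda>x. of_real (indicator U x)) x = (LINT y|lborel. of_real (h y))"
      by (subst convolve_lborel) (simp_all add: bump_def h_def m_def)
    also have "\<dots> = of_real (LINT y|lborel. h y)"
      by (rule integral_complex_of_real)
    also have "(LINT y|lborel. h y) = enn2real (\<integral>\<^sup>+ y. h y \<partial>lborel)"
      using h0 by (intro integral_eq_nn_integral) auto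
    also have "(\<integral>\<^sup>+ y. h y \<partial>lborel) = F n x"
      unfolding F_def nnconv_def
      by (intro nn_integral_cong) (auto simp: h_def m_def bump_def indicator_def norm_divide)
    finally show ?thesis .
  qed
  define I where "I n = (\<integral>\<^sup>+ x. indicator U x * (1 - F n x) \<partial>lborel)" for n
  define J where "J n = (\<integral>\<^sup>+ x. indicator (- U) x * F n x \<partial>lborel)" for n
  have "I \<longlonglongrightarrow> (\<integral>\<^sup>+ x. 0 \<partial>(lborel :: (real ^ 'n) measure))"
    unfolding I_def[abs_def]
  proof (rule nn_integral_dominated_convergence[where w = "indicator U"])
    show "AE x in lborel. (\<lambda>n. indicator U x * (1 - F n x)) \<longlonglongrightarrow> 0"
    proof (rule AE_I2)
      fix x
      show "(\<lambda>n. indicator U x * (1 - F n x)) \<longlonglongrightarrow> 0"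
      proof (cases "x \<in> U")
        case True
        then have "\<forall>\<^sub>F n in sequentially. indicator U x * (1 - F n x) = 0"
          using FU[OF True] by (auto elim: eventually_mono)
        then show ?thesis by (rule tendsto_eventually)
      qed simp
    qed
    show "(\<integral>\<^sup>+ x. indicator U x \<partial>lborel) < \<infinity>" using U by simp
  qed (auto simp: indicator_def)
  then have I0: "I \<longlonglongrightarrow> 0" by simp
  \<comment> \<open>Added to the mass \<open>?M\<close>, either one gives
    \<open>emeasure lborel U\<close>; finiteness of \<open>?M\<close> permits the
    cancellation.\<close>
  have IJ: "J n = I n" for n
  proof -
    let ?M = "\<integral>\<^sup>+ x. indicator U x * F n x \<partial>lborel"
    have "?M + J n = (\<integral>\<^sup>+ x. indicator U x * F n x + indicator (- U) x * F n x \<partial>lborel)"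
      unfolding J_def by (intro nn_integral_add[symmetric]) measurable
    also have "\<dots> = (\<integral>\<^sup>+ x. F n x \<partial>lborel)"
      by (intro nn_integral_cong) (auto simp: indicator_def)
    also have "\<dots> = emeasure lborel U"
      unfolding F_def by (subst nn_integral_nnconv) (auto simp: bump_integral)
    also have "\<dots> = (\<integral>\<^sup>+ x. indicator U x * F n x + indicator U x * (1 - F n x) \<partial>lborel)"
    proof -
      have "emeasure lborel U = (\<integral>\<^sup>+ x. indicator U x \<partial>lborel)" by simp
      also have "\<dots> = (\<integral>\<^sup>+ x. indicator U x * F n x + indicator U x * (1 - F n x) \<partial>lborel)"
        using F1 by (intro nn_integral_cong) (auto simp: indicator_def add_diff_inverse_ennreal)
      finally show ?thesis .
    qed
    also have "\<dots> = ?M + I n"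
      unfolding I_def by (intro nn_integral_add) measurable
    finally have eq: "?M + J n = ?M + I n" .
    have "?M \<le> (\<integral>\<^sup>+ x. indicator U x \<partial>lborel)"
      using F1 by (intro nn_integral_mono) (auto simp: indicator_def)
    then have "?M \<noteq> top" using U(2) by (auto simp: top_unique)
    with eq show ?thesis by (simp add: ennreal_add_left_cancel)
  qed
  have "(\<integral>\<^sup>+ x. norm (convolve (bump n) (\<lambda>x. of_real (indicator U x)) x - of_real (indicator U x)) \<partial>lborel)
      = 2 * I n" for n
  proof -
    have "(\<integral>\<^sup>+ x. norm (convolve (bump n) (\<lambda>x. of_real (indicator U x)) x - of_real (indicator U x)) \<partial>lborel)
      = (\<integral>\<^sup>+ x. indicator U x * (1 - F n x) + indicator (- U) x * F n x \<partial>lborel)"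
    proof (rule nn_integral_cong)
      fix x
      obtain t where t: "F n x = ennreal t" "0 \<le> t" "t \<le> 1"
        using F1[of n x] by (cases "F n x") (auto simp: top_unique)
      have "norm (complex_of_real t - of_real (indicator U x)) = \<bar>t - indicator U x\<bar>"
        by (simp flip: of_real_diff)
      then show "ennreal (norm (convolve (bump n) (\<lambda>x. of_real (indicator U x)) x - of_real (indicator U x)))
          = indicator U x * (1 - F n x) + indicator (- U) x * F n x"
        using t ennreal_minus[of t 1] unfolding conv by (cases "x \<in> U") auto
    qed
    also have "\<dots> = I n + J n"
      unfolding I_def J_def by (intro nn_integral_add) measurable
    finally show ?thesis by (simp add: IJ mult_2)
  qed
  then show ?thesis
    unfolding approx_def using ennreal_tendsto_cmult[OF _ I0, of 2] by simp
qed

text \<open>Outer regularity supplies an open superset of small excess, hence close in L^1.\<close>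

lemma approx_indicator:
  fixes S :: "(real ^ 'n) set"
  assumes S: "S \<in> sets lborel" "emeasure lborel S < top"
  shows "approx (\<lambda>x. of_real (indicator S x))"
proof (rule approx_closed)
  fix \<delta> :: real assume \<delta>: "0 < \<delta>"
  have [measurable]: "S \<in> sets borel" using S by simp
  obtain U where U: "open U" "S \<subseteq> U" "emeasure lborel (U - S) < ennreal \<delta>"
    using outer_regular_lborel[of S \<delta>] \<delta> by auto
  have [measurable]: "U \<in> sets borel" using U by auto
  have "emeasure lborel U = emeasure lborel (S \<union> (U - S))"
    using U(2) by (simp add: Un_absorb1)
  also have "\<dots> \<le> emeasure lborel S + emeasure lborel (U - S)"
    by (intro emeasure_subadditive) auto
  also have "\<dots> < top"
    using S U(3) by (auto intro: order.strict_trans)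
  finally have fin: "emeasure lborel U < top" .
  have "(\<integral>\<^sup>+ x. norm (complex_of_real (indicator S x) - of_real (indicator U x)) \<partial>lborel)
      = (\<integral>\<^sup>+ x. indicator (U - S) x \<partial>lborel)"
    using U(2) by (intro nn_integral_cong) (auto simp: indicator_def)
  then have "(\<integral>\<^sup>+ x. norm (complex_of_real (indicator S x) - of_real (indicator U x)) \<partial>lborel) \<le> ennreal \<delta>"
    using U(3) by simp
  then show "\<exists>h\<in>L1.X. approx h \<and>
      (\<integral>\<^sup>+ x. norm (complex_of_real (indicator S x) - h x) \<partial>lborel) \<le> ennreal \<delta>"
    using approx_open[OF U(1) fin] L1_X_indicator[of U] fin by (intro bexI) auto
qed (use L1_X_indicator S in auto)

lemma approx_integrable:
  fixes w :: "real ^ 'n \<Rightarrow> complex"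
  assumes "integrable lborel w"
  shows "approx w"
  using assms
proof (induction rule: integrable_induct)
  case (base S c)
  then have "approx (\<lambda>x. c * of_real (indicator S x))"
    by (intro approx_cmult approx_indicator L1_X_indicator) auto
  then show ?case by (simp add: scaleR_conv_of_real mult.commute)
next
  case (add f g)
  then show ?case by (intro approx_add) (auto simp: L1_X_iff)
next
  case (lim f u)
  show ?case
  proof (rule approx_closed)
    show "f \<in> L1.X" using lim by (auto simp: L1_X_iff)
    fix \<delta> :: real assume \<delta>: "0 < \<delta>"
    have "(\<lambda>i. \<integral>\<^sup>+ x. norm (f x - u i x) \<partial>lborel) \<longlonglongrightarrow> 0"
    proof (rule nn_integral_dominated_convergence_norm[where w = "\<lambda>x. 2 * norm (f x)"])
      have [measurable]: "f \<in> borel_measurable borel" using lim by auto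
      show "(\<integral>\<^sup>+ x. ennreal (2 * norm (f x)) \<partial>lborel) < \<infinity>"
        using lim by (simp add: integrable_iff_bounded ennreal_mult nn_integral_cmult ennreal_mult_less_top)
    qed (use lim in auto)
    from order_tendstoD(2)[OF this, of "ennreal \<delta>"]
    have "\<forall>\<^sub>F i in sequentially. (\<integral>\<^sup>+ x. norm (f x - u i x) \<partial>lborel) < ennreal \<delta>"
      using \<delta> by simp
    then obtain i where "(\<integral>\<^sup>+ x. norm (f x - u i x) \<partial>lborel) < ennreal \<delta>"
      by (auto simp: eventually_sequentially)
    then show "\<exists>h\<in>L1.X. approx h \<and> (\<integral>\<^sup>+ x. norm (f x - h x) \<partial>lborel) \<le> ennreal \<delta>"
      using lim by (intro bexI[of _ "u i"]) (auto simp: L1_X_iff)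
  qed
qed

section \<open>Sequences with summable increments, and supports of convolutions\<close>

context conv_norm
begin

lemma A_add:
  assumes "f \<in> A" "g \<in> A" shows "(\<lambda>x. f x + g x) \<in> A"
proof -
  have "(\<lambda>x. - g x) \<in> A" using assms(2) by (auto simp: A_def)
  from A_diff[OF assms(1) this] show ?thesis by simp
qed

lemma A_cmult: "f \<in> A \<Longrightarrow> (\<lambda>x. c * f x) \<in> A"
  by (auto simp: A_def norm_mult ennreal_mult nn_integral_cmult ennreal_mult_less_top)

lemma convolve_add_left_AE:
  assumes "f \<in> A" "f' \<in> A" "g \<in> X"
  shows "AE x in lborel. convolve (\<lambda>x. f x + f' x) g x = convolve f g x + convolve f' g x"
  using convolve_AE_finite[OF assms(1,3)] convolve_AE_finite[OF assms(2,3)]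
proof eventually_elim
  case (elim x)
  have [measurable]: "f \<in> borel_measurable borel" "f' \<in> borel_measurable borel" "g \<in> borel_measurable borel"
    using assms by auto
  have "convolve g (\<lambda>x. f x + f' x) x = convolve g f x + convolve g f' x"
    using elim by (intro convolve_add_right) (auto simp: nnconv_commute)
  then show ?case by (simp add: convolve_commute)
qed

text \<open>The limit is defined pointwise as a telescoping series, so a common zero of all
  \<open>u n\<close> is a zero of \<open>g\<close>, everywhere and not just almost everywhere. This
  carries the support condition over to the limit.\<close>

lemma sequence_converges:
  assumes u: "\<And>n. u n \<in> X" and sum: "(\<Sum>n. N (nnorm (\<lambda>x. u (Suc n) x - u n x))) < top"
  obtains g B where "g \<in> X" "(\<lambda>n. N (nnorm (\<lambda>x. u n x - g x))) \<longlonglongrightarrow> 0"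
    "B < top" "\<And>n. N (nnorm (u n)) \<le> B" "\<forall>x. (\<forall>n. u n x = 0) \<longrightarrow> g x = 0"
proof -
  define d where "d n = (\<lambda>x. u (Suc n) x - u n x)" for n
  define g where "g = (\<lambda>x. u 0 x + (\<Sum>n. d n x))"
  define B where "B = N (nnorm (u 0)) + (\<Sum>n. N (nnorm (d n)))"
  have dX: "d n \<in> X" for n unfolding d_def by (intro X_diff u)
  have sum': "(\<Sum>n. N (nnorm (d n))) < top" using sum by (simp add: d_def)
  note lim = series_converges[OF dX sum']
  note [measurable] = X_measurable[OF u] X_measurable[OF dX]
  have tel: "u n x = u 0 x + (\<Sum>k<n. d k x)" for n x
    by (induction n) (auto simp: d_def)
  have "N (nnorm (\<lambda>x. u n x - g x)) = N (nnorm (\<lambda>x. (\<Sum>k. d k x) - (\<Sum>k<n. d k x)))" for n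
    by (subst N_nnorm_minus[symmetric], subst tel) (simp add: g_def)
  then have lim_g: "(\<lambda>n. N (nnorm (\<lambda>x. u n x - g x))) \<longlonglongrightarrow> 0"
    using lim(4) by simp
  have "g \<in> X" unfolding g_def by (intro X_add u lim(2))
  moreover note lim_g
  moreover have "B < top" using sum' X_finite[OF u[of 0]] by (simp add: B_def)
  moreover have "N (nnorm (u n)) \<le> B" for n
  proof -
    have "N (nnorm (u n)) \<le> N (nnorm (u 0)) + (\<Sum>k<n. N (nnorm (d k)))"
    proof (induction n)
      case (Suc n)
      have "N (nnorm (u (Suc n))) = N (nnorm (\<lambda>x. u n x + d n x))" by (simp add: d_def)
      also have "\<dots> \<le> N (nnorm (u n)) + N (nnorm (d n))" by (intro N_nnorm_add) measurable
      also have "\<dots> \<le> N (nnorm (u 0)) + (\<Sum>k<n. N (nnorm (d k))) + N (nnorm (d n))"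
        by (intro add_mono Suc) auto
      finally show ?case by (simp add: add.assoc)
    qed simp
    also have "\<dots> \<le> B" unfolding B_def by (intro add_mono sum_le_suminf) auto
    finally show ?thesis .
  qed
  moreover have "\<forall>x. (\<forall>n. u n x = 0) \<longrightarrow> g x = 0"
    by (simp add: g_def d_def)
  ultimately show thesis by (rule that)
qed

end

lemma convolve_cmult_left:
  fixes f g :: "real ^ 'n \<Rightarrow> complex"
  assumes [measurable]: "f \<in> borel_measurable borel" "g \<in> borel_measurable borel"
  shows "convolve (\<lambda>x. c * f x) g x = c * convolve f g x"
  by (simp add: convolve_lborel mult.assoc)

lemma convolve_cong_AE:
  fixes f g h :: "real ^ 'n \<Rightarrow> complex"
  assumes [measurable]: "f \<in> borel_measurable borel" "g \<in> borel_measurable borel" "h \<in> borel_measurable borel"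
    and ae: "AE x in lborel. g x = h x"
  shows "convolve f g x = convolve f h x"
proof -
  have "AE y in lborel. f (x - y) * g y = f (x - y) * h y"
    using ae by eventually_elim simp
  then show ?thesis
    unfolding convolve_lborel[OF assms(1,2)] convolve_lborel[OF assms(1,3)]
    by (intro integral_cong_AE) auto
qed

lemma convolve_support:
  fixes f g :: "real ^ 'n \<Rightarrow> complex"
  assumes "\<And>z. f z \<noteq> 0 \<Longrightarrow> z \<in> cbox 0 (a *\<^sub>R 1)" "\<And>z. g z \<noteq> 0 \<Longrightarrow> z \<in> cbox 0 (b *\<^sub>R 1)"
    and "convolve f g x \<noteq> 0"
  shows "x \<in> cbox 0 ((a + b) *\<^sub>R 1)"
proof -
  obtain y where "f (x - y) * g y \<noteq> 0"
  proof (rule ccontr)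
    assume "\<not> thesis"
    then have "\<And>y. f (x - y) * g y = 0" using that by blast
    then have "convolve f g x = 0"
      unfolding convolve_def by (simp only: Bochner_Integration.integral_zero)
    then show False using assms(3) by simp
  qed
  then have "x - y \<in> cbox 0 (a *\<^sub>R 1)" "y \<in> cbox 0 (b *\<^sub>R 1)"
    using assms(1,2) by auto
  then have "0 \<le> x $ i - y $ i" "x $ i - y $ i \<le> a" "0 \<le> y $ i" "y $ i \<le> b" for i
    by (auto simp: mem_box_cart)
  then have "0 \<le> x $ i \<and> x $ i \<le> a + b" for i
    by (smt (verit))
  then show ?thesis by (auto simp: mem_box_cart)
qed

lemma A_imp_L1_X: "f \<in> L1.A \<Longrightarrow> f \<in> L1.X"
  by (simp add: L1.A_def L1.X_def)

section \<open>The amalgam instance and its approximate identity\<close>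

context amalgam_conv
begin

sublocale cn: conv_norm \<nu> s K
proof
  show "0 < s" by (rule s_pos)
  show "0 \<le> K" by (simp add: K_def)
  fix F :: "real ^ 'n \<Rightarrow> ennreal" and c
  assume F: "F \<in> borel_measurable borel"
  show "\<nu> (\<lambda>x. c * F x) = ennpow c s * \<nu> F"
    by (intro cmult borel_imp_lebesgue F)
  show "AE x in lborel. F x < top" if "\<nu> F < top"
    using finite_AE[OF borel_imp_lebesgue[OF F] that] by (simp add: AE_completion_iff)
qed (auto intro!: mono_AE suminf nnconv_unit_cell intro: borel_imp_lebesgue simp: AE_completion_iff)

text \<open>Cutting off large arguments and large values is eventually exact at each point, and the
  norm of \<open>g\<close> is the majorant.\<close>

lemma bounded_support_truncation:
  assumes g: "g \<in> cn.X" and \<delta>: "0 < \<delta>"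
  obtains h and m :: nat where "h \<in> cn.X" "\<And>x. norm (h x) \<le> real m" "\<And>x. h x \<noteq> 0 \<Longrightarrow> norm x \<le> real m"
    "\<nu> (nnorm (\<lambda>x. g x - h x)) < ennreal \<delta>"
proof -
  have [measurable]: "g \<in> borel_measurable borel" using g by auto
  define t where "t m x = (if norm x \<le> real m \<and> norm (g x) \<le> real m then g x else 0)" for m :: nat and x
  have [measurable]: "t m \<in> borel_measurable borel" for m
    unfolding t_def[abs_def] by measurable
  have "(\<lambda>m. \<nu> (nnorm (\<lambda>x. g x - t m x))) \<longlonglongrightarrow> 0"
  proof (rule dominated[where G = "nnorm g"])
    show "AE x in lebesgue. (\<lambda>m. ennreal (norm (g x - t m x))) \<longlonglongrightarrow> 0"
    proof (rule AE_I2)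
      fix x
      obtain M :: nat where M: "max (norm x) (norm (g x)) \<le> real M" using real_arch_simple by blast
      have "\<forall>\<^sub>F m in sequentially. ennreal (norm (g x - t m x)) = 0"
        using eventually_ge_at_top[of M]
      proof eventually_elim
        case (elim m)
        then have "real M \<le> real m" by simp
        with M show ?case by (simp add: t_def)
      qed
      then show "(\<lambda>m. ennreal (norm (g x - t m x))) \<longlonglongrightarrow> 0" by (rule tendsto_eventually)
    qed
  qed (use g in \<open>auto simp: t_def cn.X_def intro!: borel_imp_lebesgue\<close>)
  from order_tendstoD(2)[OF this, of "ennreal \<delta>"] obtain m
    where m: "\<nu> (nnorm (\<lambda>x. g x - t m x)) < ennreal \<delta>"
    using \<delta> by (auto simp: eventually_sequentially)
  show thesis
  proof (rule that[of "t m" m])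
    have "\<nu> (nnorm (t m)) \<le> \<nu> (nnorm g)" by (intro mono) (auto simp: t_def)
    then show "t m \<in> cn.X" using g by (auto simp: cn.X_def)
  qed (use m in \<open>auto simp: t_def split: if_splits\<close>)
qed

text \<open>One majorant for all \<open>n\<close>: every bump has mass 1 and support within
  \<open>CARD('n)\<close> of 0, so mollification keeps the bound and enlarges the support by a fixed
  radius.\<close>

lemma bump_convolve_bounded:
  fixes h :: "real ^ 'n \<Rightarrow> complex" and m :: nat
  assumes [measurable]: "h \<in> borel_measurable borel"
    and h: "\<And>x. norm (h x) \<le> real m" "\<And>x. h x \<noteq> 0 \<Longrightarrow> norm x \<le> real m"
  shows "ennreal (norm (convolve (bump n) h x - h x))
    \<le> ennreal (2 * real m) * indicator (cball 0 (real m + real CARD('n))) x"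
proof -
  have mass: "(\<integral>\<^sup>+ y. norm (bump n (x - y)) \<partial>lborel) = 1"
    using nn_integral_lborel_reflect[of "nnorm (bump n)" x] by (simp add: bump_integral)
  have "ennreal (norm (convolve (bump n) h x)) \<le> nnconv (nnorm (bump n)) (nnorm h) x"
    by (intro nnorm_convolve_le) auto
  also have "\<dots> \<le> (\<integral>\<^sup>+ y. ennreal (norm (bump n (x - y))) *
      (ennreal (real m) * indicator (cball 0 (real m + real CARD('n))) x) \<partial>lborel)"
    unfolding nnconv_def
  proof (intro nn_integral_mono)
    fix y
    show "ennreal (norm (bump n (x - y))) * ennreal (norm (h y))
      \<le> ennreal (norm (bump n (x - y))) * (ennreal (real m) * indicator (cball 0 (real m + real CARD('n))) x)"
    proof (cases "bump n (x - y) = 0 \<or> h y = 0")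
      case False
      have "norm (x - y) \<le> real CARD('n) * inverse (real (Suc n))"
        using False by (intro norm_le_of_mem_cbox bump_support) auto
      also have "\<dots> \<le> real CARD('n) * 1"
        by (intro mult_left_mono) (simp_all add: inverse_le_1_iff)
      finally have "norm (x - y) \<le> real CARD('n)" by simp
      moreover have "norm x \<le> norm (x - y) + norm y"
        using norm_triangle_ineq[of "x - y" y] by simp
      ultimately have "x \<in> cball 0 (real m + real CARD('n))"
        using h(2)[of y] False by simp
      then show ?thesis using h(1)[of y] by (intro mult_left_mono) auto
    qed auto
  qed
  also have "\<dots> = ennreal (real m) * indicator (cball 0 (real m + real CARD('n))) x"
    by (simp add: nn_integral_multc mass)
  finally have 1: "ennreal (norm (convolve (bump n) h x))
      \<le> ennreal (real m) * indicator (cball 0 (real m + real CARD('n))) x" .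
  have 2: "ennreal (norm (h x)) \<le> ennreal (real m) * indicator (cball 0 (real m + real CARD('n))) x"
    using h(1)[of x] h(2)[of x] by (cases "h x = 0") auto
  have "ennreal (norm (convolve (bump n) h x - h x)) \<le> ennreal (norm (convolve (bump n) h x)) + ennreal (norm (h x))"
    by (simp add: ennreal_plus[symmetric] norm_triangle_ineq4 del: ennreal_plus)
  also have "\<dots> \<le> ennreal (real m) * indicator (cball 0 (real m + real CARD('n))) x
      + ennreal (real m) * indicator (cball 0 (real m + real CARD('n))) x"
    by (intro add_mono 1 2)
  also have "\<dots> = ennreal (2 * real m) * indicator (cball 0 (real m + real CARD('n))) x"
    using ennreal_plus[of "real m" "real m"] by (simp only: mult_2 distrib_right of_nat_0_le_iff)
  finally show ?thesis .
qed

text \<open>For a bounded \<open>h\<close> of bounded support, convergence in L^1 gives a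
  subsequence that converges almost everywhere, and dominated convergence carries this over to
  \<open>\<nu>\<close>. As only a subsequence is controlled, the claim is the existence of
  arbitrarily large good indices; the construction needs a single one that serves both
  functions.\<close>

lemma approximate_identity:
  assumes g: "g \<in> cn.X" and w: "w \<in> L1.X" and \<delta>: "0 < \<delta>"
  shows "\<exists>n\<ge>M. \<nu> (nnorm (\<lambda>x. convolve (bump n) g x - g x)) \<le> ennreal \<delta> \<and>
    (\<integral>\<^sup>+ x. norm (convolve (bump n) w x - w x) \<partial>lborel) \<le> ennreal \<delta>"
proof -
  \<comment> \<open>Solves \<open>\<eta> + (K + 1) * \<eta> = \<delta>\<close>, the error budget of
    \<open>N_convolve_sub_stable\<close>.\<close>
  define \<eta> where "\<eta> = \<delta> / (K + 2)"
  have K: "0 \<le> K" by (rule cn.K_nonneg)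
  have \<eta>: "0 < \<eta>" "\<eta> + (K + 1) * \<eta> = \<delta>"
  proof -
    have "(K + 2) * \<eta> = \<delta>" using K by (simp add: \<eta>_def)
    then show "\<eta> + (K + 1) * \<eta> = \<delta>" by (simp add: algebra_simps)
  qed (use \<delta> K in \<open>simp add: \<eta>_def\<close>)
  obtain h and m :: nat where h: "h \<in> cn.X" "\<And>x. norm (h x) \<le> real m"
      "\<And>x. h x \<noteq> 0 \<Longrightarrow> norm x \<le> real m" "\<nu> (nnorm (\<lambda>x. g x - h x)) < ennreal \<eta>"
    using bounded_support_truncation[OF g \<eta>(1)] by metis
  have hm [measurable]: "h \<in> borel_measurable borel" using h(1) by auto
  let ?B = "cball 0 (real m + real CARD('n)) :: (real ^ 'n) set"
  have B: "emeasure lborel ?B < top"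
    using emeasure_lborel_cball_finite by simp
  have hX: "h \<in> L1.X"
  proof -
    have "(\<integral>\<^sup>+ x. norm (h x) \<partial>lborel) \<le> (\<integral>\<^sup>+ x. ennreal (real m) * indicator ?B x \<partial>lborel)"
    proof (intro nn_integral_mono)
      fix x
      show "ennreal (norm (h x)) \<le> ennreal (real m) * indicator ?B x"
        using h(2)[of x] h(3)[of x] by (cases "h x = 0") auto
    qed
    also have "\<dots> < top"
      using B by (simp add: nn_integral_cmult_indicator ennreal_mult_less_top)
    finally show ?thesis by (simp add: L1.X_def)
  qed
  define u where "u n = (\<lambda>x. convolve (bump n) h x - h x)" for n
  have uX: "u n \<in> L1.X" for n
    unfolding u_def by (intro L1.X_diff L1.X_convolve bump_A hX)
  have [measurable]: "u n \<in> borel_measurable borel" for n using uX[of n] by (rule L1.X_measurable)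
  have u0: "(\<lambda>n. \<integral>\<^sup>+ x. norm (u n x) \<partial>lborel) \<longlonglongrightarrow> 0"
    using approx_integrable[of h] hX by (simp add: L1_X_iff approx_def u_def)
  have "(\<lambda>n. enn2real (\<integral>\<^sup>+ x. norm (u n x) \<partial>lborel)) \<longlonglongrightarrow> enn2real 0"
    by (rule tendsto_enn2real) (use u0 in auto)
  then have "(\<lambda>n. LINT x|lborel. norm (u n x)) \<longlonglongrightarrow> 0"
    by (simp add: integral_eq_nn_integral)
  with tendsto_L1_AE_subseq[of lborel u] uX obtain r :: "nat \<Rightarrow> nat"
    where r: "strict_mono r" "AE x in lborel. (\<lambda>n. u (r n) x) \<longlonglongrightarrow> 0"
    by (auto simp: L1_X_iff)
  have maj: "(\<lambda>x. ennreal (2 * real m) * indicator ?B x) \<in> borel_measurable borel"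
    by (intro borel_measurable_times_ennreal borel_measurable_indicator) auto
  have "(\<lambda>k. \<nu> (nnorm (u (r k)))) \<longlonglongrightarrow> 0"
  proof (rule dominated[where G = "\<lambda>x. ennreal (2 * real m) * indicator ?B x"])
    show "AE x in lebesgue. ennreal (norm (u (r k) x)) \<le> ennreal (2 * real m) * indicator ?B x" for k
      unfolding u_def by (intro AE_I2 bump_convolve_bounded hm h)
    have "AE x in lborel. (\<lambda>k. ennreal (norm (u (r k) x))) \<longlonglongrightarrow> 0"
      using r(2)
    proof eventually_elim
      case (elim x)
      then have "(\<lambda>k. ennreal (norm (u (r k) x))) \<longlonglongrightarrow> ennreal 0"
        by (intro tendsto_ennrealI tendsto_norm_zero)
      then show ?case by simp
    qed
    then show "AE x in lebesgue. (\<lambda>k. ennreal (norm (u (r k) x))) \<longlonglongrightarrow> 0"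
      by (simp add: AE_completion_iff)
    show "\<nu> (\<lambda>x. ennreal (2 * real m) * indicator ?B x) < top"
    proof (rule finite_bounded_support[where S = ?B])
      have "(\<integral>\<^sup>+ x. ennpow (ennreal (2 * real m) * indicator ?B x) p \<partial>lebesgue)
          = (\<integral>\<^sup>+ x. ennreal ((2 * real m) powr p) * indicator ?B x \<partial>lborel)"
        by (subst nn_integral_completion, intro nn_integral_cong) (auto simp: ennpow_ennreal indicator_def simp del: ennreal_mult'')
      also have "\<dots> < top"
        using B by (simp add: nn_integral_cmult_indicator ennreal_mult_less_top)
      finally show "(\<integral>\<^sup>+ x. ennpow (ennreal (2 * real m) * indicator ?B x) p \<partial>lebesgue) < top" .
    qed (auto intro!: borel_imp_lebesgue maj)
  qed (auto intro!: borel_imp_lebesgue maj)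
  then have 1: "\<forall>\<^sub>F k in sequentially. \<nu> (nnorm (u (r k))) < ennreal \<eta>"
    using \<eta>(1) order_tendstoD(2)[of "\<lambda>k. \<nu> (nnorm (u (r k)))" 0 sequentially "ennreal \<eta>"] by simp
  have "(\<lambda>n. \<integral>\<^sup>+ x. norm (convolve (bump n) w x - w x) \<partial>lborel) \<longlonglongrightarrow> 0"
    using approx_integrable[of w] w by (simp add: L1_X_iff approx_def)
  from LIMSEQ_subseq_LIMSEQ[OF this r(1)]
  have "\<forall>\<^sub>F k in sequentially. (\<integral>\<^sup>+ x. norm (convolve (bump (r k)) w x - w x) \<partial>lborel) < ennreal \<delta>"
    using \<delta> order_tendstoD(2)[of "\<lambda>k. \<integral>\<^sup>+ x. norm (convolve (bump (r k)) w x - w x) \<partial>lborel" 0 sequentially "ennreal \<delta>"]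
    by (simp add: o_def)
  with 1 have "\<forall>\<^sub>F k in sequentially. \<nu> (nnorm (u (r k))) < ennreal \<eta> \<and>
      (\<integral>\<^sup>+ x. norm (convolve (bump (r k)) w x - w x) \<partial>lborel) < ennreal \<delta> \<and> M \<le> k"
    by (intro eventually_conj eventually_ge_at_top)
  then obtain k where k: "\<nu> (nnorm (u (r k))) < ennreal \<eta>"
      "(\<integral>\<^sup>+ x. norm (convolve (bump (r k)) w x - w x) \<partial>lborel) < ennreal \<delta>" "M \<le> k"
    by (auto simp: eventually_sequentially)
  have "\<nu> (nnorm (\<lambda>x. convolve (bump (r k)) g x - g x))
      \<le> \<nu> (nnorm (u (r k))) + ennreal (K + 1) * \<nu> (nnorm (\<lambda>x. g x - h x))"
    unfolding u_def by (intro cn.N_convolve_sub_stable bump_A bump_integral g h)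
  also have "\<dots> \<le> ennreal \<eta> + ennreal (K + 1) * ennreal \<eta>"
    using k h(4) by (intro add_mono mult_left_mono) auto
  also have "\<dots> = ennreal \<delta>"
  proof -
    have "ennreal (K + 1) * ennreal \<eta> = ennreal ((K + 1) * \<eta>)"
      using K \<eta> by (intro ennreal_mult[symmetric]) auto
    moreover have "ennreal \<eta> + ennreal ((K + 1) * \<eta>) = ennreal (\<eta> + (K + 1) * \<eta>)"
      using K \<eta> by (intro ennreal_plus[symmetric]) auto
    ultimately show ?thesis using \<eta>(2) by simp
  qed
  finally show ?thesis
    using k seq_suble[OF r(1), of k] by (intro exI[of _ "r k"]) auto
qed

subsection \<open>Factorization\<close>

text \<open>The invariant of the construction: \<open>c ^ n\<close> times the Dirac measure plus \<open>w\<close> is the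
  \<open>n\<close>-th partial product of the measures \<open>c \<delta> + (1 - c) bump\<close>.\<close>

definition factored :: "(real ^ 'n \<Rightarrow> complex) \<Rightarrow> real \<Rightarrow> nat \<Rightarrow> (real ^ 'n \<Rightarrow> complex) \<Rightarrow> (real ^ 'n \<Rightarrow> complex) \<Rightarrow> bool"
  where "factored h c n w g \<longleftrightarrow> w \<in> L1.A \<and> (\<forall>z. w z \<noteq> 0 \<longrightarrow> z \<in> cbox 0 ((1 - (1 / 2) ^ n) *\<^sub>R 1)) \<and>
    g \<in> cn.X \<and> (AE x in lborel. of_real (c ^ n) * g x + convolve w g x = h x)"

text \<open>The new measure is \<open>c\<close> times the sum of Dirac and \<open>\<theta>\<close>
  times the bump. Instead of inverting it on \<open>g\<close>, solve for the correction
  \<open>d = g' - g\<close>: its right-hand side is a multiple of the mollification error of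
  \<open>g\<close>, so a fine bump makes \<open>d\<close> small.\<close>

lemma factored_step:
  assumes inv: "factored h c n w g"
    and \<theta>: "0 < \<theta>" "\<theta> powr s * K \<le> 1 / 2" and c: "c = 1 / (1 + \<theta>)"
  shows "\<exists>w' g'. factored h c (Suc n) w' g' \<and>
    (\<integral>\<^sup>+ x. norm (w' x - w x) \<partial>lborel) \<le> ennreal ((1 / 2) ^ n + c ^ n) \<and>
    \<nu> (nnorm (\<lambda>x. g' x - g x)) \<le> ennreal ((1 / 2) ^ n)"
proof -
  define b where "b = \<theta> * c"
  have cb: "0 < c" "c \<le> 1" "0 \<le> b" "b \<le> 1" "c + b = 1" "c * (1 + \<theta>) = 1"
    using \<theta> by (auto simp: c b_def field_simps)
  have w: "w \<in> L1.A" "\<And>z. w z \<noteq> 0 \<Longrightarrow> z \<in> cbox 0 ((1 - (1 / 2) ^ n) *\<^sub>R 1)"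
    and g: "g \<in> cn.X" and id: "AE x in lborel. of_real (c ^ n) * g x + convolve w g x = h x"
    using inv by (auto simp: factored_def)
  \<comment> \<open>Small enough for both increments: the scaling by \<open>\<theta>\<close> in
    \<open>e\<close> costs \<open>\<theta> powr s\<close>, and the Neumann series costs 2.\<close>
  define \<delta> where "\<delta> = (1 / 2) ^ n / (1 + 2 * \<theta> powr s)"
  have pw: "0 \<le> \<theta> powr s" by simp
  have \<delta>: "0 < \<delta>" "2 * \<theta> powr s * \<delta> \<le> (1 / 2) ^ n" "\<delta> \<le> (1 / 2) ^ n"
  proof -
    have pos: "0 < 1 + 2 * \<theta> powr s" using pw by linarith
    then show d: "0 < \<delta>" by (simp add: \<delta>_def)
    have eq: "\<delta> + 2 * \<theta> powr s * \<delta> = (1 / 2) ^ n"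
    proof -
      have "(1 + 2 * \<theta> powr s) * \<delta> = (1 / 2) ^ n" using pos by (simp add: \<delta>_def)
      then show ?thesis by (simp add: algebra_simps)
    qed
    show "2 * \<theta> powr s * \<delta> \<le> (1 / 2) ^ n" using eq d by linarith
    have "0 \<le> 2 * \<theta> powr s * \<delta>" using d pw by simp
    then show "\<delta> \<le> (1 / 2) ^ n" using eq by linarith
  qed
  \<comment> \<open>The lower bound on \<open>k\<close> limits the side of the bump to
    \<open>(1 / 2) ^ Suc n\<close>, exactly the amount by which the support bound
    \<open>1 - (1 / 2) ^ n\<close> may grow.\<close>
  obtain k where k: "2 ^ Suc n \<le> k" "\<nu> (nnorm (\<lambda>x. convolve (bump k) g x - g x)) \<le> ennreal \<delta>"
      "(\<integral>\<^sup>+ x. norm (convolve (bump k) w x - w x) \<partial>lborel) \<le> ennreal \<delta>"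
    using approximate_identity[OF g A_imp_L1_X[OF w(1)] \<delta>(1), of "2 ^ Suc n"] by blast
  define \<phi> where "\<phi> = (bump k :: real ^ 'n \<Rightarrow> complex)"
  have \<phi>: "\<phi> \<in> L1.A" "(\<integral>\<^sup>+ z. norm (\<phi> z) \<partial>lborel) = 1"
    by (simp_all add: \<phi>_def bump_A bump_integral)
  \<comment> \<open>Applied to \<open>g + d\<close>, the new measure gives \<open>c\<close> times
    the sum of \<open>g\<close>, \<open>\<theta>\<close> times the mollified \<open>g\<close>, and
    \<open>e\<close>. This choice of \<open>e\<close> cancels the mollified term and leaves
    \<open>c * (1 + \<theta>) * g\<close>, which is \<open>g\<close>.\<close>
  define e where "e = (\<lambda>x. of_real (- \<theta>) * (convolve \<phi> g x - g x))"
  have e: "e \<in> cn.X"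
    unfolding e_def by (intro cn.X_cmult cn.X_diff cn.X_convolve \<phi> g)
  obtain d where d: "d \<in> cn.X" "AE x in lborel. d x + of_real \<theta> * convolve \<phi> d x = e x"
      "\<nu> (nnorm d) \<le> 2 * \<nu> (nnorm e)"
    using cn.solve_perturbed_identity[OF \<phi> less_imp_le[OF \<theta>(1)] \<theta>(2) e] by blast
  define g' where "g' = (\<lambda>x. g x + d x)"
  \<comment> \<open>Expand the product of \<open>c ^ n\<close> Dirac plus \<open>w\<close> with
    \<open>c\<close> Dirac plus \<open>b * \<phi>\<close>, and drop its Dirac part of mass
    \<open>c ^ Suc n\<close>.\<close>
  define w' where "w' = (\<lambda>x. (of_real c * w x + of_real b * convolve w \<phi> x) + of_real (c ^ n * b) * \<phi> x)"
  have g'X: "g' \<in> cn.X" unfolding g'_def by (intro cn.X_add g d)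
  have w\<phi>X: "convolve w \<phi> \<in> L1.X"
    by (intro L1.X_convolve w A_imp_L1_X \<phi>)
  have e1: "inverse (real (Suc k)) \<le> (1 / 2) ^ Suc n"
  proof -
    have "real (2 ^ Suc n) \<le> real k" using k(1) by (rule of_nat_mono)
    then have "(2 :: real) ^ Suc n \<le> real (Suc k)" by simp
    then have "inverse (real (Suc k)) \<le> inverse (2 ^ Suc n)"
      by (intro le_imp_inverse_le) auto
    then show ?thesis by (simp add: power_one_over inverse_eq_divide)
  qed
  have box_mono: "z \<in> cbox 0 (t *\<^sub>R (1 :: real ^ 'n))" if "z \<in> cbox 0 (r *\<^sub>R 1)" "r \<le> t" for z r t
    using that by (auto simp: mem_box_cart intro: order_trans)
  have supp\<phi>: "z \<in> cbox 0 ((1 / 2) ^ Suc n *\<^sub>R 1)" if "\<phi> z \<noteq> 0" for z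
    using that unfolding \<phi>_def by (intro box_mono[OF bump_support e1])
  have half: "(1 - (1 / 2) ^ n) + (1 / 2) ^ Suc n = (1 - (1 / 2) ^ Suc n :: real)"
    by simp
  have suppw\<phi>: "z \<in> cbox 0 ((1 - (1 / 2) ^ Suc n) *\<^sub>R 1)" if "convolve w \<phi> z \<noteq> 0" for z
    unfolding half[symmetric] by (rule convolve_support[OF w(2) supp\<phi> that])
  have pow2: "(1 / 2 :: real) ^ n \<le> 1" by (simp add: power_le_one)
  have w\<phi>: "convolve w \<phi> \<in> L1.A"
  proof -
    have "z \<in> cbox 0 1" if "convolve w \<phi> z \<noteq> 0" for z
      using box_mono[OF suppw\<phi>[OF that], of 1] by simp
    then show ?thesis using w\<phi>X by (auto simp: L1.A_def L1.X_def)
  qed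
  have w'A: "w' \<in> L1.A"
    unfolding w'_def by (intro L1.A_add L1.A_cmult w \<phi> w\<phi>)
  have suppw': "z \<in> cbox 0 ((1 - (1 / 2) ^ Suc n) *\<^sub>R 1)" if "w' z \<noteq> 0" for z
  proof -
    have "w z \<noteq> 0 \<or> convolve w \<phi> z \<noteq> 0 \<or> \<phi> z \<noteq> 0"
      using that by (auto simp: w'_def)
    then show ?thesis
    proof (elim disjE)
      assume "w z \<noteq> 0"
      then show ?thesis by (intro box_mono[OF w(2)]) auto
    next
      assume "convolve w \<phi> z \<noteq> 0"
      then show ?thesis by (rule suppw\<phi>)
    next
      assume 3: "\<phi> z \<noteq> 0"
      \<comment> \<open>True because the exponent is at least 1; so already at \<open>n = 0\<close>
        the support bound has room for the fresh bump.\<close>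
      have "(1 / 2 :: real) ^ Suc n \<le> 1 - (1 / 2) ^ Suc n" using pow2 by simp
      then show ?thesis by (rule box_mono[OF supp\<phi>[OF 3]])
    qed
  qed
  note [measurable] = L1.A_measurable[OF \<phi>(1)] L1.A_measurable[OF w(1)] L1.A_measurable[OF w\<phi>]
    cn.X_measurable[OF g] cn.X_measurable[OF d(1)] cn.X_measurable[OF g'X]
    cn.X_measurable[OF cn.X_convolve[OF \<phi>(1) g'X]]
  have split: "AE x in lborel. g x = of_real c * g' x + of_real b * convolve \<phi> g' x"
    using d(2) cn.convolve_add_AE[OF \<phi>(1) g d(1)]
  proof eventually_elim
    case (elim x)
    have bc: "complex_of_real b = of_real \<theta> * of_real c" by (simp add: b_def)
    have c1: "of_real c * (1 + complex_of_real \<theta>) = 1"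
      using cb(6) by (metis of_real_1 of_real_add of_real_mult)
    have "of_real c * g' x + of_real b * convolve \<phi> g' x
        = of_real c * (g x + (d x + of_real \<theta> * convolve \<phi> d x) + of_real \<theta> * convolve \<phi> g x)"
      using elim(2) by (simp add: g'_def bc algebra_simps)
    also have "\<dots> = of_real c * (1 + of_real \<theta>) * g x"
      unfolding elim(1) e_def by (simp add: algebra_simps)
    finally show ?case using c1 by simp
  qed
  have "AE x in lborel. of_real (c ^ Suc n) * g' x + convolve w' g' x = h x"
  proof -
    have X1: "(\<lambda>x. of_real c * g' x) \<in> cn.X" "(\<lambda>x. of_real b * convolve \<phi> g' x) \<in> cn.X"
      by (intro cn.X_cmult cn.X_convolve g'X \<phi>)+
    have A1: "(\<lambda>x. of_real c * w x) \<in> L1.A" "(\<lambda>x. of_real b * convolve w \<phi> x) \<in> L1.A"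
      "(\<lambda>x. of_real (c ^ n * b) * \<phi> x) \<in> L1.A"
      by (intro L1.A_cmult w w\<phi> \<phi>)+
    have wg: "convolve w g x = convolve w (\<lambda>x. of_real c * g' x + of_real b * convolve \<phi> g' x) x" for x
      by (intro convolve_cong_AE split) measurable
    show ?thesis
      using id split cn.convolve_add_AE[OF w(1) X1] cn.convolve_assoc_AE[OF w(1) \<phi>(1) g'X]
        cn.convolve_add_left_AE[OF L1.A_add[OF A1(1,2)] A1(3) g'X]
        cn.convolve_add_left_AE[OF A1(1,2) g'X]
    proof eventually_elim
      case (elim x)
      have "convolve w' g' x = of_real c * convolve w g' x + of_real b * convolve (convolve w \<phi>) g' x
          + of_real (c ^ n * b) * convolve \<phi> g' x"
        unfolding w'_def elim(5) elim(6) by (simp add: convolve_cmult_left)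
      moreover have "convolve w g x = of_real c * convolve w g' x + of_real b * convolve w (convolve \<phi> g') x"
        unfolding wg elim(3) by (simp add: convolve_cmult_right)
      ultimately have "of_real (c ^ Suc n) * g' x + convolve w' g' x
          = of_real (c ^ n) * (of_real c * g' x + of_real b * convolve \<phi> g' x) + convolve w g x"
        unfolding elim(4) by (simp add: algebra_simps)
      then show ?case unfolding elim(2)[symmetric] elim(1) .
    qed
  qed
  then have "factored h c (Suc n) w' g'"
    using w'A suppw' g'X by (simp add: factored_def)
  moreover have "(\<integral>\<^sup>+ x. norm (w' x - w x) \<partial>lborel) \<le> ennreal ((1 / 2) ^ n + c ^ n)"
  proof -
    \<comment> \<open>By \<open>c = 1 - b\<close> the increment is a mollification error of
      \<open>w\<close> plus the bump fed by the old Dirac part. The latter has mass at most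
      \<open>c ^ n\<close>, which is summable because \<open>c < 1\<close>.\<close>
    have "w' x - w x = of_real b * (convolve \<phi> w x - w x) + of_real (c ^ n * b) * \<phi> x" for x
    proof -
      have c1: "complex_of_real c = 1 - of_real b"
        using cb(5) by (metis add_diff_cancel_right' of_real_1 of_real_diff)
      have comm: "convolve w \<phi> x = convolve \<phi> w x" by (rule convolve_commute) measurable
      show ?thesis unfolding w'_def c1 comm by (simp add: algebra_simps)
    qed
    then have "(\<integral>\<^sup>+ x. norm (w' x - w x) \<partial>lborel)
        = (\<integral>\<^sup>+ x. norm (of_real b * (convolve \<phi> w x - w x) + of_real (c ^ n * b) * \<phi> x) \<partial>lborel)"
      by simp
    also have "\<dots> \<le> (\<integral>\<^sup>+ x. norm (of_real b * (convolve \<phi> w x - w x)) \<partial>lborel)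
        + (\<integral>\<^sup>+ x. norm (of_real (c ^ n * b) * \<phi> x) \<partial>lborel)"
      by (rule L1.N_nnorm_add) (auto intro!: borel_measurable_times borel_measurable_diff convolve_measurable)
    also have "\<dots> = ennreal b * (\<integral>\<^sup>+ x. norm (convolve \<phi> w x - w x) \<partial>lborel)
        + ennreal (c ^ n * b) * (\<integral>\<^sup>+ x. norm (\<phi> x) \<partial>lborel)"
    proof -
      have m: "convolve \<phi> w \<in> borel_measurable borel" by (intro convolve_measurable) auto
      note [measurable] = m
      have "0 \<le> c ^ n * b" using cb by auto
      then show ?thesis
        using cb by (simp add: norm_mult ennreal_mult nn_integral_cmult del: of_real_mult of_real_power)
    qed
    also have "\<dots> \<le> ennreal 1 * ennreal ((1 / 2) ^ n) + ennreal (c ^ n) * 1"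
    proof (intro add_mono mult_mono ennreal_leI)
      show "(\<integral>\<^sup>+ x. norm (convolve \<phi> w x - w x) \<partial>lborel) \<le> ennreal ((1 / 2) ^ n)"
        using k(3) \<delta>(3) unfolding \<phi>_def by (meson ennreal_leI order_trans)
      show "c ^ n * b \<le> c ^ n" using cb by (simp add: mult_left_le)
    qed (use cb \<phi> in auto)
    also have "\<dots> = ennreal ((1 / 2) ^ n + c ^ n)"
      using cb by simp
    finally show ?thesis .
  qed
  moreover have "\<nu> (nnorm (\<lambda>x. g' x - g x)) \<le> ennreal ((1 / 2) ^ n)"
  proof -
    have "\<nu> (nnorm (\<lambda>x. g' x - g x)) = \<nu> (nnorm d)" by (simp add: g'_def)
    also have "\<dots> \<le> 2 * \<nu> (nnorm e)" by (rule d)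
    also have "\<nu> (nnorm e) = ennreal (norm (of_real (- \<theta>) :: complex) powr s) * \<nu> (nnorm (\<lambda>x. convolve \<phi> g x - g x))"
      unfolding e_def by (rule cn.N_nnorm_cmult) (auto intro!: borel_measurable_diff convolve_measurable)
    also have "norm (of_real (- \<theta>) :: complex) = \<theta>" using \<theta> by simp
    also have "2 * (ennreal (\<theta> powr s) * \<nu> (nnorm (\<lambda>x. convolve \<phi> g x - g x)))
        \<le> 2 * (ennreal (\<theta> powr s) * ennreal \<delta>)"
      using k(2) unfolding \<phi>_def by (intro mult_left_mono) auto
    also have "\<dots> = ennreal (2 * \<theta> powr s * \<delta>)"
    proof -
      have "ennreal (2 * \<theta> powr s * \<delta>) = ennreal 2 * ennreal (\<theta> powr s * \<delta>)"
        using \<delta> unfolding mult.assoc by (intro ennreal_mult) auto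
      also have "ennreal (\<theta> powr s * \<delta>) = ennreal (\<theta> powr s) * ennreal \<delta>"
        using \<delta> by (intro ennreal_mult) auto
      finally show ?thesis by simp
    qed
    also have "\<dots> \<le> ennreal ((1 / 2) ^ n)" by (intro ennreal_leI \<delta>)
    finally show ?thesis .
  qed
  ultimately show ?thesis by blast
qed

lemma factorization:
  assumes h: "h \<in> cn.X"
  shows "\<exists>f\<in>L1.A. \<exists>g\<in>cn.X. AE x in lborel. h x = convolve f g x"
proof -
  \<comment> \<open>Gives \<open>\<theta> powr s = 1 / (2 * (K + 1))\<close>, which makes each
    Neumann step at least halve \<open>\<nu>\<close>.\<close>
  define \<theta> where "\<theta> = (1 / (2 * (K + 1))) powr (1 / s)"
  have K: "0 \<le> K" by (rule cn.K_nonneg)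
  have sp: "0 < s" by (rule s_pos)
  have \<theta>: "0 < \<theta>" "\<theta> powr s * K \<le> 1 / 2"
  proof -
    show "0 < \<theta>" using K by (simp add: \<theta>_def)
    have eq: "\<theta> powr s = 1 / (2 * (K + 1))"
      using K sp by (simp add: \<theta>_def powr_powr del: min_less_iff_conj)
    then show "\<theta> powr s * K \<le> 1 / 2" unfolding eq using K by (simp add: field_simps)
  qed
  define c where "c = 1 / (1 + \<theta>)"
  have c: "0 < c" "c < 1" using \<theta> by (auto simp: c_def field_simps)
  define P where "P n z \<longleftrightarrow> factored h c n (fst z) (snd z)" for n and z :: "(real ^ 'n \<Rightarrow> complex) \<times> (real ^ 'n \<Rightarrow> complex)"
  define Q where "Q n z z' \<longleftrightarrow> (\<integral>\<^sup>+ x. norm (fst z' x - fst z x) \<partial>lborel) \<le> ennreal ((1 / 2) ^ n + c ^ n) \<and>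
    \<nu> (nnorm (\<lambda>x. snd z' x - snd z x)) \<le> ennreal ((1 / 2) ^ n)"
    for n and z z' :: "(real ^ 'n \<Rightarrow> complex) \<times> (real ^ 'n \<Rightarrow> complex)"
  \<comment> \<open>Each bump depends on the pair reached so far, hence dependent choice. The start
    is \<open>w = 0\<close> and \<open>g = h\<close>, with all mass in the Dirac part and a support
    cube of side 0.\<close>
  have "\<exists>F. \<forall>n. P n (F n) \<and> Q n (F n) (F (Suc n))"
  proof (rule dependent_nat_choice)
    have "P 0 (\<lambda>_. 0, h)"
      using h by (simp add: P_def factored_def convolve_def L1.A_def)
    then show "\<exists>z. P 0 z" by blast
  next
    fix z n assume "P n z"
    then obtain w' g' where "factored h c (Suc n) w' g'"
      "(\<integral>\<^sup>+ x. norm (w' x - fst z x) \<partial>lborel) \<le> ennreal ((1 / 2) ^ n + c ^ n)"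
      "\<nu> (nnorm (\<lambda>x. g' x - snd z x)) \<le> ennreal ((1 / 2) ^ n)"
      using factored_step[OF _ \<theta> c_def, of h n "fst z" "snd z"] unfolding P_def by blast
    then have "P (Suc n) (w', g') \<and> Q n z (w', g')"
      by (simp add: P_def Q_def)
    then show "\<exists>z'. P (Suc n) z' \<and> Q n z z'" by blast
  qed
  then obtain F where F: "\<And>n. P n (F n)" "\<And>n. Q n (F n) (F (Suc n))" by blast
  define w where "w n = fst (F n)" for n
  define u where "u n = snd (F n)" for n
  have w: "w n \<in> L1.A" and u: "u n \<in> cn.X"
    and id: "AE x in lborel. of_real (c ^ n) * u n x + convolve (w n) (u n) x = h x" for n
    using F(1)[of n] by (auto simp: P_def factored_def w_def u_def)
  have geo: "summable (\<lambda>n. (1 / 2 :: real) ^ n)" "summable (\<lambda>n. (1 / 2) ^ n + c ^ n)"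
    using c by (auto intro!: summable_add summable_geometric)
  have "(\<Sum>n. \<integral>\<^sup>+ x. norm (w (Suc n) x - w n x) \<partial>lborel) \<le> (\<Sum>n. ennreal ((1 / 2) ^ n + c ^ n))"
    using F(2) by (intro suminf_le) (auto simp: Q_def w_def)
  also have "\<dots> < top"
    using geo(2) c by (subst suminf_ennreal2) auto
  finally have sw: "(\<Sum>n. \<integral>\<^sup>+ x. norm (w (Suc n) x - w n x) \<partial>lborel) < top" .
  have "(\<Sum>n. \<nu> (nnorm (\<lambda>x. u (Suc n) x - u n x))) \<le> (\<Sum>n. ennreal ((1 / 2) ^ n))"
    using F(2) by (intro suminf_le) (auto simp: Q_def u_def)
  also have "\<dots> < top"
    using geo(1) by (subst suminf_ennreal2) auto
  finally have su: "(\<Sum>n. \<nu> (nnorm (\<lambda>x. u (Suc n) x - u n x))) < top" .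
  obtain f B' where f: "f \<in> L1.X" "(\<lambda>n. \<integral>\<^sup>+ x. norm (w n x - f x) \<partial>lborel) \<longlonglongrightarrow> 0"
      "B' < top" "\<And>n. (\<integral>\<^sup>+ x. norm (w n x) \<partial>lborel) \<le> B'"
      "\<forall>x. (\<forall>n. w n x = 0) \<longrightarrow> f x = 0"
    by (rule L1.sequence_converges[OF A_imp_L1_X[OF w] sw]) (rule that; assumption)
  have fA: "f \<in> L1.A"
  proof -
    have "z \<in> cbox 0 1" if fz: "f z \<noteq> 0" for z
    proof -
      obtain n where "w n z \<noteq> 0" using f(5) fz by blast
      then show ?thesis using w[of n] by (auto simp: L1.A_def)
    qed
    then show ?thesis using f(1) by (auto simp: L1.A_def L1.X_def)
  qed
  obtain g B where g: "g \<in> cn.X" "(\<lambda>n. \<nu> (nnorm (\<lambda>x. u n x - g x))) \<longlonglongrightarrow> 0"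
      "B < top" "\<And>n. \<nu> (nnorm (u n)) \<le> B" "\<forall>x. (\<forall>n. u n x = 0) \<longrightarrow> g x = 0"
    by (rule cn.sequence_converges[OF u su]) (rule that; assumption)
  have conv_lim: "(\<lambda>n. \<nu> (nnorm (\<lambda>x. convolve (w n) (u n) x - convolve f g x))) \<longlonglongrightarrow> 0"
    by (rule cn.convolve_tendsto[OF w fA u g(1) f(2) g(2) g(4) g(3)])
  note [measurable] = cn.X_measurable[OF u] cn.X_measurable[OF h]
    cn.X_measurable[OF cn.X_convolve[OF w u]] cn.X_measurable[OF cn.X_convolve[OF fA g(1)]]
  \<comment> \<open>The error is the Dirac part \<open>c ^ n * u n\<close>; since \<open>B\<close>
    bounds all \<open>u n\<close>, it decays like the powers of \<open>c powr s\<close>.\<close>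
  have "\<nu> (nnorm (\<lambda>x. convolve (w n) (u n) x - h x)) \<le> B * ennreal ((c powr s) ^ n)" for n
  proof -
    have "AE x in lborel. nnorm (\<lambda>x. convolve (w n) (u n) x - h x) x = nnorm (\<lambda>x. of_real (c ^ n) * u n x) x"
      using id[of n]
    proof eventually_elim
      case (elim x)
      show ?case unfolding elim[symmetric] by (simp add: norm_mult)
    qed
    then have "\<nu> (nnorm (\<lambda>x. convolve (w n) (u n) x - h x)) = \<nu> (nnorm (\<lambda>x. of_real (c ^ n) * u n x))"
      by (rule cn.N_cong)
    also have "\<dots> = ennreal (norm (of_real (c ^ n) :: complex) powr s) * \<nu> (nnorm (u n))"
      by (rule cn.N_nnorm_cmult) measurable
    also have "norm (of_real (c ^ n) :: complex) powr s = (c powr s) ^ n"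
    proof -
      have "norm (of_real (c ^ n) :: complex) = c ^ n" using c by (simp add: norm_power)
      moreover have "(c ^ n) powr s = (c powr s) ^ n"
        using c(1) by (induction n) (simp_all add: powr_mult)
      ultimately show ?thesis by simp
    qed
    finally show ?thesis using g(4)[of n] by (simp add: mult.commute[of B] mult_left_mono)
  qed
  moreover have "(\<lambda>n. B * ennreal ((c powr s) ^ n)) \<longlonglongrightarrow> 0"
  proof -
    have "c powr s < 1"
      using c sp powr_less_mono2[of s c 1] by (simp del: min_less_iff_conj)
    then have "(\<lambda>n. ennreal ((c powr s) ^ n)) \<longlonglongrightarrow> ennreal 0"
      using c by (intro tendsto_ennrealI LIMSEQ_realpow_zero) auto
    from ennreal_tendsto_cmult[OF g(3) this] show ?thesis by simp
  qed
  ultimately have "(\<lambda>n. \<nu> (nnorm (\<lambda>x. convolve (w n) (u n) x - h x))) \<longlonglongrightarrow> 0"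
    by (rule tendsto_0_le_ennreal)
  then have "AE x in lborel. h x = convolve f g x"
    using conv_lim by (intro cn.limit_unique_AE[of "\<lambda>n. convolve (w n) (u n)"]) measurable
  then show ?thesis using fA g(1) by blast
qed

section \<open>Young's inequality for the full spaces, and membership of the factors\<close>

lemma nnconv_amalgam_finite:
  assumes f [measurable]: "f \<in> borel_measurable borel" and fin: "amalgam_norm 1 r v (nnorm f) < top"
    and g: "g \<in> cn.X" and r: "0 < r" "r \<le> 1" "r \<le> q"
    and v': "0 < D" "\<And>x y. v (x + y) \<le> D * v x * v' y" "\<And>x. 0 < v' x"
  shows "\<nu> (nnconv (nnorm f) (nnorm g)) < top"
proof -
  let ?L = "count_space (int_lattice :: (real ^ 'n) set)"
  define a where "a j = (\<integral>\<^sup>+ z. ennreal (norm (f z)) * indicator ((+) j ` cbox 0 1) z \<partial>lborel)" for j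
  define T where "T = (\<integral>\<^sup>+ j. ennpow (a j * ennreal (v j)) r \<partial>?L)"
  have T: "T < top"
  proof -
    have "Lp_norm (lebesgue_on ((+) j ` cbox 0 1)) 1 (nnorm f) = a j" for j
      using Lp_norm_ennreal[of 1 "lebesgue_on ((+) j ` cbox 0 1)" "nnorm f"]
      by (simp add: nn_integral_cell a_def)
    then show ?thesis
      using fin r by (simp add: amalgam_norm_def T_def Lp_norm_ennreal ennpow_less_top_iff)
  qed
  have a: "a j < top" if j: "j \<in> int_lattice" for j
  proof -
    have "ennpow (a j * ennreal (v j)) r \<le> T"
      unfolding T_def by (rule nn_integral_ge_point) fact
    then have "ennpow (a j * ennreal (v j)) r < top"
      using T by (rule order.strict_trans1)
    then show ?thesis using v_pos[of j] by (auto simp: ennpow_less_top_iff ennreal_mult_less_top)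
  qed
  \<comment> \<open>Moderateness of \<open>v\<close> trades \<open>v (j - e)\<close> for
    \<open>v j\<close>, so \<open>V\<close> is bounded by a multiple of \<open>v\<close> and the
    hypothesis on \<open>f\<close> applies.\<close>
  define E where "E = C * (\<Sum>e\<in>(nbhd :: (real ^ 'n) set). D * v' (- e))"
  have E: "0 \<le> E"
    unfolding E_def using C_pos v' by (intro mult_nonneg_nonneg sum_nonneg) (auto simp: less_imp_le)
  have V_le: "V j \<le> E * v j" for j
  proof -
    have "(\<Sum>e\<in>nbhd. v (j - e)) \<le> (\<Sum>e\<in>nbhd. D * v j * v' (- e))"
      using v'(2)[of j "- e" for e] by (intro sum_mono) simp
    also have "\<dots> = (\<Sum>e\<in>nbhd. D * v' (- e)) * v j"
      unfolding sum_distrib_right by (intro sum.cong) (simp_all add: mult_ac)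
    finally show ?thesis
      unfolding V_def E_def using C_pos by (simp add: mult.assoc)
  qed
  have le: "ennpow (a j * ennreal (V j)) s \<le> ennpow (ennreal E) s * ennpow (ennpow (a j * ennreal (v j)) r) (s / r)"
    for j
  proof -
    have "ennpow (a j * ennreal (V j)) s \<le> ennpow (ennreal E * (a j * ennreal (v j))) s"
    proof (rule ennpow_mono)
      have "a j * ennreal (V j) \<le> a j * ennreal (E * v j)"
        by (intro mult_left_mono ennreal_leI V_le) auto
      then show "a j * ennreal (V j) \<le> ennreal E * (a j * ennreal (v j))"
        using E v_pos[of j] by (simp add: ennreal_mult mult_ac)
    qed (use s_pos in simp)
    then show ?thesis
      using r s_pos by (simp add: ennpow_mult ennpow_ennpow del: min_less_iff_conj)
  qed
  have "(\<integral>\<^sup>+ j. ennpow (a j * ennreal (V j)) s \<partial>?L)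
      \<le> (\<integral>\<^sup>+ j. ennpow (ennreal E) s * ennpow (ennpow (a j * ennreal (v j)) r) (s / r) \<partial>?L)"
    by (intro nn_integral_mono le)
  also have "\<dots> = ennpow (ennreal E) s * (\<integral>\<^sup>+ j. ennpow (ennpow (a j * ennreal (v j)) r) (s / r) \<partial>?L)"
    by (rule nn_integral_cmult) simp
  \<comment> \<open>Here \<open>r \<le> s\<close>, because \<open>r\<close> is at most 1 and at most
    \<open>q\<close>: sequences in l^r lie in l^s.\<close>
  also have "\<dots> \<le> ennpow (ennreal E) s * ennpow T (s / r)"
    unfolding T_def using r by (intro mult_left_mono ennpow_sum_ge) auto
  also have "\<dots> < top"
    using T by (simp add: ennreal_mult_less_top ennpow_less_top_iff)
  finally have sum: "(\<integral>\<^sup>+ j. ennpow (a j * ennreal (V j)) s \<partial>?L) < top" .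
  have "\<nu> (nnconv (nnorm f) (nnorm g)) \<le>
      (\<integral>\<^sup>+ j. ennpow (a j * ennreal (V j)) s \<partial>?L) * (of_nat (card (nbhd :: (real ^ 'n) set)) * \<nu> (nnorm g))"
    unfolding a_def using a g by (intro nnconv_bound) (auto simp: a_def)
  also have "\<dots> < top"
    using sum g by (auto simp: ennreal_mult_less_top cn.X_def of_nat_less_top)
  finally show ?thesis .
qed

text \<open>The support meets finitely many cells, so integrability alone suffices for every
  \<open>r\<close> and \<open>v\<close>.\<close>

lemma A_imp_WL:
  assumes f: "f \<in> L1.A" and r: "0 < r"
  shows "f \<in> WL 1 (ennreal r) v"
proof -
  interpret V: amalgam 1 r v
    using r v_pos by unfold_locales auto
  have "amalgam_norm 1 r v (nnorm f) < top"
  proof (rule V.finite_bounded_support[where S = "cbox 0 1"])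
    show "(\<integral>\<^sup>+ x. ennpow (ennreal (norm (f x))) 1 \<partial>lebesgue) < top"
      using f by (simp add: L1.A_def nn_integral_completion)
  qed (use f in \<open>auto simp: L1.A_def intro!: borel_imp_lebesgue\<close>)
  then show ?thesis
    using WL_iff[of r f 1 v] r f by (auto simp: L1.A_def intro: borel_imp_lebesgue)
qed

lemma WL_cong_AE:
  assumes "h \<in> WL (ennreal p) (ennreal q) \<omega>" "AE x in lebesgue. h x = k x"
  shows "k \<in> WL (ennreal p) (ennreal q) \<omega>"
proof -
  have "AE x in lebesgue. nnorm h x = nnorm k x"
    using assms(2) by eventually_elim simp
  then have "\<nu> (nnorm h) = \<nu> (nnorm k)" by (rule cong_AE)
  then show ?thesis
    using assms borel_measurable_AE[of h k] by (simp add: WL_iff q)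
qed

lemma WL_borel_iff: "g \<in> borel_measurable borel \<Longrightarrow> g \<in> WL (ennreal p) (ennreal q) \<omega> \<longleftrightarrow> g \<in> cn.X"
  by (simp add: WL_iff q cn.X_def borel_imp_lebesgue)

end

section \<open>Borel representatives and the two inclusions\<close>

lemma ex_borel_version:
  fixes f :: "real ^ 'n \<Rightarrow> complex"
  assumes "f \<in> borel_measurable lebesgue"
  obtains f' where "f' \<in> borel_measurable borel" "AE x in lebesgue. f x = f' x"
proof -
  have "(\<lambda>x. Re (f x)) \<in> borel_measurable lebesgue" "(\<lambda>x. Im (f x)) \<in> borel_measurable lebesgue"
    by (rule measurable_compose[OF assms], simp)+
  from this[THEN completion_ex_borel_measurable_real]
  obtain a b where ab: "a \<in> borel_measurable lborel" "AE x in lborel. Re (f x) = a x"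
      "b \<in> borel_measurable lborel" "AE x in lborel. Im (f x) = b x"
    by blast
  then have [measurable]: "a \<in> borel_measurable borel" "b \<in> borel_measurable borel" by auto
  have "AE x in lborel. f x = of_real (a x) + \<i> * of_real (b x)"
    using ab(2,4) by eventually_elim (simp add: complex_eq_iff)
  then have "AE x in lebesgue. f x = of_real (a x) + \<i> * of_real (b x)"
    by (simp add: AE_completion_iff)
  moreover have "(\<lambda>x. of_real (a x) + \<i> * of_real (b x)) \<in> borel_measurable borel" by measurable
  ultimately show thesis by (rule that[rotated])
qed

text \<open>Reflections and translations preserve null sets, so a change of representatives affects
  neither integrability nor the value at any point.\<close>

lemma convolve_borel_version:
  fixes f g f' g' :: "real ^ 'n \<Rightarrow> complex"
  assumes [measurable]: "f' \<in> borel_measurable borel" "g' \<in> borel_measurable borel"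
    and f: "AE x in lebesgue. f x = f' x" and g: "AE x in lebesgue. g x = g' x"
  shows "integrable lebesgue (\<lambda>y. f (x - y) * g y) \<longleftrightarrow> integrable lebesgue (\<lambda>y. f' (x - y) * g' y)"
    and "convolve f g x = convolve f' g' x"
proof -
  have "AE y in lborel. f (x - y) = f' (x - y)"
    using f by (intro AE_lborel_reflect) (simp add: AE_completion_iff)
  moreover have "AE y in lborel. g y = g' y"
    using g by (simp add: AE_completion_iff)
  ultimately have "AE y in lborel. f' (x - y) * g' y = f (x - y) * g y"
    by eventually_elim simp
  then have ae: "AE y in lebesgue. f' (x - y) * g' y = f (x - y) * g y"
    by (simp add: AE_completion_iff)
  have m': "(\<lambda>y. f' (x - y) * g' y) \<in> borel_measurable lebesgue"
    by (rule borel_imp_lebesgue) measurable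
  have m: "(\<lambda>y. f (x - y) * g y) \<in> borel_measurable lebesgue"
    by (rule borel_measurable_AE[OF m' ae])
  show "integrable lebesgue (\<lambda>y. f (x - y) * g y) \<longleftrightarrow> integrable lebesgue (\<lambda>y. f' (x - y) * g' y)"
    by (rule integrable_cong_AE[OF m m' AE_symmetric[OF ae]])
  show "convolve f g x = convolve f' g' x"
    unfolding convolve_def by (rule integral_cong_AE[OF m m' AE_symmetric[OF ae]])
qed

theorem theorem3p2:
  fixes r p q :: real and \<omega> v :: "real ^ 'n \<Rightarrow> real"
  assumes "0 < r" "r \<le> 1"
    and "1 \<le> p"
    and "r \<le> q"
    and "\<omega> \<in> P_E" "v \<in> P_E"
    and "moderate v \<omega>"
  shows "(\<forall>f \<in> WL 1 (ennreal r) v. \<forall>g \<in> WL (ennreal p) (ennreal q) \<omega>.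
            convolution_defined f g \<and> convolution_defined g f)
    \<and> conv_set (WL 1 (ennreal r) v) (WL (ennreal p) (ennreal q) \<omega>)
          = conv_set (WL (ennreal p) (ennreal q) \<omega>) (WL 1 (ennreal r) v)
    \<and> conv_set (WL (ennreal p) (ennreal q) \<omega>) (WL 1 (ennreal r) v)
          = WL (ennreal p) (ennreal q) \<omega>"
proof -
  obtain C where C: "0 < C" "\<And>x y. \<omega> (x + y) \<le> C * \<omega> x * v y"
    using assms(7) unfolding moderate_def by blast
  obtain v' D where v': "0 < D" "\<And>x y. v (x + y) \<le> D * v x * v' y" "\<And>x. 0 < v' x"
    using assms(6) unfolding P_E_def moderate_def weight_def by blast
  interpret amalgam_conv p q \<omega> v C
    using assms C by unfold_locales (auto simp: P_E_def weight_def)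
  let ?A = "WL 1 (ennreal r) v" and ?X = "WL (ennreal p) (ennreal q) \<omega>"
  \<comment> \<open>The estimates are made for Borel versions and transferred back. The two orders
    of convolution agree at every point, which gives the equality of the product sets.\<close>
  have conv: "convolution_defined f g \<and> convolution_defined g f \<and>
      (\<forall>x. convolve g f x = convolve f g x) \<and> convolve g f \<in> ?X"
    if f: "f \<in> ?A" and g: "g \<in> ?X" for f g
  proof -
    interpret V: amalgam 1 r v
      using assms(1) v_pos by unfold_locales auto
    have fm: "f \<in> borel_measurable lebesgue" "amalgam_norm 1 r v (nnorm f) < top"
      using f WL_iff[of r f 1 v] assms(1) by auto
    obtain f' where f': "f' \<in> borel_measurable borel" "AE x in lebesgue. f x = f' x"
      using ex_borel_version[OF fm(1)] .
    obtain g' where g': "g' \<in> borel_measurable borel" "AE x in lebesgue. g x = g' x"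
      using ex_borel_version[of g] g by (auto simp: WL_def)
    have "AE x in lebesgue. nnorm f x = nnorm f' x"
      using f'(2) by eventually_elim simp
    from V.cong_AE[OF this] have fin: "amalgam_norm 1 r v (nnorm f') < top"
      using fm(2) by simp
    have g'X: "g' \<in> cn.X"
      using WL_cong_AE[OF g g'(2)] WL_borel_iff[OF g'(1)] by simp
    have nu: "\<nu> (nnconv (nnorm f') (nnorm g')) < top"
      by (rule nnconv_amalgam_finite[OF f'(1) fin g'X assms(1,2,4) v'])
    have ae: "AE x in lborel. nnconv (nnorm f') (nnorm g') x < top"
      using f'(1) g'(1) by (intro cn.N_finite nu nnconv_measurable nnorm_measurable)
    have comm: "convolve g f x = convolve f g x" for x
      using convolve_borel_version(2)[OF f'(1) g'(1) f'(2) g'(2)]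
        convolve_borel_version(2)[OF g'(1) f'(1) g'(2) f'(2)]
        convolve_commute[OF f'(1) g'(1)] by simp
    have "convolve f' g' \<in> cn.X"
    proof -
      have "\<nu> (nnorm (convolve f' g')) \<le> \<nu> (nnconv (nnorm f') (nnorm g'))"
        by (intro mono nnorm_convolve_le f' g')
      then show ?thesis
        using nu convolve_measurable[OF f'(1) g'(1)] by (auto simp: cn.X_def)
    qed
    moreover have "convolve g f = convolve f' g'"
      using comm convolve_borel_version(2)[OF f'(1) g'(1) f'(2) g'(2)] by (intro ext) simp
    ultimately have "convolve g f \<in> ?X"
      using WL_borel_iff[OF convolve_measurable[OF f'(1) g'(1)]] by simp
    moreover have "convolution_defined f g"
      unfolding convolution_defined_def convolve_borel_version(1)[OF f'(1) g'(1) f'(2) g'(2)]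
        convolve_integrable[OF f'(1) g'(1)] using ae by (simp add: AE_completion_iff)
    moreover have "convolution_defined g f"
      unfolding convolution_defined_def convolve_borel_version(1)[OF g'(1) f'(1) g'(2) f'(2)]
        convolve_integrable[OF g'(1) f'(1)]
      using ae nnconv_commute[of "nnorm f'" "nnorm g'"] f'(1) g'(1)
      by (simp add: AE_completion_iff nnorm_measurable)
    ultimately show ?thesis using comm by blast
  qed
  have eq: "conv_set ?A ?X = conv_set ?X ?A"
  proof -
    have "(AE x in lebesgue. h x = convolve f g x) \<longleftrightarrow> (AE x in lebesgue. h x = convolve g f x)"
      if "f \<in> ?A" "g \<in> ?X" for f g h
      using conv[OF that] by simp
    then show ?thesis unfolding conv_set_def by blast
  qed
  have "conv_set ?X ?A \<subseteq> ?X"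
  proof
    fix h assume "h \<in> conv_set ?X ?A"
    then obtain g f where gf: "g \<in> ?X" "f \<in> ?A" "AE x in lebesgue. h x = convolve g f x"
      by (auto simp: conv_set_def)
    show "h \<in> ?X"
      using conv[OF gf(2,1)] WL_cong_AE[OF _ AE_symmetric[OF gf(3)]] by blast
  qed
  moreover have "?X \<subseteq> conv_set ?A ?X"
  proof
    fix h assume h: "h \<in> ?X"
    obtain h' where h': "h' \<in> borel_measurable borel" "AE x in lebesgue. h x = h' x"
      using ex_borel_version[of h] h by (auto simp: WL_def)
    then have "h' \<in> cn.X" using WL_cong_AE[OF h h'(2)] WL_borel_iff[OF h'(1)] by simp
    then obtain f g where fg: "f \<in> L1.A" "g \<in> cn.X" "AE x in lborel. h' x = convolve f g x"
      using factorization by blast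
    have "AE x in lebesgue. h' x = convolve f g x" using fg(3) by (simp add: AE_completion_iff)
    with h'(2) have "AE x in lebesgue. h x = convolve f g x" by eventually_elim simp
    moreover have "f \<in> ?A" using A_imp_WL[OF fg(1) assms(1)] .
    moreover have "g \<in> ?X" using fg(2) WL_borel_iff[of g] by auto
    ultimately show "h \<in> conv_set ?A ?X" unfolding conv_set_def by blast
  qed
  ultimately have "conv_set ?X ?A = ?X" using eq by auto
  with conv eq show ?thesis by simp
qed

end
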